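(* Let $1\le r\le\alpha<\infty$, $\gamma\in\mathbb{R}\setminus\{0\}$, $\eta\in(0,1)$, and $0\le s_0<s<1<q<q_0<\infty$ with $s=(1-\eta)s_0+\eta$ and $\frac1q=\frac{1-\eta}{q_0}+\eta$. If $r=1$ and $\gamma\in(-\infty,0)$, assume further that $\gamma\in(-\infty,-1)$ and $n=1$. Write $X:=M^\alpha_r(\mathbb{R}^n)$. Then there exists $C>0$ such that for every $f\in C^1(\mathbb{R}^n)$ with $|\nabla f|\in C_{\mathrm c}(\mathbb{R}^n)$, $$\sup_{\lambda>0}\lambda\left\|\int_{\mathbb{R}^n}\mathbf{1}_{D_{\lambda,\gamma/q,s}[f]}(\cdot,y)|\cdot-y|^{\gamma-n}dy\right\|_X^{1/q}\le C\left[\sup_{\lambda>0}\lambda\left\|\int_{\mathbb{R}^n}\mathbf{1}_{D_{\lambda,\gamma/q_0,s_0}[f]}(\cdot,y)|\cdot-y|^{\gamma-n}dy\right\|_X^{1/q_0}\right]^{1-\eta}\|\,|\nabla f|\,\|_X^\eta.$$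
   Context: For $0<r\le\alpha<\infty$, the Morrey space $M^\alpha_r(\mathbb{R}^n)$ is the set of measurable $f$ with $\|f\|_{M^\alpha_r}:=\sup_B|B|^{\frac1\alpha-\frac1r}\|f\|_{L^r(B)}<\infty$ (supremum over balls). For $\lambda>0$, $\beta\in\mathbb{R}$, $\sigma\in[0,1]$, $D_{\lambda,\beta,\sigma}[f]:=\{(x,y):x\ne y,\ |f(x)-f(y)|/|x-y|^{\sigma+\beta}>\lambda\}$. *)

theory Defs
  imports "HOL-Analysis.Analysis"
begin

definition epow :: "ennreal \<Rightarrow> real \<Rightarrow> ennreal" where
  "epow x p = (if x = \<infinity> then \<infinity> else ennreal (enn2real x powr p))"

definition morrey_norm :: "real \<Rightarrow> real \<Rightarrow> ('a::euclidean_space \<Rightarrow> ennreal) \<Rightarrow> ennreal" where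
  "morrey_norm \<alpha> r F =
     (SUP x\<in>UNIV. SUP \<rho>\<in>{0<..}.
        ennreal (measure lborel (ball x \<rho>) powr (1/\<alpha> - 1/r)) *
        epow (\<integral>\<^sup>+ y\<in>ball x \<rho>. epow (F y) r \<partial>lborel) (1/r))"

definition Dset :: "real \<Rightarrow> real \<Rightarrow> real \<Rightarrow> ('a::euclidean_space \<Rightarrow> real) \<Rightarrow> ('a \<times> 'a) set" where
  "Dset t \<beta> \<sigma> f = {(x,y). x \<noteq> y \<and> \<bar>f x - f y\<bar> / (dist x y powr (\<sigma> + \<beta>)) > t}"

definition Dint :: "real \<Rightarrow> real \<Rightarrow> real \<Rightarrow> real \<Rightarrow> ('a::euclidean_space \<Rightarrow> real) \<Rightarrow> 'a \<Rightarrow> ennreal" where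
  "Dint t \<beta> \<sigma> \<gamma> f x =
     (\<integral>\<^sup>+ y. indicator (Dset t \<beta> \<sigma> f) (x, y) * ennreal (dist x y powr (\<gamma> - real DIM('a))) \<partial>lborel)"

end

theory Submission
  imports Defs
begin

text \<open>
  The quotient of the left-hand side is the geometric mean of the quotient for \<open>(s0, q0)\<close> and of the
  one for the endpoint \<open>(1, 1)\<close>, so a level set of it is contained in the union of two level sets whose
  levels can be balanced. This reduces the theorem to the endpoint, a weak-type bound by \<open>\<bar>\<nabla> f\<bar>\<close>.

  For the endpoint, \<open>\<bar>f x - f (x + \<rho> u)\<bar>\<close> is at most \<open>\<bar>u\<bar>\<close> times the integral of \<open>\<bar>\<nabla> f\<bar>\<close> along the segment, so
  the inner integral is dominated by an average over directions \<open>u\<close> of a one-dimensional functional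
  of \<open>\<bar>\<nabla> f\<bar>\<close> along rays. On a ball \<open>B(x0, R)\<close>, the part of \<open>\<bar>\<nabla> f\<bar>\<close> outside \<open>B(x0, 2 R)\<close> is controlled pointwise,
  because averaging over directions turns integrals over rays into integrals over balls. The part inside is
  controlled in \<open>L\<^sup>r\<close> by a one-dimensional inequality, transferred to each direction by averaging over
  translations. That inequality follows from a greedy selection of disjoint intervals, and for \<open>r > 1\<close>
  from the one-sided maximal function.
\<close>

section \<open>Powers of extended nonnegative reals\<close>

text \<open>The obstacle is \<open>r = 1\<close>. For \<open>r > 1\<close> the level functional on a
  ray is dominated pointwise by a maximal function, for every nonzero \<gamma>. In L^1 a maximal
  function is only of weak type, so there the level functional itself is integrated: every pair
  (start, length) in its level set is charged to one of finitely many disjoint intervals. These are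
  ranked by the weight \<open>\<rho> powr (1 + \<gamma>)\<close>, not by length, so that a charged
  length is at most a multiple of the selected one if \<gamma> > 0 and at least a multiple of it if
  \<gamma> < -1. In both ranges the remaining integral in \<rho> converges. Directions are taken
  from an annulus, not from the unit sphere, so that averaging over them is integration against
  Lebesgue measure and Tonelli applies; the price is some powers of 2. Translations act along the
  direction of the ray itself, which is what exposes whole lines to the one-dimensional inequality.
  Compact support makes the Morrey norm of the gradient finite, so that the interpolation levels can
  be chosen as real numbers.\<close>

lemma epow_ennreal: "0 \<le> x \<Longrightarrow> epow (ennreal x) p = ennreal (x powr p)"
  by (simp add: epow_def)

lemma epow_top [simp]: "epow top p = top"
  by (simp add: epow_def)

lemma epow_0 [simp]: "epow 0 p = 0"
  by (simp add: epow_def)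

lemma epow_1 [simp]: "epow x 1 = x"
  by (cases x) (auto simp: epow_ennreal)

lemma epow_eq_0_iff [simp]: "epow x p = 0 \<longleftrightarrow> x = 0"
  by (cases x) (auto simp: epow_ennreal ennreal_eq_0_iff)

lemma epow_mono: "x \<le> y \<Longrightarrow> 0 \<le> p \<Longrightarrow> epow x p \<le> epow y p"
  by (cases x; cases y) (auto simp: epow_ennreal top_unique intro!: ennreal_leI powr_mono2)

lemma epow_mult: "epow (x * y) p = epow x p * epow y p"
proof -
  \<comment> \<open>Only mixed products need care: \<open>ennreal a * top\<close> is 0 or
    \<open>top\<close>, and \<open>epow\<close> fixes both values.\<close>
  have *: "epow (ennreal a * top) p = epow (ennreal a) p * top" if "0 \<le> a" for a
    using that by (cases "a = 0") (auto simp: ennreal_mult_top epow_ennreal)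
  show ?thesis
  proof (cases x; cases y)
    fix a b :: real assume "0 \<le> a" "0 \<le> b" "x = ennreal a" "y = ennreal b"
    then show ?thesis
      by (auto simp: epow_ennreal ennreal_mult[symmetric] powr_mult)
  qed (use * in \<open>auto simp: mult.commute\<close>)
qed

lemma epow_epow: "epow (epow x p) p' = epow x (p * p')"
  by (cases x) (auto simp: epow_ennreal powr_powr)

text \<open>Bounding the sum by twice the maximum, and not by convexity, gives a constant valid for
  all nonnegative exponents; it is used with \<open>r\<close> and with \<open>1 / r\<close>.\<close>

lemma epow_add_le:
  assumes "0 \<le> p"
  shows "epow (x + y) p \<le> ennreal (2 powr p) * (epow x p + epow y p)"
proof -
  have "epow (x + y) p \<le> epow (2 * max x y) p"
    using assms by (intro epow_mono) (auto simp: mult_2 max_def intro: add_mono)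
  also have "\<dots> = ennreal (2 powr p) * epow (max x y) p"
    by (metis epow_mult epow_ennreal ennreal_numeral zero_le_numeral)
  also have "epow (max x y) p \<le> epow x p + epow y p"
    by (simp add: max_def)
  finally show ?thesis by (simp add: mult_left_mono)
qed

lemma measurable_epow [measurable]: "(\<lambda>x. epow x p) \<in> borel_measurable borel"
  unfolding epow_def by measurable

section \<open>Power integrals, Jensen's inequality and the layer-cake formula\<close>

lemma nn_integral_powr_from_0:
  assumes "p > -1" "0 \<le> c"
  shows "(\<integral>\<^sup>+x. ennreal (x powr p) * indicator {0..c} x \<partial>lborel) = ennreal (c powr (p+1) / (p+1))"
  by (rule nn_integral_has_integral_lebesgue'[OF _ has_integral_powr_from_0[OF assms]]) auto

lemma nn_integral_powr_to_inf:
  assumes "p < -1" "0 < a"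
  shows "(\<integral>\<^sup>+x. ennreal (x powr p) * indicator {a..} x \<partial>lborel) = ennreal (a powr (p+1) / -(p+1))"
proof -
  have "a powr (p+1) / -(p+1) = - (a powr (p+1)) / (p+1)"
    by (metis minus_divide_left minus_divide_right)
  then show ?thesis
    using nn_integral_has_integral_lebesgue'[OF _ has_integral_powr_to_inf[OF assms]] by simp
qed

text \<open>The graph of \<open>x powr r\<close> lies above its tangent at \<open>a\<close>. This is
  Young's inequality for \<open>x\<close> and \<open>a powr (r - 1)\<close> with the conjugate
  exponents \<open>r\<close> and \<open>r / (r - 1)\<close>.\<close>

lemma powr_tangent_le:
  fixes r a x :: real
  assumes "1 \<le> r" "0 < a" "0 \<le> x"
  shows "r * a powr (r - 1) * x \<le> x powr r + (r - 1) * a powr r"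
proof (cases "r = 1")
  case False
  then have r: "1 < r" using assms by simp
  have "x * a powr (r - 1) \<le> x powr r / r + (a powr (r - 1)) powr (r / (r - 1)) / (r / (r - 1))"
    by (rule Youngs_inequality) (use r assms in \<open>auto simp: field_simps\<close>)
  also have "(a powr (r - 1)) powr (r / (r - 1)) = a powr r"
    using r by (simp add: powr_powr)
  finally show ?thesis using r by (simp add: field_simps)
qed (use assms in simp)

lemma epow_tangent_le:
  assumes "1 \<le> r" "0 < a"
  shows "ennreal (r * a powr (r - 1)) * x \<le> epow x r + ennreal ((r - 1) * a powr r)"
  using powr_tangent_le[OF assms] assms
  by (cases x) (auto simp: epow_ennreal ennreal_mult[symmetric] ennreal_plus[symmetric] 
      simp del: ennreal_plus intro!: ennreal_leI)

text \<open>Jensen's inequality for the power \<open>r\<close>. Integrating the tangent inequality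
  over \<open>A\<close> gives one bound for each tangent point \<open>a\<close>; the mean of
  \<open>F\<close> is the right choice of \<open>a\<close>.\<close>

lemma epow_nn_integral_le:
  assumes "1 \<le> r" and A: "A \<in> sets M" "emeasure M A \<noteq> \<infinity>" "measure M A > 0"
    and [measurable]: "F \<in> borel_measurable M"
  shows "epow (\<integral>\<^sup>+x\<in>A. F x \<partial>M) r \<le> ennreal (measure M A powr (r - 1)) * (\<integral>\<^sup>+x\<in>A. epow (F x) r \<partial>M)"
proof -
  note A(1)[measurable]
  define m where "m = measure M A"
  have m: "0 < m" "emeasure M A = ennreal m"
    using A by (auto simp: m_def emeasure_eq_ennreal_measure)
  have key: "ennreal (r * a powr (r - 1)) * (\<integral>\<^sup>+x\<in>A. F x \<partial>M)
      \<le> (\<integral>\<^sup>+x\<in>A. epow (F x) r \<partial>M) + ennreal ((r - 1) * a powr r * m)" if "0 < a" for a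
  proof -
    have "ennreal (r * a powr (r - 1)) * (\<integral>\<^sup>+x\<in>A. F x \<partial>M)
        = (\<integral>\<^sup>+x. ennreal (r * a powr (r - 1)) * F x * indicator A x \<partial>M)"
      by (subst nn_integral_cmult[symmetric]) (auto simp: mult.assoc)
    also have "\<dots> \<le> (\<integral>\<^sup>+x. epow (F x) r * indicator A x + ennreal ((r - 1) * a powr r) * indicator A x \<partial>M)"
      by (intro nn_integral_mono) (auto simp: indicator_def epow_tangent_le \<open>1 \<le> r\<close> that)
    also have "\<dots> = (\<integral>\<^sup>+x\<in>A. epow (F x) r \<partial>M) + ennreal ((r - 1) * a powr r * m)"
      using assms(1) m by (subst nn_integral_add) (auto simp: nn_integral_cmult_indicator ennreal_mult)
    finally show ?thesis .
  qed
  define I where "I = (\<integral>\<^sup>+x\<in>A. F x \<partial>M)"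
  show ?thesis
  proof (cases I)
    case (real i)
    show ?thesis
    proof (cases "i = 0")
      case False
      then have i: "0 < i" using real by simp
      \<comment> \<open>The mean of \<open>F\<close> over \<open>A\<close>: here the left-hand side
        of \<open>key\<close> is \<open>m * a powr r\<close> plus exactly the error term of the
        right-hand side, which cancels.\<close>
      define a where "a = i / m"
      have a: "0 < a" using i m by (simp add: a_def)
      have "i powr r = m powr (r - 1) * (m * a powr r)"
        using m i by (simp add: a_def powr_divide powr_diff)
      moreover have "ennreal (m * a powr r) \<le> (\<integral>\<^sup>+x\<in>A. epow (F x) r \<partial>M)"
      proof -
        have "r * a powr (r - 1) * i = m * a powr r + (r - 1) * a powr r * m"
        proof -
          have "i = a * m" using m by (simp add: a_def)
          moreover have "a powr (r - 1) * a = a powr r"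
            using a by (simp add: powr_diff)
          ultimately show ?thesis by (metis (no_types, opaque_lifting) add.commute diff_add_cancel distrib_right mult.assoc mult.commute mult_1)
        qed
        then have "ennreal (m * a powr r) + ennreal ((r - 1) * a powr r * m)
            \<le> (\<integral>\<^sup>+x\<in>A. epow (F x) r \<partial>M) + ennreal ((r - 1) * a powr r * m)"
          using key[OF a] real m assms(1) a
          by (simp add: I_def[symmetric] ennreal_mult[symmetric] ennreal_plus[symmetric] del: ennreal_plus)
        then show ?thesis by (simp add: ennreal_add_left_cancel_le add.commute[of _ "ennreal ((r - 1) * a powr r * m)"])
      qed
      ultimately show ?thesis
        using real i m unfolding I_def[symmetric] m_def[symmetric]
        by (auto simp: epow_ennreal ennreal_mult intro!: mult_left_mono)
    qed (use real in \<open>simp add: I_def\<close>)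
  next
    case top
    \<comment> \<open>For an infinite integral any tangent of positive slope carries infinity to the
      right-hand side; the one at 1 is taken.\<close>
    have "top \<le> (\<integral>\<^sup>+x\<in>A. epow (F x) r \<partial>M) + ennreal ((r - 1) * 1 powr r * m)"
      using key[of 1] top assms(1) by (simp add: I_def[symmetric] ennreal_mult_top)
    then have "(\<integral>\<^sup>+x\<in>A. epow (F x) r \<partial>M) = top"
      by (simp add: top_unique)
    then show ?thesis
      using m by (simp add: m_def[symmetric] ennreal_mult_top)
  qed
qed

lemma epow_layer_cake:
  assumes "0 < r"
  shows "epow x r = (\<integral>\<^sup>+t. ennreal (r * t powr (r - 1)) * indicator {t. 0 < t \<and> ennreal t < x} t \<partial>lborel)"
proof -
  have fin: "(\<integral>\<^sup>+t. ennreal (r * t powr (r - 1)) * indicator {t. 0 < t \<and> ennreal t < ennreal c} t \<partial>lborel) 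
      = ennreal (c powr r)" if "0 \<le> c" for c
  proof -
    have "(\<integral>\<^sup>+t. ennreal (r * t powr (r - 1)) * indicator {t. 0 < t \<and> ennreal t < ennreal c} t \<partial>lborel)
        = (\<integral>\<^sup>+t. ennreal r * (ennreal (t powr (r - 1)) * indicator {0..c} t) \<partial>lborel)"
      using AE_lborel_singleton[of "c::real"] AE_lborel_singleton[of "0::real"] assms that
      by (intro nn_integral_cong_AE) (auto simp: indicator_def ennreal_less_iff ennreal_mult elim!: eventually_mono)
    also have "\<dots> = ennreal r * ennreal (c powr r / r)"
      using nn_integral_powr_from_0[of "r - 1" c] assms that by (subst nn_integral_cmult) auto
    also have "\<dots> = ennreal (c powr r)"
      using assms by (subst ennreal_mult[symmetric]) auto
    finally show ?thesis .
  qed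
  show ?thesis
  proof (cases x)
    case top
    \<comment> \<open>Truncation at height \<open>real n powr (1/r)\<close> has integral
      \<open>n\<close>, so the full integral is above every natural number.\<close>
    have "ennreal (real n) \<le> (\<integral>\<^sup>+t. ennreal (r * t powr (r - 1)) * indicator {t. 0 < t \<and> ennreal t < top} t \<partial>lborel)" for n
    proof -
      have "ennreal (real n) = (\<integral>\<^sup>+t. ennreal (r * t powr (r - 1)) * indicator {t. 0 < t \<and> ennreal t < ennreal (real n powr (1/r))} t \<partial>lborel)"
        using assms by (subst fin) (auto simp: powr_powr)
      also have "\<dots> \<le> (\<integral>\<^sup>+t. ennreal (r * t powr (r - 1)) * indicator {t. 0 < t \<and> ennreal t < top} t \<partial>lborel)"
        by (intro nn_integral_mono) (auto simp: indicator_def)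
      finally show ?thesis .
    qed
    then show ?thesis
      unfolding top epow_top
      by (metis ennreal_Ex_less_of_nat ennreal_of_nat_eq_real_of_nat leD less_top)
  qed (use fin in \<open>auto simp: epow_ennreal\<close>)
qed

section \<open>The one-dimensional inequality\<close>

definition ray_int :: "(real \<Rightarrow> ennreal) \<Rightarrow> real \<Rightarrow> ennreal" where
  "ray_int \<phi> \<rho> = (\<integral>\<^sup>+t\<in>{0..\<rho>}. \<phi> t \<partial>lborel)"

text \<open>
  With \<open>\<phi> t = \<bar>\<nabla> f (x + t u)\<bar>\<close> and up to constants, this dominates the part of \<open>Dint 1 \<gamma> 1 \<gamma> f x\<close> that comes
  from the ray \<open>x + \<rho> u\<close>.
\<close>
definition ray_level :: "real \<Rightarrow> (real \<Rightarrow> ennreal) \<Rightarrow> ennreal" where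
  "ray_level \<gamma> \<phi> = (\<integral>\<^sup>+\<rho>. ennreal (\<rho> powr (\<gamma> - 1)) *
     indicator {\<rho>. 0 < \<rho> \<and> ennreal (\<rho> powr (1 + \<gamma>)) < ray_int \<phi> \<rho>} \<rho> \<partial>lborel)"

text \<open>The forward Hardy-Littlewood maximal function of \<phi> at 0; translates of \<phi> give
  its other values. Rational radii make the supremum countable, hence measurable, and
  \<open>ray_int_le_fwd_max\<close> recovers the real ones.\<close>

definition fwd_max :: "(real \<Rightarrow> ennreal) \<Rightarrow> ennreal" where
  "fwd_max \<phi> = (SUP \<rho>\<in>{\<rho>\<in>\<rat>. 0 < \<rho>}. ennreal (1 / \<rho>) * ray_int \<phi> \<rho>)"

text \<open>A Vitali-type selection ranked by \<open>w\<close>, for which the mass of a set is only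
  an upper bound. Picking \<open>j\<close> with \<open>w j\<close> above half the supremum and
  discarding every set that meets \<open>S j\<close> gives the factor 2. The process stops because a
  finite measure has room for only finitely many disjoint sets of mass above
  \<open>m\<close>.\<close>

lemma greedy_disjoint_selection:
  fixes S :: "'i \<Rightarrow> 'a set" and w :: "'i \<Rightarrow> real"
  assumes "finite_measure M" "0 < m"
    and "\<And>i. i \<in> F \<Longrightarrow> S i \<in> sets M \<and> m < w i \<and> w i \<le> measure M (S i)"
  shows "\<exists>C\<subseteq>F. finite C \<and> disjoint_family_on S C \<and> (\<forall>i\<in>F. \<exists>j\<in>C. S i \<inter> S j \<noteq> {} \<and> w i \<le> 2 * w j)"
proof -
  interpret finite_measure M by fact
  \<comment> \<open>Induction on a bound \<open>n\<close> for the size of disjoint subfamilies,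
    which is finite even for an uncountable \<open>F\<close>.\<close>
  have main: "\<exists>C\<subseteq>F. finite C \<and> disjoint_family_on S C \<and> (\<forall>i\<in>F. \<exists>j\<in>C. S i \<inter> S j \<noteq> {} \<and> w i \<le> 2 * w j)"
    if "\<And>i. i \<in> F \<Longrightarrow> S i \<in> sets M \<and> m < w i \<and> w i \<le> measure M (S i)"
      "\<And>C. C \<subseteq> F \<Longrightarrow> finite C \<Longrightarrow> disjoint_family_on S C \<Longrightarrow> card C \<le> n" for n F
    using that
  proof (induction n arbitrary: F)
    case 0
    have "F = {}"
    proof (rule ccontr)
      assume "F \<noteq> {}"
      then obtain i where "i \<in> F" by auto
      with "0.prems"(2)[of "{i}"] show False by (simp add: disjoint_family_on_def)
    qed
    then show ?case by (auto simp: disjoint_family_on_def)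
  next
    case (Suc n)
    show ?case
    proof (cases "F = {}")
      case False
      have bdd: "bdd_above (w ` F)"
        using Suc.prems(1) bounded_measure by (intro bdd_aboveI2[of _ _ "measure M (space M)"]) (meson order_trans)
      have pos: "0 < Sup (w ` F)"
      proof -
        obtain i where i: "i \<in> F" using False by auto
        then have "w i \<le> Sup (w ` F)" by (intro cSUP_upper bdd)
        with Suc.prems(1)[OF i] \<open>0 < m\<close> show ?thesis by linarith
      qed
      then obtain j where j: "j \<in> F" "Sup (w ` F) / 2 < w j"
        using less_cSUP_iff[OF False bdd, of "Sup (w ` F) / 2"] by auto
      have half: "w i \<le> 2 * w j" if "i \<in> F" for i
        using cSUP_upper[OF that bdd] j(2) by linarith
      \<comment> \<open>A disjoint subfamily avoiding \<open>S j\<close> stays disjoint after adding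
        \<open>j\<close>, so its size bound drops to \<open>n\<close>.\<close>
      define F' where "F' = {i\<in>F. S i \<inter> S j = {}}"
      have "\<exists>C\<subseteq>F'. finite C \<and> disjoint_family_on S C \<and> (\<forall>i\<in>F'. \<exists>j\<in>C. S i \<inter> S j \<noteq> {} \<and> w i \<le> 2 * w j)"
      proof (rule Suc.IH)
        show "S i \<in> sets M \<and> m < w i \<and> w i \<le> measure M (S i)" if "i \<in> F'" for i
          using that Suc.prems(1) by (auto simp: F'_def)
        fix C assume C: "C \<subseteq> F'" "finite C" "disjoint_family_on S C"
        have "S j \<noteq> {}" using Suc.prems(1)[OF j(1)] \<open>0 < m\<close> by auto
        then have "j \<notin> C" using C(1) by (auto simp: F'_def)
        moreover have "card (insert j C) \<le> Suc n"
          using C j(1) by (intro Suc.prems(2)) (auto simp: F'_def disjoint_family_on_def)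
        ultimately show "card C \<le> n" using C(2) by simp
      qed
      then obtain C where C: "C \<subseteq> F'" "finite C" "disjoint_family_on S C"
        "\<And>i. i \<in> F' \<Longrightarrow> \<exists>j\<in>C. S i \<inter> S j \<noteq> {} \<and> w i \<le> 2 * w j" by blast
      show ?thesis
      proof (intro exI[of _ "insert j C"] conjI ballI)
        show "disjoint_family_on S (insert j C)"
          using C(1,3) by (auto simp: F'_def disjoint_family_on_def)
        fix i assume "i \<in> F"
        then show "\<exists>j\<in>insert j C. S i \<inter> S j \<noteq> {} \<and> w i \<le> 2 * w j"
          using C(4)[of i] half by (cases "S i \<inter> S j = {}") (auto simp: F'_def)
      qed (use C j in \<open>auto simp: F'_def\<close>)
    qed (auto simp: disjoint_family_on_def)
  qed
  have "card C \<le> nat \<lceil>measure M (space M) / m\<rceil>" if C: "C \<subseteq> F" "finite C" "disjoint_family_on S C" for C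
  proof -
    have "real (card C) * m = (\<Sum>i\<in>C. m)" by simp
    also have "\<dots> \<le> (\<Sum>i\<in>C. measure M (S i))"
      using C assms(3) by (intro sum_mono) force
    also have "\<dots> = measure M (\<Union>i\<in>C. S i)"
      using C assms(3) by (intro finite_measure_finite_Union[symmetric]) auto
    also have "\<dots> \<le> measure M (space M)" by (rule bounded_measure)
    finally have "real (card C) \<le> measure M (space M) / m"
      using \<open>0 < m\<close> by (simp add: field_simps)
    then show ?thesis by linarith
  qed
  then show ?thesis using assms(3) by (intro main) auto
qed

section \<open>Monotonicity and measurability of the ray functionals\<close>

lemma ray_int_mono: "(\<And>t. 0 \<le> t \<Longrightarrow> \<phi> t \<le> \<psi> t) \<Longrightarrow> ray_int \<phi> \<rho> \<le> ray_int \<psi> \<rho>"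
  unfolding ray_int_def by (intro nn_integral_mono) (auto simp: indicator_def)

lemma ray_int_mono_right: "\<rho> \<le> \<rho>' \<Longrightarrow> ray_int \<phi> \<rho> \<le> ray_int \<phi> \<rho>'"
  unfolding ray_int_def by (intro nn_integral_mono) (auto simp: indicator_def)

lemma measurable_ray_int [measurable]:
  assumes [measurable]: "(\<lambda>(p, t). \<Phi> p t) \<in> borel_measurable (M \<Otimes>\<^sub>M borel)" "\<rho> \<in> borel_measurable M"
  shows "(\<lambda>p. ray_int (\<Phi> p) (\<rho> p)) \<in> borel_measurable M"
proof -
  have "ray_int (\<Phi> p) (\<rho> p) = (\<integral>\<^sup>+t. \<Phi> p t * (if 0 \<le> t \<and> t \<le> \<rho> p then 1 else 0) \<partial>lborel)" for p
    unfolding ray_int_def by (intro nn_integral_cong) (auto simp: indicator_def)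
  then show ?thesis by simp
qed

lemma measurable_ray_level [measurable]:
  assumes [measurable]: "(\<lambda>(p, t). \<Phi> p t) \<in> borel_measurable (M \<Otimes>\<^sub>M borel)"
  shows "(\<lambda>p. ray_level \<gamma> (\<Phi> p)) \<in> borel_measurable M"
  unfolding ray_level_def by measurable

lemma measurable_fwd_max [measurable]:
  assumes [measurable]: "(\<lambda>(p, t). \<Phi> p t) \<in> borel_measurable (M \<Otimes>\<^sub>M borel)"
  shows "(\<lambda>p. fwd_max (\<Phi> p)) \<in> borel_measurable M"
proof -
  have "countable {\<rho>::real. \<rho> \<in> \<rat> \<and> 0 < \<rho>}"
    by (rule countable_subset[OF _ countable_rat]) auto
  then show ?thesis
    unfolding fwd_max_def
  proof (rule borel_measurable_SUP)
    fix \<rho> :: real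
    show "(\<lambda>p. ennreal (1 / \<rho>) * ray_int (\<Phi> p) \<rho>) \<in> borel_measurable M"
      by measurable
  qed
qed

lemma ray_int_le_fwd_max:
  assumes "0 < \<rho>"
  shows "ray_int \<phi> \<rho> \<le> ennreal \<rho> * fwd_max \<phi>"
proof (cases "fwd_max \<phi>")
  case (real s)
  have "ray_int \<phi> \<rho> \<le> ennreal (\<rho> * s) + ennreal e" if e: "0 < e" for e
  proof -
    \<comment> \<open>A rational slightly above \<rho>; the denominator \<open>s + 1\<close> keeps
      the error \<open>e * (s / (s + 1))\<close> below \<open>e\<close> and covers
      \<open>s = 0\<close>.\<close>
    obtain p where p: "p \<in> \<rat>" "\<rho> < p" "p < \<rho> + e / (s + 1)"
      using Rats_dense_in_real[of \<rho> "\<rho> + e / (s + 1)"] e real by (auto simp: field_simps add_pos_nonneg)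
    have "ray_int \<phi> \<rho> \<le> ray_int \<phi> p" using p by (intro ray_int_mono_right) simp
    also have "ray_int \<phi> p = ennreal p * (ennreal (1 / p) * ray_int \<phi> p)"
      using p assms by (simp add: mult.assoc[symmetric] ennreal_mult[symmetric])
    also have "\<dots> \<le> ennreal p * fwd_max \<phi>"
      unfolding fwd_max_def using p assms by (intro mult_left_mono SUP_upper) auto
    also have "\<dots> = ennreal (p * s)" using real p assms by (simp add: ennreal_mult)
    also have "p * s \<le> \<rho> * s + e"
    proof -
      have "p * s \<le> (\<rho> + e / (s + 1)) * s" using p real by (intro mult_right_mono) auto
      also have "\<dots> = \<rho> * s + e * (s / (s + 1))" by (simp add: field_simps)
      also have "\<dots> \<le> \<rho> * s + e * 1" using e real by (intro add_left_mono mult_left_mono) auto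
      finally show ?thesis by simp
    qed
    finally show ?thesis using real assms e by (simp add: ennreal_plus[symmetric] ennreal_leI del: ennreal_plus)
  qed
  then have "ray_int \<phi> \<rho> \<le> ennreal (\<rho> * s)" by (rule ennreal_le_epsilon)
  then show ?thesis using real assms by (simp add: ennreal_mult)
qed (use assms in \<open>simp add: ennreal_mult_top\<close>)

lemma less_fwd_max_iff:
  assumes "0 \<le> t"
  shows "ennreal t < fwd_max \<phi> \<longleftrightarrow> (\<exists>\<rho>\<in>\<rat>. 0 < \<rho> \<and> ennreal (t * \<rho>) < ray_int \<phi> \<rho>)"
proof -
  have "ennreal t < ennreal (1 / \<rho>) * s \<longleftrightarrow> ennreal (t * \<rho>) < s" if "0 < \<rho>" for \<rho> s
    using that assms by (cases s) (auto simp: ennreal_mult[symmetric] ennreal_less_iff ennreal_mult_top field_simps)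
  then show ?thesis unfolding fwd_max_def less_SUP_iff by auto
qed

text \<open>The bound turns the level condition into \<open>\<rho> powr \<gamma> < S\<close>, so
  \<rho> lies on one side of a threshold, where \<open>\<rho> powr (\<gamma> - 1)\<close> integrates
  to exactly \<open>S / \<bar>\<gamma>\<bar>\<close>. It serves both the maximal function and the
  far part of the gradient.\<close>

lemma ray_level_le:
  assumes "\<gamma> \<noteq> 0" and S: "\<And>\<rho>. 0 < \<rho> \<Longrightarrow> ray_int \<phi> \<rho> \<le> ennreal \<rho> * S"
  shows "ray_level \<gamma> \<phi> \<le> ennreal (1 / \<bar>\<gamma>\<bar>) * S"
proof (cases S)
  case (real s)
  have less: "\<rho> powr \<gamma> < s" if "0 < \<rho>" "ennreal (\<rho> powr (1 + \<gamma>)) < ray_int \<phi> \<rho>" for \<rho>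
  proof -
    have "ennreal (\<rho> powr (1 + \<gamma>)) < ennreal (\<rho> * s)"
      using that(2) S[OF that(1)] real that by (simp add: ennreal_mult)
    then show ?thesis using that real by (simp add: ennreal_less_iff powr_add)
  qed
  show ?thesis
  proof (cases "s = 0")
    case True
    then have "ray_level \<gamma> \<phi> = (\<integral>\<^sup>+\<rho>. 0 \<partial>(lborel :: real measure))"
      unfolding ray_level_def using less by (intro nn_integral_cong) (fastforce simp: indicator_def)
    then show ?thesis by simp
  next
    case False
    then have s: "0 < s" using real by simp
    \<comment> \<open>The threshold radius: admissible radii lie below it for positive \<gamma> and
      above it for negative \<gamma>.\<close>
    define c where "c = s powr (1 / \<gamma>)"
    have c: "0 < c" "c powr \<gamma> = s" using s assms(1) by (auto simp: c_def powr_powr)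
    show ?thesis
    proof (cases "0 < \<gamma>")
      case True
      have "ray_level \<gamma> \<phi> \<le> (\<integral>\<^sup>+\<rho>. ennreal (\<rho> powr (\<gamma> - 1)) * indicator {0..c} \<rho> \<partial>lborel)"
        unfolding ray_level_def
      proof (intro nn_integral_mono mult_left_mono)
        fix \<rho>
        have "\<rho> \<le> c" if "0 < \<rho>" "ennreal (\<rho> powr (1 + \<gamma>)) < ray_int \<phi> \<rho>"
          using less[OF that] c True powr_less_mono2[of \<gamma> c \<rho>] by fastforce
        then show "indicator {\<rho>. 0 < \<rho> \<and> ennreal (\<rho> powr (1 + \<gamma>)) < ray_int \<phi> \<rho>} \<rho> \<le> (indicator {0..c} \<rho> :: ennreal)"
          by (auto simp: indicator_def)
      qed auto
      also have "\<dots> = ennreal (s / \<gamma>)"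
        using nn_integral_powr_from_0[of "\<gamma> - 1" c] c True by simp
      finally show ?thesis using real True by (simp add: ennreal_mult[symmetric])
    next
      case False
      have "ray_level \<gamma> \<phi> \<le> (\<integral>\<^sup>+\<rho>. ennreal (\<rho> powr (\<gamma> - 1)) * indicator {c..} \<rho> \<partial>lborel)"
        unfolding ray_level_def
      proof (intro nn_integral_mono mult_left_mono)
        fix \<rho>
        have "c \<le> \<rho>" if "0 < \<rho>" "ennreal (\<rho> powr (1 + \<gamma>)) < ray_int \<phi> \<rho>"
          using less[OF that] c False assms(1) that powr_less_mono2_neg[of \<gamma> \<rho> c] by fastforce
        then show "indicator {\<rho>. 0 < \<rho> \<and> ennreal (\<rho> powr (1 + \<gamma>)) < ray_int \<phi> \<rho>} \<rho> \<le> (indicator {c..} \<rho> :: ennreal)"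
          by (auto simp: indicator_def)
      qed auto
      also have "\<dots> = ennreal (s / -\<gamma>)"
        using nn_integral_powr_to_inf[of "\<gamma> - 1" c] c False assms(1) by simp
      finally show ?thesis using real False by (simp add: ennreal_mult[symmetric])
    qed
  qed
qed (use assms in \<open>simp add: ennreal_mult_top\<close>)

section \<open>Interval coverings and bounds for the forward maximal function\<close>

lemma nn_integral_translate:
  fixes a :: "'a::euclidean_space"
  assumes [measurable]: "F \<in> borel_measurable borel"
  shows "(\<integral>\<^sup>+x. F (a + x) \<partial>lborel) = (\<integral>\<^sup>+x. F x \<partial>lborel)"
proof -
  have "(\<integral>\<^sup>+x. F x \<partial>lborel) = (\<integral>\<^sup>+x. F x \<partial>distr lborel borel ((+) a))"
    by (simp only: lborel_distr_plus)
  also have "\<dots> = (\<integral>\<^sup>+x. F (a + x) \<partial>lborel)"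
    by (subst nn_integral_distr) auto
  finally show ?thesis by simp
qed

lemma ray_int_translate:
  assumes [measurable]: "\<phi> \<in> borel_measurable borel"
  shows "ray_int (\<lambda>t. \<phi> (\<tau> + t)) \<rho> = emeasure (density lborel \<phi>) {\<tau>..\<tau>+\<rho>}"
proof -
  have "emeasure (density lborel \<phi>) {\<tau>..\<tau>+\<rho>} = (\<integral>\<^sup>+t. \<phi> t * indicator {\<tau>..\<tau>+\<rho>} t \<partial>lborel)"
    by (simp add: emeasure_density)
  also have "\<dots> = (\<integral>\<^sup>+t. \<phi> (\<tau> + t) * indicator {\<tau>..\<tau>+\<rho>} (\<tau> + t) \<partial>lborel)"
    by (rule nn_integral_translate[symmetric]) measurable
  finally show ?thesis unfolding ray_int_def by (simp add: indicator_def)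
qed

text \<open>The greedy selection for the measure with density \<phi>: disjointness bounds the sum of
  the weights by the total mass. The weight is left open because the weak-type bound takes
  \<open>t * \<rho>\<close> and the L^1 bound takes
  \<open>\<rho> powr (1 + \<gamma>)\<close>.\<close>

lemma interval_selection:
  assumes \<phi> [measurable]: "\<phi> \<in> borel_measurable borel" and fin: "(\<integral>\<^sup>+t. \<phi> t \<partial>lborel) \<noteq> \<infinity>"
    and "0 < m"
    and F: "\<And>\<tau> \<rho>. (\<tau>, \<rho>) \<in> F \<Longrightarrow> m < w \<rho> \<and> ennreal (w \<rho>) < ray_int (\<lambda>t. \<phi> (\<tau> + t)) \<rho>"
  obtains C where "C \<subseteq> F" "finite C"
    "\<And>\<tau> \<rho>. (\<tau>, \<rho>) \<in> F \<Longrightarrow> \<exists>(\<sigma>, l)\<in>C. {\<tau>..\<tau>+\<rho>} \<inter> {\<sigma>..\<sigma>+l} \<noteq> {} \<and> w \<rho> \<le> 2 * w l"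
    "(\<Sum>(\<sigma>, l)\<in>C. ennreal (w l)) \<le> (\<integral>\<^sup>+t. \<phi> t \<partial>lborel)"
proof -
  define M where "M = density lborel \<phi>"
  define S where "S = (\<lambda>(\<tau>, \<rho>). {\<tau>..\<tau>+\<rho>::real})"
  have sp: "emeasure M (space M) = (\<integral>\<^sup>+t. \<phi> t \<partial>lborel)"
    by (simp add: M_def emeasure_density)
  interpret finite_measure M
    by (rule finite_measureI) (use fin sp in auto)
  have *: "S i \<in> sets M \<and> m < w (snd i) \<and> w (snd i) \<le> measure M (S i)" if "i \<in> F" for i
  proof -
    obtain \<tau> \<rho> where i: "i = (\<tau>, \<rho>)" by (cases i)
    have "ennreal (w \<rho>) < emeasure M (S i)"
      using F[of \<tau> \<rho>] that by (auto simp: i M_def S_def ray_int_translate)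
    then have "w \<rho> \<le> measure M (S i)"
      using F[of \<tau> \<rho>] that \<open>0 < m\<close> by (simp add: emeasure_eq_measure ennreal_less_iff i)
    then show ?thesis using F[of \<tau> \<rho>] that by (auto simp: i S_def M_def)
  qed
  obtain C where C: "C \<subseteq> F" "finite C" "disjoint_family_on S C"
    "\<And>i. i \<in> F \<Longrightarrow> \<exists>j\<in>C. S i \<inter> S j \<noteq> {} \<and> w (snd i) \<le> 2 * w (snd j)"
    using greedy_disjoint_selection[OF finite_measure_axioms \<open>0 < m\<close>, of F S "\<lambda>i. w (snd i)"] * by blast
  have "(\<Sum>(\<sigma>, l)\<in>C. ennreal (w l)) \<le> (\<Sum>i\<in>C. emeasure M (S i))"
    using C(1) * by (intro sum_mono) (force simp: emeasure_eq_measure intro!: ennreal_leI)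
  also have "\<dots> = emeasure M (\<Union>i\<in>C. S i)"
    using C * by (intro sum_emeasure) auto
  also have "\<dots> \<le> emeasure M (space M)" by (rule emeasure_space)
  finally have "(\<Sum>(\<sigma>, l)\<in>C. ennreal (w l)) \<le> (\<integral>\<^sup>+t. \<phi> t \<partial>lborel)" by (simp only: sp)
  moreover have "\<exists>(\<sigma>, l)\<in>C. {\<tau>..\<tau>+\<rho>} \<inter> {\<sigma>..\<sigma>+l} \<noteq> {} \<and> w \<rho> \<le> 2 * w l" if "(\<tau>, \<rho>) \<in> F" for \<tau> \<rho>
    using C(4)[OF that] by (force simp: S_def)
  ultimately show ?thesis using C(1,2) that by blast
qed

text \<open>An interval of length at most \<open>2 * l\<close> that meets
  \<open>{\<sigma>..\<sigma>+l}\<close> starts in \<open>{\<sigma> - 2 * l..\<sigma> + l}\<close>,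
  whose length \<open>3 * l\<close> is the origin of the constant 3.\<close>

lemma fwd_max_weak_type:
  assumes \<phi> [measurable]: "\<phi> \<in> borel_measurable borel" and "0 < t"
  shows "emeasure lborel {\<tau>. ennreal t < fwd_max (\<lambda>u. \<phi> (\<tau> + u))} \<le> ennreal (3 / t) * (\<integral>\<^sup>+u. \<phi> u \<partial>lborel)"
proof (cases "(\<integral>\<^sup>+u. \<phi> u \<partial>lborel) = \<infinity>")
  case False
  \<comment> \<open>Radii are kept away from 0, since the selection asks for a positive lower bound
    of the weight; continuity from below removes this restriction.\<close>
  define A where "A k = {\<tau>. \<exists>\<rho>\<in>\<rat>. 1 / real (Suc k) < \<rho> \<and> ennreal (t * \<rho>) < ray_int (\<lambda>u. \<phi> (\<tau> + u)) \<rho>}" for k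
  have [measurable]: "A k \<in> sets borel" for k
  proof -
    have "A k = (\<Union>\<rho>\<in>{\<rho>\<in>\<rat>. 1 / real (Suc k) < \<rho>}. {\<tau>. ennreal (t * \<rho>) < ray_int (\<lambda>u. \<phi> (\<tau> + u)) \<rho>})"
      by (auto simp: A_def)
    also have "\<dots> \<in> sets borel"
      by (intro sets.countable_UN' countable_subset[OF _ countable_rat]) auto
    finally show ?thesis .
  qed
  have "{\<tau>. ennreal t < fwd_max (\<lambda>u. \<phi> (\<tau> + u))} = (\<Union>k. A k)"
  proof (safe, goal_cases)
    case (1 \<tau>)
    then obtain \<rho> where \<rho>: "\<rho> \<in> \<rat>" "0 < \<rho>" "ennreal (t * \<rho>) < ray_int (\<lambda>u. \<phi> (\<tau> + u)) \<rho>"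
      using \<open>0 < t\<close> by (auto simp: less_fwd_max_iff)
    obtain k where "inverse (real (Suc k)) < \<rho>" using reals_Archimedean \<rho>(2) by blast
    then show ?case using \<rho> by (auto simp: A_def inverse_eq_divide)
  next
    case (2 \<tau> k)
    then obtain \<rho> where \<rho>: "\<rho> \<in> \<rat>" "1 / real (Suc k) < \<rho>" "ennreal (t * \<rho>) < ray_int (\<lambda>u. \<phi> (\<tau> + u)) \<rho>"
      by (auto simp: A_def)
    have "0 < 1 / real (Suc k)" by simp
    then have "0 < \<rho>" using \<rho>(2) by linarith
    then show ?case using \<open>0 < t\<close> \<rho> by (auto simp: less_fwd_max_iff)
  qed
  moreover have "emeasure lborel (\<Union>k. A k) = (SUP k. emeasure lborel (A k))"
  proof (rule SUP_emeasure_incseq[symmetric])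
    have "1 / real (Suc l) \<le> 1 / real (Suc k)" if "k \<le> l" for k l
      using that by (intro divide_left_mono) auto
    then show "incseq A"
      unfolding incseq_def A_def by (fastforce intro: le_less_trans)
  qed auto
  moreover have "emeasure lborel (A k) \<le> ennreal (3 / t) * (\<integral>\<^sup>+u. \<phi> u \<partial>lborel)" for k
  proof -
    define F where "F = {(\<tau>, \<rho>). 1 / real (Suc k) < \<rho> \<and> ennreal (t * \<rho>) < ray_int (\<lambda>u. \<phi> (\<tau> + u)) \<rho>}"
    have F: "t / real (Suc k) < t * \<rho> \<and> ennreal (t * \<rho>) < ray_int (\<lambda>u. \<phi> (\<tau> + u)) \<rho>" if "(\<tau>, \<rho>) \<in> F" for \<tau> \<rho>
      using that \<open>0 < t\<close> mult_strict_left_mono[of "1 / real (Suc k)" \<rho> t] by (auto simp: F_def)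
    obtain C where C: "C \<subseteq> F" "finite C"
      "\<And>\<tau> \<rho>. (\<tau>, \<rho>) \<in> F \<Longrightarrow> \<exists>(\<sigma>, l)\<in>C. {\<tau>..\<tau>+\<rho>} \<inter> {\<sigma>..\<sigma>+l} \<noteq> {} \<and> t * \<rho> \<le> 2 * (t * l)"
      "(\<Sum>(\<sigma>, l)\<in>C. ennreal (t * l)) \<le> (\<integral>\<^sup>+u. \<phi> u \<partial>lborel)"
      by (rule interval_selection[OF \<phi> False _ F]) (use \<open>0 < t\<close> in auto)
    have pos: "0 < l" if "(\<sigma>, l) \<in> C" for \<sigma> l
    proof -
      have "0 < 1 / real (Suc k)" by simp
      also have "\<dots> < l" using that C(1) by (auto simp: F_def)
      finally show ?thesis .
    qed
    have "A k \<subseteq> (\<Union>(\<sigma>, l)\<in>C. {\<sigma> - 2 * l..\<sigma> + l})"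
    proof
      fix \<tau> assume "\<tau> \<in> A k"
      then obtain \<rho> where "(\<tau>, \<rho>) \<in> F" by (auto simp: A_def F_def)
      from C(3)[OF this] obtain \<sigma> l where "(\<sigma>, l) \<in> C" "{\<tau>..\<tau>+\<rho>} \<inter> {\<sigma>..\<sigma>+l} \<noteq> {}" "t * \<rho> \<le> t * (2 * l)"
        by auto
      moreover from this have "\<rho> \<le> 2 * l" using \<open>0 < t\<close> by simp
      ultimately show "\<tau> \<in> (\<Union>(\<sigma>, l)\<in>C. {\<sigma> - 2 * l..\<sigma> + l})" by force
    qed
    then have "emeasure lborel (A k) \<le> emeasure lborel (\<Union>(\<sigma>, l)\<in>C. {\<sigma> - 2 * l..\<sigma> + l})"
      by (intro emeasure_mono) (use C(2) in \<open>auto intro!: sets.finite_UN\<close>)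
    also have "\<dots> \<le> (\<Sum>i\<in>C. emeasure lborel (case i of (\<sigma>, l) \<Rightarrow> {\<sigma> - 2 * l..\<sigma> + l}))"
      using C(2) by (intro emeasure_subadditive_finite) auto
    also have "\<dots> = (\<Sum>(\<sigma>, l)\<in>C. ennreal (3 / t) * ennreal (t * l))"
      using pos \<open>0 < t\<close> by (intro sum.cong refl) (force simp: ennreal_mult[symmetric] less_imp_le)
    also have "\<dots> = ennreal (3 / t) * (\<Sum>(\<sigma>, l)\<in>C. ennreal (t * l))"
      by (simp add: sum_distrib_left split_def)
    also have "\<dots> \<le> ennreal (3 / t) * (\<integral>\<^sup>+u. \<phi> u \<partial>lborel)"
      by (intro mult_left_mono C(4)) auto
    finally show ?thesis .
  qed
  ultimately show ?thesis by (simp add: SUP_least)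
qed (use assms in \<open>simp add: ennreal_mult_top\<close>)

text \<open>Values of \<phi> up to \<open>t / 2\<close> contribute at most
  \<open>t / 2 * \<rho>\<close> to \<open>ray_int\<close>, so the larger values must supply the
  rest.\<close>

lemma fwd_max_half:
  assumes [measurable]: "\<phi> \<in> borel_measurable borel" and "0 < t" "ennreal t < fwd_max \<phi>"
  shows "ennreal (t / 2) < fwd_max (\<lambda>u. \<phi> u * indicator {u. ennreal (t / 2) < \<phi> u} u)"
proof -
  define \<psi> where "\<psi> u = \<phi> u * indicator {u. ennreal (t / 2) < \<phi> u} u" for u
  have [measurable]: "\<psi> \<in> borel_measurable borel" unfolding \<psi>_def by measurable
  obtain \<rho> where \<rho>: "\<rho> \<in> \<rat>" "0 < \<rho>" "ennreal (t * \<rho>) < ray_int \<phi> \<rho>"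
    using assms by (auto simp: less_fwd_max_iff)
  have "ray_int \<phi> \<rho> \<le> (\<integral>\<^sup>+u. \<psi> u * indicator {0..\<rho>} u + ennreal (t / 2) * indicator {0..\<rho>} u \<partial>lborel)"
    unfolding ray_int_def by (intro nn_integral_mono) (auto simp: indicator_def \<psi>_def not_less)
  also have "\<dots> = ray_int \<psi> \<rho> + ennreal (t / 2 * \<rho>)"
    using \<rho> \<open>0 < t\<close> by (subst nn_integral_add) (auto simp: ray_int_def nn_integral_cmult_indicator ennreal_mult[symmetric])
  finally have "ennreal (t * \<rho>) < ray_int \<psi> \<rho> + ennreal (t / 2 * \<rho>)" using \<rho>(3) by (rule less_le_trans[rotated])
  then have "ennreal (t / 2 * \<rho>) < ray_int \<psi> \<rho>"
    using \<rho> \<open>0 < t\<close> by (cases "ray_int \<psi> \<rho>") (auto simp: ennreal_less_iff ennreal_plus[symmetric] simp del: ennreal_plus)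
  then show ?thesis using \<rho> \<open>0 < t\<close> unfolding \<psi>_def[symmetric] by (subst less_fwd_max_iff) auto
qed

text \<open>Marcinkiewicz interpolation written out. The layer-cake formula, the weak-type bound for
  \<phi> truncated at \<open>t / 2\<close>, and Tonelli leave an integral of
  \<open>t powr (r - 2)\<close> over \<open>t < 2 * \<phi> u\<close>, finite at 0 because
  \<open>r > 1\<close>. The 6 is the weak-type constant 3 at level \<open>t / 2\<close>; the other
  factors come from the integrals in \<open>t\<close>.\<close>

lemma fwd_max_strong_type:
  assumes \<phi> [measurable]: "\<phi> \<in> borel_measurable borel" and "1 < r"
  shows "(\<integral>\<^sup>+\<tau>. epow (fwd_max (\<lambda>u. \<phi> (\<tau> + u))) r \<partial>lborel)
     \<le> ennreal (6 * r * 2 powr (r - 1) / (r - 1)) * (\<integral>\<^sup>+u. epow (\<phi> u) r \<partial>lborel)"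
proof -
  have "(\<integral>\<^sup>+\<tau>. epow (fwd_max (\<lambda>u. \<phi> (\<tau> + u))) r \<partial>lborel)
     = (\<integral>\<^sup>+\<tau>. \<integral>\<^sup>+t. ennreal (r * t powr (r - 1)) * indicator {t. 0 < t \<and> ennreal t < fwd_max (\<lambda>u. \<phi> (\<tau> + u))} t \<partial>lborel \<partial>lborel)"
    using \<open>1 < r\<close> by (subst epow_layer_cake) auto
  also have "\<dots> = (\<integral>\<^sup>+t. \<integral>\<^sup>+\<tau>. ennreal (r * t powr (r - 1)) * indicator {t. 0 < t \<and> ennreal t < fwd_max (\<lambda>u. \<phi> (\<tau> + u))} t \<partial>lborel \<partial>lborel)"
    by (rule lborel_pair.Fubini'[symmetric]) measurable
  \<comment> \<open>The constant is normalised so that after Tonelli the inner integral is the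
    layer-cake formula for \<open>2 * \<phi> u\<close> with exponent \<open>r - 1\<close>.\<close>
  also have "\<dots> \<le> (\<integral>\<^sup>+t. \<integral>\<^sup>+u. ennreal (6 * r / (r - 1)) * \<phi> u * (ennreal ((r - 1) * t powr ((r - 1) - 1)) * indicator {t. 0 < t \<and> ennreal t < 2 * \<phi> u} t) \<partial>lborel \<partial>lborel)"
  proof (rule nn_integral_mono)
    fix t :: real
    show "(\<integral>\<^sup>+\<tau>. ennreal (r * t powr (r - 1)) * indicator {t. 0 < t \<and> ennreal t < fwd_max (\<lambda>u. \<phi> (\<tau> + u))} t \<partial>lborel)
      \<le> (\<integral>\<^sup>+u. ennreal (6 * r / (r - 1)) * \<phi> u * (ennreal ((r - 1) * t powr ((r - 1) - 1)) * indicator {t. 0 < t \<and> ennreal t < 2 * \<phi> u} t) \<partial>lborel)"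
    proof (cases "0 < t")
      case True
      define \<psi> where "\<psi> u = \<phi> u * indicator {u. ennreal (t / 2) < \<phi> u} u" for u
      have [measurable]: "\<psi> \<in> borel_measurable borel" unfolding \<psi>_def by measurable
      have "(\<integral>\<^sup>+\<tau>. ennreal (r * t powr (r - 1)) * indicator {t. 0 < t \<and> ennreal t < fwd_max (\<lambda>u. \<phi> (\<tau> + u))} t \<partial>lborel)
        \<le> (\<integral>\<^sup>+\<tau>. ennreal (r * t powr (r - 1)) * indicator {\<tau>. ennreal (t / 2) < fwd_max (\<lambda>u. \<psi> (\<tau> + u))} \<tau> \<partial>lborel)"
      proof (intro nn_integral_mono mult_left_mono)
        fix \<tau>
        have "ennreal (t / 2) < fwd_max (\<lambda>u. \<psi> (\<tau> + u))" if "ennreal t < fwd_max (\<lambda>u. \<phi> (\<tau> + u))"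
          using fwd_max_half[OF _ True that] by (simp add: \<psi>_def indicator_def)
        then show "indicator {t. 0 < t \<and> ennreal t < fwd_max (\<lambda>u. \<phi> (\<tau> + u))} t
            \<le> (indicator {\<tau>. ennreal (t / 2) < fwd_max (\<lambda>u. \<psi> (\<tau> + u))} \<tau> :: ennreal)"
          by (auto simp: indicator_def)
      qed auto
      also have "\<dots> = ennreal (r * t powr (r - 1)) * emeasure lborel {\<tau>. ennreal (t / 2) < fwd_max (\<lambda>u. \<psi> (\<tau> + u))}"
        by (intro nn_integral_cmult_indicator) measurable
      also have "\<dots> \<le> ennreal (r * t powr (r - 1)) * (ennreal (3 / (t / 2)) * (\<integral>\<^sup>+u. \<psi> u \<partial>lborel))"
        using True by (intro mult_left_mono fwd_max_weak_type) auto
      also have "\<dots> = ennreal (r * t powr (r - 1) * (3 / (t / 2))) * (\<integral>\<^sup>+u. \<psi> u \<partial>lborel)"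
        using True \<open>1 < r\<close> by (simp add: ennreal_mult[symmetric] mult.assoc[symmetric])
      also have "\<dots> = (\<integral>\<^sup>+u. ennreal (r * t powr (r - 1) * (3 / (t / 2))) * \<psi> u \<partial>lborel)"
        by (simp add: nn_integral_cmult)
      also have "\<dots> = (\<integral>\<^sup>+u. ennreal (6 * r / (r - 1)) * \<phi> u * (ennreal ((r - 1) * t powr ((r - 1) - 1)) * indicator {t. 0 < t \<and> ennreal t < 2 * \<phi> u} t) \<partial>lborel)"
      proof (intro nn_integral_cong)
        fix u
        have "ennreal (t / 2) < \<phi> u \<longleftrightarrow> ennreal t < 2 * \<phi> u"
          using True by (cases "\<phi> u") (auto simp: ennreal_less_iff ennreal_mult_top ennreal_numeral[symmetric] ennreal_mult[symmetric] simp del: ennreal_numeral)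
        moreover have "ennreal (r * t powr (r - 1) * (3 / (t / 2))) = ennreal (6 * r / (r - 1)) * ennreal ((r - 1) * t powr ((r - 1) - 1))"
          using \<open>1 < r\<close> True by (subst ennreal_mult[symmetric]) (auto simp: powr_diff field_simps power2_eq_square)
        ultimately show "ennreal (r * t powr (r - 1) * (3 / (t / 2))) * \<psi> u
          = ennreal (6 * r / (r - 1)) * \<phi> u * (ennreal ((r - 1) * t powr ((r - 1) - 1)) * indicator {t. 0 < t \<and> ennreal t < 2 * \<phi> u} t)"
          using True by (simp only: \<psi>_def indicator_def mem_Collect_eq simp_thms mult_ac)
      qed
      finally show ?thesis .
    qed simp
  qed
  also have "\<dots> = (\<integral>\<^sup>+u. \<integral>\<^sup>+t. ennreal (6 * r / (r - 1)) * \<phi> u * (ennreal ((r - 1) * t powr ((r - 1) - 1)) * indicator {t. 0 < t \<and> ennreal t < 2 * \<phi> u} t) \<partial>lborel \<partial>lborel)"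
    by (rule lborel_pair.Fubini') measurable
  also have "\<dots> = (\<integral>\<^sup>+u. ennreal (6 * r / (r - 1)) * \<phi> u * epow (2 * \<phi> u) (r - 1) \<partial>lborel)"
    using \<open>1 < r\<close> by (subst nn_integral_cmult) (auto simp: epow_layer_cake[of "r - 1"])
  also have "\<dots> = (\<integral>\<^sup>+u. ennreal (6 * r * 2 powr (r - 1) / (r - 1)) * epow (\<phi> u) r \<partial>lborel)"
  proof (intro nn_integral_cong)
    fix u
    have e2: "epow 2 (r - 1) = ennreal (2 powr (r - 1))"
      using epow_ennreal[of 2 "r - 1"] by simp
    have "\<phi> u * epow (\<phi> u) (r - 1) = epow (\<phi> u) r"
      using \<open>1 < r\<close> by (cases "\<phi> u") (auto simp: epow_ennreal ennreal_mult[symmetric] powr_mult_base ennreal_mult_top)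
    then have "ennreal (6 * r / (r - 1)) * \<phi> u * epow (2 * \<phi> u) (r - 1)
      = ennreal (6 * r / (r - 1)) * ennreal (2 powr (r - 1)) * epow (\<phi> u) r"
      unfolding epow_mult e2 by (metis mult.assoc mult.commute)
    also have "ennreal (6 * r / (r - 1)) * ennreal (2 powr (r - 1)) = ennreal (6 * r * 2 powr (r - 1) / (r - 1))"
      using \<open>1 < r\<close> by (simp add: ennreal_mult[symmetric])
    finally show "ennreal (6 * r / (r - 1)) * \<phi> u * epow (2 * \<phi> u) (r - 1)
      = ennreal (6 * r * 2 powr (r - 1) / (r - 1)) * epow (\<phi> u) r" .
  qed
  also have "\<dots> = ennreal (6 * r * 2 powr (r - 1) / (r - 1)) * (\<integral>\<^sup>+u. epow (\<phi> u) r \<partial>lborel)"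
    by (rule nn_integral_cmult) measurable
  finally show ?thesis .
qed

text \<open>The cost of one selected interval of length \<open>l\<close>: for each \<rho> the
  starting points fill a length \<open>l + \<rho>\<close>. With
  \<open>k = 2 powr (1 / (1 + \<gamma>))\<close> the weight condition means
  \<open>\<rho> \<le> k * l\<close> for \<gamma> > 0 and \<open>k * l \<le> \<rho>\<close> for
  \<gamma> < -1. For -1 < \<gamma> < 0 the range would reach down to 0, where
  \<open>\<rho> powr (\<gamma> - 1)\<close> is not integrable.\<close>

lemma nn_integral_level_weight:
  assumes "0 < \<gamma> \<or> \<gamma> < -1"
  obtains K where "0 < K" "\<And>l. 0 < l \<Longrightarrow>
    (\<integral>\<^sup>+\<rho>. ennreal ((l + \<rho>) * \<rho> powr (\<gamma> - 1)) * indicator {\<rho>. 0 < \<rho> \<and> \<rho> powr (1 + \<gamma>) \<le> 2 * l powr (1 + \<gamma>)} \<rho> \<partial>lborel)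
      \<le> ennreal (K * l powr (1 + \<gamma>))"
proof -
  define k where "k = 2 powr (1 / (1 + \<gamma>))"
  have k: "0 < k" by (simp add: k_def)
  have root: "(x powr (1 + \<gamma>)) powr (1 / (1 + \<gamma>)) = x" if "0 < x" for x
    using that assms by (auto simp: powr_powr)
  have kl: "(2 * l powr (1 + \<gamma>)) powr (1 / (1 + \<gamma>)) = k * l" if "0 < l" for l
    using that by (simp add: powr_mult root k_def)
  from assms show ?thesis
  proof
    assume \<gamma>: "0 < \<gamma>"
    show ?thesis
    proof (rule that)
      show "0 < (1 + k) * k powr \<gamma> / \<gamma>" using k \<gamma> by simp
      fix l :: real assume l: "0 < l"
      have "(\<integral>\<^sup>+\<rho>. ennreal ((l + \<rho>) * \<rho> powr (\<gamma> - 1)) * indicator {\<rho>. 0 < \<rho> \<and> \<rho> powr (1 + \<gamma>) \<le> 2 * l powr (1 + \<gamma>)} \<rho> \<partial>lborel)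
        \<le> (\<integral>\<^sup>+\<rho>. ennreal ((1 + k) * l) * (ennreal (\<rho> powr (\<gamma> - 1)) * indicator {0..k * l} \<rho>) \<partial>lborel)"
      proof (intro nn_integral_mono)
        fix \<rho> :: real
        have le: "\<rho> \<le> k * l" if "0 < \<rho>" "\<rho> powr (1 + \<gamma>) \<le> 2 * l powr (1 + \<gamma>)"
          using powr_mono2[OF _ _ that(2), of "1 / (1 + \<gamma>)"] that(1) \<gamma> l by (simp add: root kl)
        moreover have "(l + \<rho>) * \<rho> powr (\<gamma> - 1) \<le> (1 + k) * l * \<rho> powr (\<gamma> - 1)" if "\<rho> \<le> k * l"
          using that by (intro mult_right_mono) (auto simp: algebra_simps)
        ultimately show "ennreal ((l + \<rho>) * \<rho> powr (\<gamma> - 1)) * indicator {\<rho>. 0 < \<rho> \<and> \<rho> powr (1 + \<gamma>) \<le> 2 * l powr (1 + \<gamma>)} \<rho>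
          \<le> ennreal ((1 + k) * l) * (ennreal (\<rho> powr (\<gamma> - 1)) * indicator {0..k * l} \<rho>)"
          using k l by (auto simp: indicator_def ennreal_mult[symmetric] intro!: ennreal_leI)
      qed
      also have "\<dots> = ennreal ((1 + k) * l) * ennreal ((k * l) powr \<gamma> / \<gamma>)"
        using nn_integral_powr_from_0[of "\<gamma> - 1" "k * l"] \<gamma> k l by (subst nn_integral_cmult) auto
      also have "\<dots> = ennreal ((1 + k) * k powr \<gamma> / \<gamma> * l powr (1 + \<gamma>))"
        using \<gamma> k l by (simp add: ennreal_mult[symmetric] powr_mult powr_add mult_ac)
      finally show "(\<integral>\<^sup>+\<rho>. ennreal ((l + \<rho>) * \<rho> powr (\<gamma> - 1)) * indicator {\<rho>. 0 < \<rho> \<and> \<rho> powr (1 + \<gamma>) \<le> 2 * l powr (1 + \<gamma>)} \<rho> \<partial>lborel)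
        \<le> ennreal ((1 + k) * k powr \<gamma> / \<gamma> * l powr (1 + \<gamma>))" .
    qed
  next
    assume \<gamma>: "\<gamma> < -1"
    show ?thesis
    proof (rule that)
      show "0 < (1 / k + 1) * k powr (1 + \<gamma>) / -(\<gamma> + 1)" using k \<gamma> by (intro divide_pos_pos mult_pos_pos add_pos_pos) auto
      fix l :: real assume l: "0 < l"
      have "(\<integral>\<^sup>+\<rho>. ennreal ((l + \<rho>) * \<rho> powr (\<gamma> - 1)) * indicator {\<rho>. 0 < \<rho> \<and> \<rho> powr (1 + \<gamma>) \<le> 2 * l powr (1 + \<gamma>)} \<rho> \<partial>lborel)
        \<le> (\<integral>\<^sup>+\<rho>. ennreal (1 / k + 1) * (ennreal (\<rho> powr \<gamma>) * indicator {k * l..} \<rho>) \<partial>lborel)"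
      proof (intro nn_integral_mono)
        fix \<rho> :: real
        have le: "k * l \<le> \<rho>" if "0 < \<rho>" "\<rho> powr (1 + \<gamma>) \<le> 2 * l powr (1 + \<gamma>)"
          using powr_mono2'[OF _ _ that(2), of "1 / (1 + \<gamma>)"] that(1) \<gamma> l by (simp add: root kl)
        \<comment> \<open>Here \<open>l\<close> is absorbed into \<rho>, the reverse of the case of
          positive \<gamma>; what remains is integrable at infinity because \<gamma> < -1.\<close>
        moreover have "(l + \<rho>) * \<rho> powr (\<gamma> - 1) \<le> (1 / k + 1) * \<rho> powr \<gamma>" if "0 < \<rho>" "k * l \<le> \<rho>"
        proof -
          have "(l + \<rho>) * \<rho> powr (\<gamma> - 1) \<le> ((1 / k + 1) * \<rho>) * \<rho> powr (\<gamma> - 1)"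
            using that k by (intro mult_right_mono) (auto simp: field_simps)
          then show ?thesis using that by (simp add: powr_diff)
        qed
        ultimately show "ennreal ((l + \<rho>) * \<rho> powr (\<gamma> - 1)) * indicator {\<rho>. 0 < \<rho> \<and> \<rho> powr (1 + \<gamma>) \<le> 2 * l powr (1 + \<gamma>)} \<rho>
          \<le> ennreal (1 / k + 1) * (ennreal (\<rho> powr \<gamma>) * indicator {k * l..} \<rho>)"
          using k by (auto simp: indicator_def ennreal_mult[symmetric] simp del: ennreal_plus intro!: ennreal_leI)
      qed
      also have "\<dots> = ennreal (1 / k + 1) * ennreal ((k * l) powr (\<gamma> + 1) / -(\<gamma> + 1))"
        using nn_integral_powr_to_inf[of "\<gamma>" "k * l"] \<gamma> k l by (subst nn_integral_cmult) auto
      also have "\<dots> = ennreal ((1 / k + 1) * k powr (1 + \<gamma>) / -(\<gamma> + 1) * l powr (1 + \<gamma>))"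
        using \<gamma> k l by (subst ennreal_mult[symmetric]) (auto simp: powr_mult add.commute mult_ac intro!: divide_nonneg_nonneg)
      finally show "(\<integral>\<^sup>+\<rho>. ennreal ((l + \<rho>) * \<rho> powr (\<gamma> - 1)) * indicator {\<rho>. 0 < \<rho> \<and> \<rho> powr (1 + \<gamma>) \<le> 2 * l powr (1 + \<gamma>)} \<rho> \<partial>lborel)
        \<le> ennreal ((1 / k + 1) * k powr (1 + \<gamma>) / -(\<gamma> + 1) * l powr (1 + \<gamma>))" .
    qed
  qed
qed

text \<open>Takes the place of the maximal function, which is not bounded on L^1. Each selected
  interval costs at most a multiple of \<open>l powr (1 + \<gamma>)\<close>, and the selection
  bounds the sum of these by the mass of \<phi>.\<close>

lemma ray_level_L1:
  assumes "0 < \<gamma> \<or> \<gamma> < -1"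
  obtains K where "0 < K" "\<And>\<phi>. \<phi> \<in> borel_measurable borel \<Longrightarrow>
    (\<integral>\<^sup>+\<tau>. ray_level \<gamma> (\<lambda>u. \<phi> (\<tau> + u)) \<partial>lborel) \<le> ennreal K * (\<integral>\<^sup>+u. \<phi> u \<partial>lborel)"
proof -
  obtain K where K: "0 < K" "\<And>l. 0 < l \<Longrightarrow>
    (\<integral>\<^sup>+\<rho>. ennreal ((l + \<rho>) * \<rho> powr (\<gamma> - 1)) * indicator {\<rho>. 0 < \<rho> \<and> \<rho> powr (1 + \<gamma>) \<le> 2 * l powr (1 + \<gamma>)} \<rho> \<partial>lborel)
      \<le> ennreal (K * l powr (1 + \<gamma>))"
    using nn_integral_level_weight[OF assms] by blast
  have "(\<integral>\<^sup>+\<tau>. ray_level \<gamma> (\<lambda>u. \<phi> (\<tau> + u)) \<partial>lborel) \<le> ennreal K * (\<integral>\<^sup>+u. \<phi> u \<partial>lborel)"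
    if \<phi> [measurable]: "\<phi> \<in> borel_measurable borel" for \<phi>
  proof (cases "(\<integral>\<^sup>+u. \<phi> u \<partial>lborel) = \<infinity>")
    case False
    \<comment> \<open>The lower bound on the weight makes the selection applicable; monotone
      convergence in \<open>k\<close> removes it.\<close>
    define F where "F k = {(\<tau>, \<rho>). 0 < \<rho> \<and> 1 / real (Suc k) < \<rho> powr (1 + \<gamma>)
        \<and> ennreal (\<rho> powr (1 + \<gamma>)) < ray_int (\<lambda>u. \<phi> (\<tau> + u)) \<rho>}" for k
    have [measurable]: "F k \<in> sets (borel \<Otimes>\<^sub>M borel)" for k
    proof -
      have "Measurable.pred (borel \<Otimes>\<^sub>M borel) (\<lambda>p. 0 < snd p \<and> 1 / real (Suc k) < snd p powr (1 + \<gamma>)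
        \<and> ennreal (snd p powr (1 + \<gamma>)) < ray_int (\<lambda>u. \<phi> (fst p + u)) (snd p))"
        by measurable
      then show ?thesis by (simp add: pred_def F_def split_def space_pair_measure)
    qed
    have step: "(\<integral>\<^sup>+\<tau>. \<integral>\<^sup>+\<rho>. ennreal (\<rho> powr (\<gamma> - 1)) * indicator (F k) (\<tau>, \<rho>) \<partial>lborel \<partial>lborel)
        \<le> ennreal K * (\<integral>\<^sup>+u. \<phi> u \<partial>lborel)" for k
    proof -
      obtain C where C: "C \<subseteq> F k" "finite C"
        "\<And>\<tau> \<rho>. (\<tau>, \<rho>) \<in> F k \<Longrightarrow> \<exists>(\<sigma>, l)\<in>C. {\<tau>..\<tau>+\<rho>} \<inter> {\<sigma>..\<sigma>+l} \<noteq> {} \<and> \<rho> powr (1 + \<gamma>) \<le> 2 * l powr (1 + \<gamma>)"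
        "(\<Sum>(\<sigma>, l)\<in>C. ennreal (l powr (1 + \<gamma>))) \<le> (\<integral>\<^sup>+u. \<phi> u \<partial>lborel)"
        by (rule interval_selection[OF \<phi> False, of "1 / real (Suc k)" "F k" "\<lambda>\<rho>. \<rho> powr (1 + \<gamma>)"])
          (auto simp: F_def)
      define G where "G l = {\<rho>::real. 0 < \<rho> \<and> \<rho> powr (1 + \<gamma>) \<le> 2 * l powr (1 + \<gamma>)}" for l
      have [measurable]: "G l \<in> sets borel" for l unfolding G_def by measurable
      have pos: "0 < l" if "(\<sigma>, l) \<in> C" for \<sigma> l using that C(1) by (auto simp: F_def)
      have "(\<integral>\<^sup>+\<tau>. \<integral>\<^sup>+\<rho>. ennreal (\<rho> powr (\<gamma> - 1)) * indicator (F k) (\<tau>, \<rho>) \<partial>lborel \<partial>lborel)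
        = (\<integral>\<^sup>+\<rho>. \<integral>\<^sup>+\<tau>. ennreal (\<rho> powr (\<gamma> - 1)) * indicator (F k) (\<tau>, \<rho>) \<partial>lborel \<partial>lborel)"
        by (rule lborel_pair.Fubini'[symmetric]) measurable
      \<comment> \<open>\<open>{\<tau>..\<tau>+\<rho>}\<close> meets
        \<open>{\<sigma>..\<sigma>+l}\<close> only if \<tau> lies in
        \<open>{\<sigma> - \<rho>..\<sigma> + l}\<close>, which has length
        \<open>l + \<rho>\<close>.\<close>
      also have "\<dots> \<le> (\<integral>\<^sup>+\<rho>. \<integral>\<^sup>+\<tau>. (\<Sum>(\<sigma>, l)\<in>C. ennreal (\<rho> powr (\<gamma> - 1)) * indicator (G l) \<rho> * indicator {\<sigma> - \<rho>..\<sigma> + l} \<tau>) \<partial>lborel \<partial>lborel)"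
      proof (intro nn_integral_mono)
        fix \<rho> \<tau> :: real
        show "ennreal (\<rho> powr (\<gamma> - 1)) * indicator (F k) (\<tau>, \<rho>)
          \<le> (\<Sum>(\<sigma>, l)\<in>C. ennreal (\<rho> powr (\<gamma> - 1)) * indicator (G l) \<rho> * indicator {\<sigma> - \<rho>..\<sigma> + l} \<tau>)"
        proof (cases "(\<tau>, \<rho>) \<in> F k")
          case True
          from C(3)[OF this] obtain \<sigma> l where J: "(\<sigma>, l) \<in> C" "{\<tau>..\<tau>+\<rho>} \<inter> {\<sigma>..\<sigma>+l} \<noteq> {}" "\<rho> powr (1 + \<gamma>) \<le> 2 * l powr (1 + \<gamma>)"
            by auto
          have "\<tau> \<in> {\<sigma> - \<rho>..\<sigma> + l}" using J(2) by auto
          moreover have "\<rho> \<in> G l" using J(3) True by (auto simp: G_def F_def)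
          ultimately have "ennreal (\<rho> powr (\<gamma> - 1)) * indicator (F k) (\<tau>, \<rho>)
            = (case (\<sigma>, l) of (\<sigma>, l) \<Rightarrow> ennreal (\<rho> powr (\<gamma> - 1)) * indicator (G l) \<rho> * indicator {\<sigma> - \<rho>..\<sigma> + l} \<tau>)"
            using True by simp
          also have "\<dots> \<le> (\<Sum>(\<sigma>, l)\<in>C. ennreal (\<rho> powr (\<gamma> - 1)) * indicator (G l) \<rho> * indicator {\<sigma> - \<rho>..\<sigma> + l} \<tau>)"
            using C(2) J(1) by (intro member_le_sum) auto
          finally show ?thesis .
        qed simp
      qed
      also have "\<dots> = (\<integral>\<^sup>+\<rho>. (\<Sum>(\<sigma>, l)\<in>C. ennreal ((l + \<rho>) * \<rho> powr (\<gamma> - 1)) * indicator (G l) \<rho>) \<partial>lborel)"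
      proof (intro nn_integral_cong)
        fix \<rho> :: real
        have "(\<integral>\<^sup>+\<tau>. (\<Sum>(\<sigma>, l)\<in>C. ennreal (\<rho> powr (\<gamma> - 1)) * indicator (G l) \<rho> * indicator {\<sigma> - \<rho>..\<sigma> + l} \<tau>) \<partial>lborel)
          = (\<Sum>(\<sigma>, l)\<in>C. ennreal (\<rho> powr (\<gamma> - 1)) * indicator (G l) \<rho> * emeasure lborel {\<sigma> - \<rho>..\<sigma> + l})"
          unfolding split_def by (subst nn_integral_sum) (auto intro!: sum.cong nn_integral_cmult_indicator)
        also have "\<dots> = (\<Sum>(\<sigma>, l)\<in>C. ennreal ((l + \<rho>) * \<rho> powr (\<gamma> - 1)) * indicator (G l) \<rho>)"
        proof (intro sum.cong refl, clarify)
          fix \<sigma> l assume "(\<sigma>, l) \<in> C"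
          then show "ennreal (\<rho> powr (\<gamma> - 1)) * indicator (G l) \<rho> * emeasure lborel {\<sigma> - \<rho>..\<sigma> + l}
            = ennreal ((l + \<rho>) * \<rho> powr (\<gamma> - 1)) * indicator (G l) \<rho>"
            using pos[of \<sigma> l] by (auto simp: G_def indicator_def ennreal_mult[symmetric] add.commute mult.commute simp del: ennreal_plus)
        qed
        finally show "(\<integral>\<^sup>+\<tau>. (\<Sum>(\<sigma>, l)\<in>C. ennreal (\<rho> powr (\<gamma> - 1)) * indicator (G l) \<rho> * indicator {\<sigma> - \<rho>..\<sigma> + l} \<tau>) \<partial>lborel)
          = (\<Sum>(\<sigma>, l)\<in>C. ennreal ((l + \<rho>) * \<rho> powr (\<gamma> - 1)) * indicator (G l) \<rho>)" .
      qed
      also have "\<dots> = (\<Sum>(\<sigma>, l)\<in>C. \<integral>\<^sup>+\<rho>. ennreal ((l + \<rho>) * \<rho> powr (\<gamma> - 1)) * indicator (G l) \<rho> \<partial>lborel)"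
        unfolding split_def by (subst nn_integral_sum) auto
      also have "\<dots> \<le> (\<Sum>(\<sigma>, l)\<in>C. ennreal K * ennreal (l powr (1 + \<gamma>)))"
        using K pos by (intro sum_mono) (auto simp: ennreal_mult[symmetric] G_def)
      also have "\<dots> = ennreal K * (\<Sum>(\<sigma>, l)\<in>C. ennreal (l powr (1 + \<gamma>)))"
        by (simp add: sum_distrib_left split_def del: sum_ennreal)
      also have "\<dots> \<le> ennreal K * (\<integral>\<^sup>+u. \<phi> u \<partial>lborel)"
        by (intro mult_left_mono C(4)) auto
      finally show ?thesis .
    qed
    have F_mono: "F k \<subseteq> F l" if "k \<le> l" for k l
    proof -
      have "1 / real (Suc l) \<le> 1 / real (Suc k)" using that by (intro divide_left_mono) auto
      then show ?thesis unfolding F_def by auto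
    qed
    have ray_level: "ray_level \<gamma> (\<lambda>u. \<phi> (\<tau> + u)) = (SUP k. \<integral>\<^sup>+\<rho>. ennreal (\<rho> powr (\<gamma> - 1)) * indicator (F k) (\<tau>, \<rho>) \<partial>lborel)" for \<tau>
    proof -
      have "ray_level \<gamma> (\<lambda>u. \<phi> (\<tau> + u)) = (\<integral>\<^sup>+\<rho>. (SUP k. ennreal (\<rho> powr (\<gamma> - 1)) * indicator (F k) (\<tau>, \<rho>)) \<partial>lborel)"
        unfolding ray_level_def
      proof (intro nn_integral_cong)
        fix \<rho> :: real
        let ?P = "0 < \<rho> \<and> ennreal (\<rho> powr (1 + \<gamma>)) < ray_int (\<lambda>u. \<phi> (\<tau> + u)) \<rho>"
        have "(SUP k. indicator (F k) (\<tau>, \<rho>)) = (indicator {\<rho>. 0 < \<rho> \<and> ennreal (\<rho> powr (1 + \<gamma>)) < ray_int (\<lambda>u. \<phi> (\<tau> + u)) \<rho>} \<rho> :: ennreal)"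
        proof (cases ?P)
          case True
          then obtain k where "inverse (real (Suc k)) < \<rho> powr (1 + \<gamma>)"
            using reals_Archimedean[of "\<rho> powr (1 + \<gamma>)"] by auto
          with True have "(\<tau>, \<rho>) \<in> F k" by (simp add: F_def inverse_eq_divide)
          then have "1 \<le> (SUP k. indicator (F k) (\<tau>, \<rho>) :: ennreal)"
            by (intro SUP_upper2[of k]) auto
          moreover have "(SUP k. indicator (F k) (\<tau>, \<rho>) :: ennreal) \<le> 1"
            by (intro SUP_least) (auto simp: indicator_def)
          ultimately show ?thesis using True by simp
        next
          case False
          then have "(\<tau>, \<rho>) \<notin> F k" for k by (auto simp: F_def)
          then show ?thesis using False by simp
        qed
        then show "ennreal (\<rho> powr (\<gamma> - 1)) * indicator {\<rho>. 0 < \<rho> \<and> ennreal (\<rho> powr (1 + \<gamma>)) < ray_int (\<lambda>u. \<phi> (\<tau> + u)) \<rho>} \<rho>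
          = (SUP k. ennreal (\<rho> powr (\<gamma> - 1)) * indicator (F k) (\<tau>, \<rho>))"
          by (simp flip: SUP_mult_left_ennreal)
      qed
      also have "\<dots> = (SUP k. \<integral>\<^sup>+\<rho>. ennreal (\<rho> powr (\<gamma> - 1)) * indicator (F k) (\<tau>, \<rho>) \<partial>lborel)"
        by (rule nn_integral_monotone_convergence_SUP)
          (auto simp: incseq_def le_fun_def indicator_def dest!: F_mono)
      finally show ?thesis .
    qed
    have "(\<integral>\<^sup>+\<tau>. ray_level \<gamma> (\<lambda>u. \<phi> (\<tau> + u)) \<partial>lborel) = (SUP k. \<integral>\<^sup>+\<tau>. \<integral>\<^sup>+\<rho>. ennreal (\<rho> powr (\<gamma> - 1)) * indicator (F k) (\<tau>, \<rho>) \<partial>lborel \<partial>lborel)"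
      unfolding ray_level
      by (rule nn_integral_monotone_convergence_SUP)
        (auto simp: incseq_def le_fun_def indicator_def dest!: F_mono intro!: nn_integral_mono)
    then show ?thesis using step by (simp add: SUP_least)
  qed (use K in \<open>simp add: ennreal_mult_top\<close>)
  with K(1) that show ?thesis by blast
qed

text \<open>For \<open>r > 1\<close> the pointwise bound by \<open>fwd_max\<close> with factor
  \<open>1 / \<bar>\<gamma>\<bar>\<close> works for every nonzero \<gamma>; for \<open>r = 1\<close>
  it is the charging argument that restricts \<gamma>.\<close>

lemma ray_level_Lr:
  assumes "1 \<le> r" "\<gamma> \<noteq> 0" "r = 1 \<longrightarrow> 0 < \<gamma> \<or> \<gamma> < -1"
  obtains K where "0 < K" "\<And>\<phi>. \<phi> \<in> borel_measurable borel \<Longrightarrow>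
    (\<integral>\<^sup>+\<tau>. epow (ray_level \<gamma> (\<lambda>u. \<phi> (\<tau> + u))) r \<partial>lborel) \<le> ennreal K * (\<integral>\<^sup>+u. epow (\<phi> u) r \<partial>lborel)"
proof (cases "r = 1")
  case True
  then show ?thesis using ray_level_L1[of \<gamma>] assms that by auto
next
  case False
  then have r: "1 < r" using assms by simp
  define K where "K = (1 / \<bar>\<gamma>\<bar>) powr r * (6 * r * 2 powr (r - 1) / (r - 1))"
  show ?thesis
  proof (rule that)
    show "0 < K" using r assms by (simp add: K_def)
    fix \<phi> :: "real \<Rightarrow> ennreal" assume [measurable]: "\<phi> \<in> borel_measurable borel"
    have "(\<integral>\<^sup>+\<tau>. epow (ray_level \<gamma> (\<lambda>u. \<phi> (\<tau> + u))) r \<partial>lborel)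
      \<le> (\<integral>\<^sup>+\<tau>. epow (ennreal (1 / \<bar>\<gamma>\<bar>) * fwd_max (\<lambda>u. \<phi> (\<tau> + u))) r \<partial>lborel)"
      using assms by (intro nn_integral_mono epow_mono ray_level_le ray_int_le_fwd_max) auto
    also have "\<dots> = ennreal ((1 / \<bar>\<gamma>\<bar>) powr r) * (\<integral>\<^sup>+\<tau>. epow (fwd_max (\<lambda>u. \<phi> (\<tau> + u))) r \<partial>lborel)"
      unfolding epow_mult by (subst nn_integral_cmult) (auto simp: epow_ennreal)
    also have "\<dots> \<le> ennreal ((1 / \<bar>\<gamma>\<bar>) powr r) * (ennreal (6 * r * 2 powr (r - 1) / (r - 1)) * (\<integral>\<^sup>+u. epow (\<phi> u) r \<partial>lborel))"
      using r by (intro mult_left_mono fwd_max_strong_type) auto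
    also have "\<dots> = ennreal K * (\<integral>\<^sup>+u. epow (\<phi> u) r \<partial>lborel)"
      unfolding K_def using r by (simp add: ennreal_mult[symmetric] mult.assoc[symmetric])
    finally show "(\<integral>\<^sup>+\<tau>. epow (ray_level \<gamma> (\<lambda>u. \<phi> (\<tau> + u))) r \<partial>lborel) \<le> ennreal K * (\<integral>\<^sup>+u. epow (\<phi> u) r \<partial>lborel)" .
  qed
qed

section \<open>Differences along rays\<close>

text \<open>A set of directions with positive finite volume, so that averages over directions are
  integrals against \<open>lborel\<close>. Lengths between 1 and 2 keep powers of
  \<open>norm u\<close> bounded from both sides.\<close>

definition shell :: "'a::euclidean_space set" where
  "shell = {u. 1 < norm u \<and> norm u < 2}"

lemma shell_sets [measurable]: "shell \<in> sets borel"
  unfolding shell_def by measurable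

lemma ball_sets [measurable]: "ball (x :: 'a::euclidean_space) r \<in> sets borel"
  by simp

lemma emeasure_shell_finite: "emeasure lborel (shell :: 'a::euclidean_space set) \<noteq> \<infinity>"
proof -
  have "emeasure lborel (shell :: 'a set) \<le> emeasure lborel (ball (0::'a) 2)"
    by (intro emeasure_mono) (auto simp: shell_def)
  then show ?thesis using emeasure_bounded_finite[of "ball (0::'a) 2"] by (auto simp: top_unique)
qed

lemma measure_shell_pos: "0 < measure lborel (shell :: 'a::euclidean_space set)"
proof -
  obtain b :: 'a where b: "b \<in> Basis" using nonempty_Basis by blast
  have "ball ((3/2) *\<^sub>R b) (1/4) \<subseteq> shell"
  proof
    fix x assume "x \<in> ball ((3/2) *\<^sub>R b) (1/4)"
    then have "norm ((3/2) *\<^sub>R b - x) < 1/4" by (simp add: dist_norm)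
    moreover have "norm ((3/2) *\<^sub>R b) = 3/2" using b by simp
    ultimately show "x \<in> shell"
      unfolding shell_def using norm_triangle_ineq2[of "(3/2) *\<^sub>R b" x] norm_triangle_ineq3[of x "(3/2) *\<^sub>R b"]
      by (auto simp: norm_minus_commute)
  qed
  then have "measure lborel (ball ((3/2) *\<^sub>R b) (1/4)) \<le> measure lborel (shell :: 'a set)"
    by (rule measure_mono_fmeasurable) (use emeasure_shell_finite in \<open>auto simp: fmeasurable_def less_top[symmetric]\<close>)
  moreover have "0 < measure lborel (ball ((3/2) *\<^sub>R b) (1/4))"
    by (simp add: content_ball)
  ultimately show ?thesis by linarith
qed

section \<open>From integrals over space to integrals along rays\<close>

lemma nn_integral_scale:
  fixes G :: "'a::euclidean_space \<Rightarrow> ennreal"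
  assumes [measurable]: "G \<in> borel_measurable borel" and "0 < \<rho>"
  shows "(\<integral>\<^sup>+u. G (\<rho> *\<^sub>R u) \<partial>lborel) = ennreal (\<rho> powr - real DIM('a)) * (\<integral>\<^sup>+z. G z \<partial>lborel)"
proof -
  have "(\<integral>\<^sup>+z. G z \<partial>lborel) = (\<integral>\<^sup>+z. G z \<partial>density (distr lborel borel (\<lambda>x. 0 + \<rho> *\<^sub>R x)) (\<lambda>_. ennreal (\<bar>\<rho>\<bar> ^ DIM('a))))"
    using lborel_affine[of \<rho> "0::'a"] assms by (metis less_irrefl)
  also have "\<dots> = ennreal (\<rho> powr real DIM('a)) * (\<integral>\<^sup>+u. G (\<rho> *\<^sub>R u) \<partial>lborel)"
    using assms(2) by (simp add: nn_integral_density nn_integral_distr nn_integral_cmult powr_realpow)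
  finally have "ennreal (\<rho> powr - real DIM('a)) * (\<integral>\<^sup>+z. G z \<partial>lborel)
    = ennreal (\<rho> powr - real DIM('a) * \<rho> powr real DIM('a)) * (\<integral>\<^sup>+u. G (\<rho> *\<^sub>R u) \<partial>lborel)"
    by (simp add: ennreal_mult mult.assoc)
  also have "\<rho> powr - real DIM('a) * \<rho> powr real DIM('a) = 1"
    using assms(2) by (simp add: powr_add[symmetric])
  finally show ?thesis by simp
qed

text \<open>Replaces integration in polar coordinates, with the shell in the role of the sphere.\<close>
lemma nn_integral_le_rays:
  fixes G :: "'a::euclidean_space \<Rightarrow> ennreal"
  assumes [measurable]: "G \<in> borel_measurable borel"
  shows "(\<integral>\<^sup>+z. G z * ennreal (norm z powr - real DIM('a)) \<partial>lborel)
    \<le> 2 * (\<integral>\<^sup>+u\<in>shell. (\<integral>\<^sup>+\<rho>\<in>{0<..}. G (\<rho> *\<^sub>R u) * ennreal (1 / \<rho>) \<partial>lborel) \<partial>lborel)"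
proof -
  let ?n = "real DIM('a)"
  have [measurable]: "(\<lambda>(u, \<rho>). G (\<rho> *\<^sub>R u)) \<in> borel_measurable (borel \<Otimes>\<^sub>M borel)"
    by measurable
  have sh: "indicator shell ((1 / \<rho>) *\<^sub>R z) = (indicator {z. \<rho> < norm z \<and> norm z < 2 * \<rho>} z :: ennreal)" if "0 < \<rho>" for \<rho> and z :: 'a
    using that by (auto simp: indicator_def shell_def field_simps)
  \<comment> \<open>\<open>z\<close> lies in \<rho> times the shell exactly for
    \<open>norm z / 2 < \<rho> < norm z\<close>. On this interval of length
    \<open>norm z / 2\<close> the decreasing power of \<rho> is at least its value at
    \<open>norm z\<close>, whence the factor 2.\<close>
  have inner: "ennreal (norm z powr - ?n) \<le> 2 * (\<integral>\<^sup>+\<rho>\<in>{0<..}. ennreal (\<rho> powr (- ?n - 1)) * indicator {z. \<rho> < norm z \<and> norm z < 2 * \<rho>} z \<partial>lborel)" for z :: 'a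
  proof (cases "z = 0")
    case False
    define a where "a = norm z"
    have a: "0 < a" using False by (simp add: a_def)
    have "ennreal (a powr - ?n) = 2 * (ennreal (a powr (- ?n - 1)) * ennreal (a / 2))"
      using a by (simp add: ennreal_mult[symmetric] powr_diff ennreal_numeral[symmetric] del: ennreal_numeral)
    also have "\<dots> = 2 * (\<integral>\<^sup>+\<rho>. ennreal (a powr (- ?n - 1)) * indicator {a / 2<..<a} \<rho> \<partial>lborel)"
      using a by (subst nn_integral_cmult_indicator) auto
    also have "\<dots> \<le> 2 * (\<integral>\<^sup>+\<rho>\<in>{0<..}. ennreal (\<rho> powr (- ?n - 1)) * indicator {z. \<rho> < norm z \<and> norm z < 2 * \<rho>} z \<partial>lborel)"
      using a by (intro mult_left_mono nn_integral_mono)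
        (auto simp: indicator_def a_def[symmetric] intro!: ennreal_leI powr_mono2')
    finally show ?thesis by (simp add: a_def)
  qed simp
  have "(\<integral>\<^sup>+u\<in>shell. (\<integral>\<^sup>+\<rho>\<in>{0<..}. G (\<rho> *\<^sub>R u) * ennreal (1 / \<rho>) \<partial>lborel) \<partial>lborel)
    = (\<integral>\<^sup>+u. (\<integral>\<^sup>+\<rho>. G (\<rho> *\<^sub>R u) * ennreal (1 / \<rho>) * indicator {0<..} \<rho> * indicator shell u \<partial>lborel) \<partial>lborel)"
    by (subst nn_integral_multc) auto
  also have "\<dots> = (\<integral>\<^sup>+\<rho>. (\<integral>\<^sup>+u. G (\<rho> *\<^sub>R u) * ennreal (1 / \<rho>) * indicator {0<..} \<rho> * indicator shell u \<partial>lborel) \<partial>lborel)"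
    by (rule lborel_pair.Fubini'[symmetric]) measurable
  also have "\<dots> = (\<integral>\<^sup>+\<rho>. (\<integral>\<^sup>+z. G z * (ennreal (\<rho> powr (- ?n - 1)) * indicator {z. \<rho> < norm z \<and> norm z < 2 * \<rho>} z * indicator {0<..} \<rho>) \<partial>lborel) \<partial>lborel)"
  proof (rule nn_integral_cong)
    fix \<rho> :: real
    show "(\<integral>\<^sup>+u. G (\<rho> *\<^sub>R u) * ennreal (1 / \<rho>) * indicator {0<..} \<rho> * indicator shell u \<partial>lborel)
      = (\<integral>\<^sup>+z. G z * (ennreal (\<rho> powr (- ?n - 1)) * indicator {z. \<rho> < norm z \<and> norm z < 2 * \<rho>} z * indicator {0<..} \<rho>) \<partial>lborel)"
    proof (cases "0 < \<rho>")
      case True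
      have "(\<integral>\<^sup>+u. G (\<rho> *\<^sub>R u) * ennreal (1 / \<rho>) * indicator {0<..} \<rho> * indicator shell u \<partial>lborel)
        = (\<integral>\<^sup>+u. ennreal (1 / \<rho>) * (G (\<rho> *\<^sub>R u) * indicator {z. \<rho> < norm z \<and> norm z < 2 * \<rho>} (\<rho> *\<^sub>R u)) \<partial>lborel)"
        using True sh[OF True, of "\<rho> *\<^sub>R u" for u] by (simp add: mult_ac)
      also have "\<dots> = ennreal (1 / \<rho>) * (ennreal (\<rho> powr - ?n) * (\<integral>\<^sup>+z. G z * indicator {z. \<rho> < norm z \<and> norm z < 2 * \<rho>} z \<partial>lborel))"
        by (subst nn_integral_cmult, measurable) (subst nn_integral_scale[OF _ True, symmetric], auto)
      also have "\<dots> = ennreal (\<rho> powr (- ?n - 1)) * (\<integral>\<^sup>+z. G z * indicator {z. \<rho> < norm z \<and> norm z < 2 * \<rho>} z \<partial>lborel)"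
        using True by (simp add: mult.assoc[symmetric] ennreal_mult[symmetric] powr_diff)
      also have "\<dots> = (\<integral>\<^sup>+z. G z * (ennreal (\<rho> powr (- ?n - 1)) * indicator {z. \<rho> < norm z \<and> norm z < 2 * \<rho>} z * indicator {0<..} \<rho>) \<partial>lborel)"
        using True by (subst nn_integral_cmult[symmetric]) (auto simp: mult_ac)
      finally show ?thesis .
    qed simp
  qed
  also have "\<dots> = (\<integral>\<^sup>+z. (\<integral>\<^sup>+\<rho>. G z * (ennreal (\<rho> powr (- ?n - 1)) * indicator {z. \<rho> < norm z \<and> norm z < 2 * \<rho>} z * indicator {0<..} \<rho>) \<partial>lborel) \<partial>lborel)"
    by (rule lborel_pair.Fubini') measurable
  also have "\<dots> = (\<integral>\<^sup>+z. G z * (\<integral>\<^sup>+\<rho>\<in>{0<..}. ennreal (\<rho> powr (- ?n - 1)) * indicator {z. \<rho> < norm z \<and> norm z < 2 * \<rho>} z \<partial>lborel) \<partial>lborel)"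
    by (subst nn_integral_cmult) (auto simp: mult_ac)
  finally have eq: "2 * (\<integral>\<^sup>+u\<in>shell. (\<integral>\<^sup>+\<rho>\<in>{0<..}. G (\<rho> *\<^sub>R u) * ennreal (1 / \<rho>) \<partial>lborel) \<partial>lborel)
    = (\<integral>\<^sup>+z. G z * (2 * (\<integral>\<^sup>+\<rho>\<in>{0<..}. ennreal (\<rho> powr (- ?n - 1)) * indicator {z. \<rho> < norm z \<and> norm z < 2 * \<rho>} z \<partial>lborel)) \<partial>lborel)"
    by (simp add: nn_integral_cmult[symmetric] mult_ac)
  show ?thesis unfolding eq by (intro nn_integral_mono mult_left_mono inner) auto
qed

text \<open>The parameter on the segment is not arc length, hence the factor \<open>norm u\<close>;
  it cancels in \<open>Dint_le_ray_level\<close>.\<close>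

lemma abs_diff_le_ray_int:
  fixes f :: "'a::euclidean_space \<Rightarrow> real"
  assumes f: "\<And>x. GDERIV f x :> g x" and g: "continuous_on UNIV g" and "0 \<le> \<rho>"
  shows "ennreal \<bar>f x - f (x + \<rho> *\<^sub>R u)\<bar> \<le> ennreal (norm u) * ray_int (\<lambda>t. ennreal (norm (g (x + t *\<^sub>R u)))) \<rho>"
proof -
  have cont: "continuous_on A (\<lambda>t. g (x + t *\<^sub>R u))" for A
    by (intro continuous_on_compose2[OF g] continuous_intros) auto
  have der: "((\<lambda>t. f (x + t *\<^sub>R u)) has_vector_derivative (u \<bullet> g (x + t *\<^sub>R u))) (at t within A)" for t A
  proof -
    have "((\<lambda>t. f (x + t *\<^sub>R u)) has_derivative (\<lambda>h. (h *\<^sub>R u) \<bullet> g (x + t *\<^sub>R u))) (at t within A)"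
      using f[of "x + t *\<^sub>R u"] unfolding gderiv_def
      by (rule has_derivative_compose[rotated]) (auto intro!: derivative_eq_intros)
    then show ?thesis by (simp add: has_vector_derivative_def)
  qed
  have "((\<lambda>t. u \<bullet> g (x + t *\<^sub>R u)) has_integral (f (x + \<rho> *\<^sub>R u) - f (x + 0 *\<^sub>R u))) {0..\<rho>}"
    by (rule fundamental_theorem_of_calculus[OF \<open>0 \<le> \<rho>\<close> der])
  moreover have "((\<lambda>t. norm u * norm (g (x + t *\<^sub>R u))) has_integral (norm u * integral {0..\<rho>} (\<lambda>t. norm (g (x + t *\<^sub>R u))))) {0..\<rho>}"
    by (intro has_integral_mult_right integrable_integral integrable_continuous_interval continuous_intros cont)
  ultimately have le: "norm (f (x + \<rho> *\<^sub>R u) - f (x + 0 *\<^sub>R u)) \<le> norm u * integral {0..\<rho>} (\<lambda>t. norm (g (x + t *\<^sub>R u)))"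
    using integral_norm_bound_integral[of "\<lambda>t. u \<bullet> g (x + t *\<^sub>R u)" "{0..\<rho>}" "\<lambda>t. norm u * norm (g (x + t *\<^sub>R u))"]
    by (simp add: has_integral_iff Cauchy_Schwarz_ineq2)
  have "ray_int (\<lambda>t. ennreal (norm (g (x + t *\<^sub>R u)))) \<rho> = ennreal (integral {0..\<rho>} (\<lambda>t. norm (g (x + t *\<^sub>R u))))"
    unfolding ray_int_def
    by (rule nn_integral_has_integral_lebesgue')
      (auto intro!: integrable_integral integrable_continuous_interval continuous_intros cont)
  then show ?thesis
    using le by (simp add: ennreal_mult[symmetric] integral_nonneg integrable_continuous_interval continuous_intros cont abs_minus_commute)
qed

lemma ray_int_cmult:
  assumes [measurable]: "\<phi> \<in> borel_measurable borel"
  shows "ray_int (\<lambda>t. c * \<phi> t) \<rho> = c * ray_int \<phi> \<rho>"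
  unfolding ray_int_def by (subst nn_integral_cmult[symmetric]) (auto simp: mult.assoc)

lemma ray_int_add:
  assumes [measurable]: "\<phi> \<in> borel_measurable borel" "\<psi> \<in> borel_measurable borel"
  shows "ray_int (\<lambda>t. \<phi> t + \<psi> t) \<rho> = ray_int \<phi> \<rho> + ray_int \<psi> \<rho>"
  unfolding ray_int_def by (subst nn_integral_add[symmetric]) (auto simp: distrib_right)

text \<open>If a sum exceeds a threshold, twice one of its terms does. As the threshold has to stay
  fixed, the factor 2 goes into the argument of \<open>ray_level\<close>, which is not
  homogeneous.\<close>

lemma ray_level_add_le:
  assumes [measurable]: "\<phi> \<in> borel_measurable borel" "\<psi> \<in> borel_measurable borel"
  shows "ray_level \<gamma> (\<lambda>t. \<phi> t + \<psi> t) \<le> ray_level \<gamma> (\<lambda>t. 2 * \<phi> t) + ray_level \<gamma> (\<lambda>t. 2 * \<psi> t)"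
proof -
  have "a < 2 * x \<or> a < 2 * y" if "a < x + y" for a x y :: ennreal
  proof (rule ccontr)
    assume "\<not> ?thesis"
    then have "2 * x \<le> a" "2 * y \<le> a" by auto
    then have "2 * (x + y) \<le> 2 * a" using add_mono[of "2 * x" a "2 * y" a] by (simp add: distrib_left mult_2)
    then have "x + y \<le> a" by (subst (asm) ennreal_mult_le_mult_iff) auto
    with that show False by simp
  qed
  then have "ray_level \<gamma> (\<lambda>t. \<phi> t + \<psi> t) \<le> (\<integral>\<^sup>+\<rho>. ennreal (\<rho> powr (\<gamma> - 1)) *
     indicator {\<rho>. 0 < \<rho> \<and> ennreal (\<rho> powr (1 + \<gamma>)) < ray_int (\<lambda>t. 2 * \<phi> t) \<rho>} \<rho> + ennreal (\<rho> powr (\<gamma> - 1)) *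
     indicator {\<rho>. 0 < \<rho> \<and> ennreal (\<rho> powr (1 + \<gamma>)) < ray_int (\<lambda>t. 2 * \<psi> t) \<rho>} \<rho> \<partial>lborel)"
    unfolding ray_level_def by (intro nn_integral_mono) (auto simp: indicator_def ray_int_cmult ray_int_add)
  also have "\<dots> = ray_level \<gamma> (\<lambda>t. 2 * \<phi> t) + ray_level \<gamma> (\<lambda>t. 2 * \<psi> t)"
    unfolding ray_level_def by (rule nn_integral_add) measurable
  finally show ?thesis .
qed

lemma ray_level_mono: "(\<And>t. \<phi> t \<le> \<psi> t) \<Longrightarrow> ray_level \<gamma> \<phi> \<le> ray_level \<gamma> \<psi>"
  unfolding ray_level_def
  by (intro nn_integral_mono) (auto simp: indicator_def intro: less_le_trans[OF _ ray_int_mono])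

text \<open>Along a ray the level condition involves
  \<open>(\<rho> * norm u) powr (1 + \<gamma>)\<close>. Two stray powers of \<open>norm u\<close>,
  with exponents \<gamma> and -\<gamma>, are each at most
  \<open>2 powr \<bar>\<gamma>\<bar>\<close>: one ends up in front, the other inside the ray
  functional. The remaining 2 is that of \<open>nn_integral_le_rays\<close>.\<close>

lemma Dint_le_ray_level:
  fixes f :: "'a::euclidean_space \<Rightarrow> real"
  assumes f: "\<And>x. GDERIV f x :> g x" and g: "continuous_on UNIV g"
  shows "Dint 1 \<gamma> 1 \<gamma> f x \<le> ennreal (2 * 2 powr \<bar>\<gamma>\<bar>) *
    (\<integral>\<^sup>+u\<in>shell. ray_level \<gamma> (\<lambda>t. ennreal (2 powr \<bar>\<gamma>\<bar>) * ennreal (norm (g (x + t *\<^sub>R u)))) \<partial>lborel)"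
proof -
  let ?n = "real DIM('a)"
  have "continuous (at x) f" for x
    using f[of x] by (intro has_derivative_continuous) (auto simp: gderiv_def)
  then have "continuous_on UNIV f" by (simp add: continuous_at_imp_continuous_on)
  then have [measurable]: "f \<in> borel_measurable borel" by (rule borel_measurable_continuous_onI)
  have [measurable]: "g \<in> borel_measurable borel" using g by (rule borel_measurable_continuous_onI)
  \<comment> \<open>The kernel is split: \<open>norm z powr \<gamma>\<close> joins the indicator in
    \<open>G\<close>, and \<open>norm z powr - n\<close> is what becomes \<open>1 / \<rho>\<close>
    along rays.\<close>
  define G where "G z = indicator (Dset 1 \<gamma> 1 f) (x, x + z) * ennreal (norm z powr \<gamma>)" for z
  have G: "G z = (if z \<noteq> 0 \<and> \<bar>f x - f (x + z)\<bar> / norm z powr (1 + \<gamma>) > 1 then 1 else 0) * ennreal (norm z powr \<gamma>)" for z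
    by (auto simp: G_def Dset_def dist_norm indicator_def)
  have [measurable]: "G \<in> borel_measurable borel" unfolding G by measurable
  define k where "k = 2 powr \<bar>\<gamma>\<bar>"
  have k: "0 < k" by (simp add: k_def)
  have "Dint 1 \<gamma> 1 \<gamma> f x = (\<integral>\<^sup>+y. (if x \<noteq> y \<and> \<bar>f x - f y\<bar> / dist x y powr (1 + \<gamma>) > 1 then 1 else 0) * ennreal (dist x y powr (\<gamma> - ?n)) \<partial>lborel)"
    unfolding Dint_def by (intro nn_integral_cong) (auto simp: Dset_def indicator_def)
  also have "\<dots> = (\<integral>\<^sup>+z. (if x \<noteq> x + z \<and> \<bar>f x - f (x + z)\<bar> / dist x (x + z) powr (1 + \<gamma>) > 1 then 1 else 0) * ennreal (dist x (x + z) powr (\<gamma> - ?n)) \<partial>lborel)"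
    by (rule nn_integral_translate[symmetric]) measurable
  also have "\<dots> = (\<integral>\<^sup>+z. G z * ennreal (norm z powr - ?n) \<partial>lborel)"
    by (intro nn_integral_cong) (auto simp: G dist_norm ennreal_mult[symmetric] powr_add[symmetric])
  also have "\<dots> \<le> 2 * (\<integral>\<^sup>+u\<in>shell. (\<integral>\<^sup>+\<rho>\<in>{0<..}. G (\<rho> *\<^sub>R u) * ennreal (1 / \<rho>) \<partial>lborel) \<partial>lborel)"
    by (rule nn_integral_le_rays) measurable
  also have "\<dots> \<le> 2 * (\<integral>\<^sup>+u. ennreal k * (ray_level \<gamma> (\<lambda>t. ennreal k * ennreal (norm (g (x + t *\<^sub>R u)))) * indicator shell u) \<partial>lborel)"
  proof (intro mult_left_mono nn_integral_mono)
    fix u :: 'a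
    have "(\<integral>\<^sup>+\<rho>\<in>{0<..}. G (\<rho> *\<^sub>R u) * ennreal (1 / \<rho>) \<partial>lborel)
      \<le> ennreal k * ray_level \<gamma> (\<lambda>t. ennreal k * ennreal (norm (g (x + t *\<^sub>R u))))" if u: "u \<in> shell"
    proof -
      have nu: "1 < norm u" "norm u < 2" using u by (auto simp: shell_def)
      have pk: "norm u powr \<gamma> \<le> k" "norm u powr - \<gamma> \<le> k"
      proof -
        have "norm u powr \<gamma> \<le> norm u powr \<bar>\<gamma>\<bar>" "norm u powr -\<gamma> \<le> norm u powr \<bar>\<gamma>\<bar>"
          using nu by (auto intro!: powr_mono)
        moreover have "norm u powr \<bar>\<gamma>\<bar> \<le> k" unfolding k_def using nu by (intro powr_mono2) auto
        ultimately show "norm u powr \<gamma> \<le> k" "norm u powr - \<gamma> \<le> k" by linarith+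
      qed
      have "(\<integral>\<^sup>+\<rho>\<in>{0<..}. G (\<rho> *\<^sub>R u) * ennreal (1 / \<rho>) \<partial>lborel)
        \<le> (\<integral>\<^sup>+\<rho>. ennreal k * (ennreal (\<rho> powr (\<gamma> - 1)) * indicator {\<rho>. 0 < \<rho> \<and>
           ennreal (\<rho> powr (1 + \<gamma>)) < ray_int (\<lambda>t. ennreal k * ennreal (norm (g (x + t *\<^sub>R u)))) \<rho>} \<rho>) \<partial>lborel)"
      proof (rule nn_integral_mono)
        fix \<rho> :: real
        show "G (\<rho> *\<^sub>R u) * ennreal (1 / \<rho>) * indicator {0<..} \<rho>
          \<le> ennreal k * (ennreal (\<rho> powr (\<gamma> - 1)) * indicator {\<rho>. 0 < \<rho> \<and>
           ennreal (\<rho> powr (1 + \<gamma>)) < ray_int (\<lambda>t. ennreal k * ennreal (norm (g (x + t *\<^sub>R u)))) \<rho>} \<rho>)"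
        proof (cases "0 < \<rho> \<and> \<bar>f x - f (x + \<rho> *\<^sub>R u)\<bar> / norm (\<rho> *\<^sub>R u) powr (1 + \<gamma>) > 1")
          case True
          then have \<rho>: "0 < \<rho>" by simp
          \<comment> \<open>The level condition is derived with both sides multiplied by
            \<open>norm u\<close>, the factor that \<open>abs_diff_le_ray_int\<close>
            produces.\<close>
          have "ennreal (norm u) * ennreal (\<rho> powr (1 + \<gamma>)) \<le> ennreal k * ennreal (\<rho> powr (1 + \<gamma>) * norm u powr (1 + \<gamma>))"
          proof -
            have "norm u * \<rho> powr (1 + \<gamma>) = norm u powr (1 + \<gamma>) * norm u powr - \<gamma> * \<rho> powr (1 + \<gamma>)"
              using nu by (simp add: powr_add[symmetric])
            also have "\<dots> \<le> norm u powr (1 + \<gamma>) * k * \<rho> powr (1 + \<gamma>)"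
              using pk by (intro mult_left_mono mult_right_mono) auto
            finally show ?thesis using k by (simp add: ennreal_mult[symmetric] mult_ac ennreal_leI)
          qed
          also have "\<dots> < ennreal k * ennreal \<bar>f x - f (x + \<rho> *\<^sub>R u)\<bar>"
          proof -
            have "norm (\<rho> *\<^sub>R u) powr (1 + \<gamma>) = \<rho> powr (1 + \<gamma>) * norm u powr (1 + \<gamma>)"
              using \<rho> by (simp add: powr_mult)
            moreover have "u \<noteq> 0" using nu by auto
            ultimately have "\<rho> powr (1 + \<gamma>) * norm u powr (1 + \<gamma>) < \<bar>f x - f (x + \<rho> *\<^sub>R u)\<bar>"
              using True by (auto simp: less_divide_eq split: if_splits)
            then show ?thesis using k by (simp add: ennreal_mult[symmetric] ennreal_less_iff)
          qed
          also have "\<dots> \<le> ennreal k * (ennreal (norm u) * ray_int (\<lambda>t. ennreal (norm (g (x + t *\<^sub>R u)))) \<rho>)"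
            using \<rho> by (intro mult_left_mono abs_diff_le_ray_int[OF f g]) auto
          also have "\<dots> = ennreal (norm u) * ray_int (\<lambda>t. ennreal k * ennreal (norm (g (x + t *\<^sub>R u)))) \<rho>"
            by (subst ray_int_cmult) (auto simp: mult_ac)
          finally have "ennreal (\<rho> powr (1 + \<gamma>)) < ray_int (\<lambda>t. ennreal k * ennreal (norm (g (x + t *\<^sub>R u)))) \<rho>"
            by (meson linorder_not_le mult_left_mono zero_le)
          moreover have "(\<rho> * norm u) powr \<gamma> * (1 / \<rho>) \<le> k * \<rho> powr (\<gamma> - 1)"
          proof -
            have "(\<rho> * norm u) powr \<gamma> * (1 / \<rho>) = norm u powr \<gamma> * \<rho> powr (\<gamma> - 1)"
              using \<rho> by (simp add: powr_mult powr_diff)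
            then show ?thesis using pk by (simp add: mult_right_mono)
          qed
          ultimately show ?thesis
            using True k by (simp add: G ennreal_mult[symmetric] ennreal_leI)
        qed (auto simp: G indicator_def)
      qed
      also have "\<dots> = ennreal k * ray_level \<gamma> (\<lambda>t. ennreal k * ennreal (norm (g (x + t *\<^sub>R u))))"
        unfolding ray_level_def by (rule nn_integral_cmult) measurable
      finally show ?thesis .
    qed
    then show "(\<integral>\<^sup>+\<rho>\<in>{0<..}. G (\<rho> *\<^sub>R u) * ennreal (1 / \<rho>) \<partial>lborel) * indicator shell u
      \<le> ennreal k * (ray_level \<gamma> (\<lambda>t. ennreal k * ennreal (norm (g (x + t *\<^sub>R u)))) * indicator shell u)"
      by (auto simp: indicator_def)
  qed auto
  also have "\<dots> = ennreal (2 * k) * (\<integral>\<^sup>+u\<in>shell. ray_level \<gamma> (\<lambda>t. ennreal k * ennreal (norm (g (x + t *\<^sub>R u)))) \<partial>lborel)"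
    using k by (subst nn_integral_cmult) (auto simp: ennreal_mult mult.assoc)
  finally show ?thesis by (simp add: k_def)
qed

text \<open>Shifting the variable by \<open>\<tau> *\<^sub>R u\<close> and integrating over \<tau>
  in \<open>{0..R}\<close> exposes integrals of the ray functional along lines in direction
  \<open>u\<close>, where the one-dimensional inequality applies. The 10 is the ratio of the final
  range \<open>{-(5*R)..5*R}\<close> of \<tau> to the initial one.\<close>

lemma ray_level_near:
  assumes "1 \<le> r" "\<gamma> \<noteq> 0" "r = 1 \<longrightarrow> 0 < \<gamma> \<or> \<gamma> < -1"
  obtains K where "0 < K" "\<And>(k :: 'a::euclidean_space \<Rightarrow> ennreal) x0 R u. k \<in> borel_measurable borel \<Longrightarrow> 0 < R \<Longrightarrow>
    (\<And>z. z \<notin> ball x0 (2 * R) \<Longrightarrow> k z = 0) \<Longrightarrow> u \<in> shell \<Longrightarrow>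
    (\<integral>\<^sup>+x\<in>ball x0 R. epow (ray_level \<gamma> (\<lambda>t. k (x + t *\<^sub>R u))) r \<partial>lborel) \<le> ennreal K * (\<integral>\<^sup>+z. epow (k z) r \<partial>lborel)"
proof -
  obtain K where K: "0 < K" "\<And>\<phi>. \<phi> \<in> borel_measurable borel \<Longrightarrow>
    (\<integral>\<^sup>+\<tau>. epow (ray_level \<gamma> (\<lambda>u. \<phi> (\<tau> + u))) r \<partial>lborel) \<le> ennreal K * (\<integral>\<^sup>+u. epow (\<phi> u) r \<partial>lborel)"
    using ray_level_Lr[OF assms] by metis
  show ?thesis
  proof (rule that)
    show "0 < 10 * K" using K by simp
    fix k :: "'a \<Rightarrow> ennreal" and x0 u :: 'a and R :: real
    assume [measurable]: "k \<in> borel_measurable borel" and R: "0 < R"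
      and supp: "\<And>z. z \<notin> ball x0 (2 * R) \<Longrightarrow> k z = 0" and u: "u \<in> shell"
    have nu: "1 < norm u" "norm u < 2" using u by (auto simp: shell_def)
    define E where "E x = epow (ray_level \<gamma> (\<lambda>t. k (x + t *\<^sub>R u))) r" for x
    have [measurable]: "E \<in> borel_measurable borel" unfolding E_def by measurable
    define I where "I = (\<integral>\<^sup>+x\<in>ball x0 R. E x \<partial>lborel)"
    have shift: "I = (\<integral>\<^sup>+x. E (\<tau> *\<^sub>R u + x) * indicator (ball x0 R) (\<tau> *\<^sub>R u + x) \<partial>lborel)" for \<tau>
      unfolding I_def by (rule nn_integral_translate[symmetric]) measurable
    have "ennreal R * I = (\<integral>\<^sup>+\<tau>. I * indicator {0..R} \<tau> \<partial>lborel)"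
      using R by (subst nn_integral_cmult_indicator) (auto simp: mult.commute)
    also have "\<dots> = (\<integral>\<^sup>+\<tau>. (\<integral>\<^sup>+x. E (\<tau> *\<^sub>R u + x) * indicator (ball x0 R) (\<tau> *\<^sub>R u + x) * indicator {0..R} \<tau> \<partial>lborel) \<partial>lborel)"
      by (intro nn_integral_cong) (subst nn_integral_multc, measurable, subst shift, rule refl)
    \<comment> \<open>A shift moves points by at most \<open>2 * R\<close>, so \<open>x\<close>
      stays in the ball of radius \<open>3 * R\<close>; the restriction on \<tau> is then dropped to
      obtain full lines.\<close>
    also have "\<dots> \<le> (\<integral>\<^sup>+\<tau>. (\<integral>\<^sup>+x. E (\<tau> *\<^sub>R u + x) * indicator (ball x0 (3 * R)) x \<partial>lborel) \<partial>lborel)"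
    proof (intro nn_integral_mono)
      fix \<tau> :: real and x :: 'a
      have "x \<in> ball x0 (3 * R)" if "\<tau> *\<^sub>R u + x \<in> ball x0 R" "0 \<le> \<tau>" "\<tau> \<le> R"
      proof -
        have "norm (\<tau> *\<^sub>R u) \<le> R * 2" unfolding norm_scaleR using that nu by (intro mult_mono) auto
        then show ?thesis using that norm_triangle_ineq[of "x0 - (\<tau> *\<^sub>R u + x)" "\<tau> *\<^sub>R u"] by (auto simp: dist_norm algebra_simps)
      qed
      then show "E (\<tau> *\<^sub>R u + x) * indicator (ball x0 R) (\<tau> *\<^sub>R u + x) * indicator {0..R} \<tau>
        \<le> E (\<tau> *\<^sub>R u + x) * indicator (ball x0 (3 * R)) x"
        by (auto simp: indicator_def)
    qed
    also have "\<dots> = (\<integral>\<^sup>+x. (\<integral>\<^sup>+\<tau>. E (\<tau> *\<^sub>R u + x) * indicator (ball x0 (3 * R)) x \<partial>lborel) \<partial>lborel)"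
      by (rule lborel_pair.Fubini') measurable
    also have "\<dots> = (\<integral>\<^sup>+x. (\<integral>\<^sup>+\<tau>. epow (ray_level \<gamma> (\<lambda>t. k (x + (\<tau> + t) *\<^sub>R u))) r \<partial>lborel) * indicator (ball x0 (3 * R)) x \<partial>lborel)"
      unfolding E_def by (subst nn_integral_multc) (auto simp: algebra_simps)
    also have "\<dots> \<le> (\<integral>\<^sup>+x. ennreal K * (\<integral>\<^sup>+\<tau>. epow (k (x + \<tau> *\<^sub>R u)) r \<partial>lborel) * indicator (ball x0 (3 * R)) x \<partial>lborel)"
      by (intro nn_integral_mono mult_right_mono K(2)) auto
    also have "\<dots> = (\<integral>\<^sup>+x. (\<integral>\<^sup>+\<tau>. ennreal K * epow (k (x + \<tau> *\<^sub>R u)) r * indicator (ball x0 (3 * R)) x \<partial>lborel) \<partial>lborel)"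
      by (simp add: nn_integral_cmult nn_integral_multc)
    \<comment> \<open>Now \<tau> is confined again: \<open>x\<close> within \<open>3 * R\<close> of
      the center, \<open>x + \<tau> *\<^sub>R u\<close> in the support and \<open>norm u > 1\<close>
      force \<open>\<bar>\<tau>\<bar> \<le> 5 * R\<close>. This allows the restriction on
      \<open>x\<close> to be dropped.\<close>
    also have "\<dots> \<le> (\<integral>\<^sup>+x. (\<integral>\<^sup>+\<tau>. ennreal K * epow (k (x + \<tau> *\<^sub>R u)) r * indicator {-(5*R)..5*R} \<tau> \<partial>lborel) \<partial>lborel)"
    proof (intro nn_integral_mono)
      fix \<tau> :: real and x :: 'a
      have "\<bar>\<tau>\<bar> \<le> 5 * R" if "x \<in> ball x0 (3 * R)" "x + \<tau> *\<^sub>R u \<in> ball x0 (2 * R)"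
      proof -
        have "\<bar>\<tau>\<bar> * 1 \<le> \<bar>\<tau>\<bar> * norm u" using nu by (intro mult_left_mono) auto
        also have "\<dots> = norm ((x0 - x) - (x0 - (x + \<tau> *\<^sub>R u)))" by simp
        also have "\<dots> \<le> norm (x0 - x) + norm (x0 - (x + \<tau> *\<^sub>R u))" by (rule norm_triangle_ineq4)
        finally show ?thesis using that by (auto simp: dist_norm)
      qed
      then show "ennreal K * epow (k (x + \<tau> *\<^sub>R u)) r * indicator (ball x0 (3 * R)) x
        \<le> ennreal K * epow (k (x + \<tau> *\<^sub>R u)) r * indicator {-(5*R)..5*R} \<tau>"
        using supp[of "x + \<tau> *\<^sub>R u"] by (cases "x + \<tau> *\<^sub>R u \<in> ball x0 (2 * R)") (auto simp: indicator_def abs_le_iff)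
    qed
    also have "\<dots> = (\<integral>\<^sup>+\<tau>. (\<integral>\<^sup>+x. ennreal K * epow (k (x + \<tau> *\<^sub>R u)) r * indicator {-(5*R)..5*R} \<tau> \<partial>lborel) \<partial>lborel)"
      by (rule lborel_pair.Fubini') measurable
    also have "\<dots> = (\<integral>\<^sup>+\<tau>. ennreal K * (\<integral>\<^sup>+x. epow (k (\<tau> *\<^sub>R u + x)) r \<partial>lborel) * indicator {-(5*R)..5*R} \<tau> \<partial>lborel)"
      by (simp add: nn_integral_cmult nn_integral_multc add.commute)
    also have "\<dots> = (\<integral>\<^sup>+\<tau>. ennreal K * (\<integral>\<^sup>+x. epow (k x) r \<partial>lborel) * indicator {-(5*R)..5*R} \<tau> \<partial>lborel)"
      by (subst nn_integral_translate[of "\<lambda>x. epow (k x) r"]) auto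
    also have "\<dots> = ennreal R * (ennreal (10 * K) * (\<integral>\<^sup>+x. epow (k x) r \<partial>lborel))"
    proof -
      have "ennreal K * ennreal (10 * R) = ennreal R * ennreal (10 * K)"
        using R K by (simp add: ennreal_mult[symmetric] mult_ac)
      then show ?thesis
        using R by (subst nn_integral_cmult_indicator) (auto, metis mult.assoc mult.commute)
    qed
    finally have "I \<le> ennreal (10 * K) * (\<integral>\<^sup>+x. epow (k x) r \<partial>lborel)"
      using R by (subst (asm) ennreal_mult_le_mult_iff) auto
    then show "(\<integral>\<^sup>+x\<in>ball x0 R. epow (ray_level \<gamma> (\<lambda>t. k (x + t *\<^sub>R u))) r \<partial>lborel) \<le> ennreal (10 * K) * (\<integral>\<^sup>+z. epow (k z) r \<partial>lborel)"
      by (simp add: I_def E_def)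
  qed
qed

section \<open>Morrey norms\<close>

lemma morrey_norm_mono:
  assumes "0 < r" "\<And>x. F x \<le> G x"
  shows "morrey_norm \<alpha> r F \<le> morrey_norm \<alpha> r G"
  unfolding morrey_norm_def using assms
  by (intro SUP_mono' mult_left_mono epow_mono nn_integral_mono mult_right_mono) auto

lemma morrey_norm_cmult:
  assumes "0 < r" and [measurable]: "F \<in> borel_measurable borel"
  shows "morrey_norm \<alpha> r (\<lambda>x. c * F x) = c * morrey_norm \<alpha> r F"
proof -
  have "epow (\<integral>\<^sup>+y\<in>ball x \<rho>. epow (c * F y) r \<partial>lborel) (1 / r)
    = c * epow (\<integral>\<^sup>+y\<in>ball x \<rho>. epow (F y) r \<partial>lborel) (1 / r)" for x \<rho>
  proof -
    have "(\<integral>\<^sup>+y\<in>ball x \<rho>. epow (c * F y) r \<partial>lborel) = epow c r * (\<integral>\<^sup>+y\<in>ball x \<rho>. epow (F y) r \<partial>lborel)"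
      by (simp add: epow_mult nn_integral_cmult mult.assoc)
    then show ?thesis using assms(1) by (simp add: epow_mult epow_epow)
  qed
  then show ?thesis
    unfolding morrey_norm_def by (simp add: SUP_mult_left_ennreal mult.left_commute)
qed

text \<open>A triangle inequality up to a constant, from \<open>epow_add_le\<close> with exponent
  \<open>r\<close> inside the integral and \<open>1 / r\<close> outside.\<close>

lemma Lr_add_le:
  assumes "1 \<le> r" and [measurable]: "F \<in> borel_measurable M" "G \<in> borel_measurable M" "A \<in> sets M"
  shows "epow (\<integral>\<^sup>+x\<in>A. epow (F x + G x) r \<partial>M) (1 / r) \<le> ennreal (2 * 2 powr (1 / r)) *
    (epow (\<integral>\<^sup>+x\<in>A. epow (F x) r \<partial>M) (1 / r) + epow (\<integral>\<^sup>+x\<in>A. epow (G x) r \<partial>M) (1 / r))"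
proof -
  have "(\<integral>\<^sup>+x\<in>A. epow (F x + G x) r \<partial>M)
    \<le> (\<integral>\<^sup>+x. ennreal (2 powr r) * (epow (F x) r * indicator A x + epow (G x) r * indicator A x) \<partial>M)"
    using assms(1) by (intro nn_integral_mono) (auto simp: indicator_def epow_add_le)
  also have "\<dots> = ennreal (2 powr r) * ((\<integral>\<^sup>+x\<in>A. epow (F x) r \<partial>M) + (\<integral>\<^sup>+x\<in>A. epow (G x) r \<partial>M))"
    by (simp add: nn_integral_cmult nn_integral_add)
  finally have "epow (\<integral>\<^sup>+x\<in>A. epow (F x + G x) r \<partial>M) (1 / r)
    \<le> epow (ennreal (2 powr r) * ((\<integral>\<^sup>+x\<in>A. epow (F x) r \<partial>M) + (\<integral>\<^sup>+x\<in>A. epow (G x) r \<partial>M))) (1 / r)"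
    using assms(1) by (intro epow_mono) auto
  also have "\<dots> = ennreal 2 * epow ((\<integral>\<^sup>+x\<in>A. epow (F x) r \<partial>M) + (\<integral>\<^sup>+x\<in>A. epow (G x) r \<partial>M)) (1 / r)"
    using assms(1) by (simp add: epow_mult epow_ennreal powr_powr)
  also have "\<dots> \<le> ennreal 2 * (ennreal (2 powr (1 / r)) *
    (epow (\<integral>\<^sup>+x\<in>A. epow (F x) r \<partial>M) (1 / r) + epow (\<integral>\<^sup>+x\<in>A. epow (G x) r \<partial>M) (1 / r)))"
    using assms(1) by (intro mult_left_mono epow_add_le) auto
  also have "\<dots> = ennreal (2 * 2 powr (1 / r)) *
    (epow (\<integral>\<^sup>+x\<in>A. epow (F x) r \<partial>M) (1 / r) + epow (\<integral>\<^sup>+x\<in>A. epow (G x) r \<partial>M) (1 / r))"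
    by (simp add: ennreal_mult mult.assoc)
  finally show ?thesis .
qed

lemma le_morrey_norm:
  "0 < \<rho> \<Longrightarrow> ennreal (measure lborel (ball x \<rho>) powr (1/\<alpha> - 1/r)) *
     epow (\<integral>\<^sup>+ y\<in>ball x \<rho>. epow (F y) r \<partial>lborel) (1/r) \<le> morrey_norm \<alpha> r F"
  unfolding morrey_norm_def by (rule SUP_upper2[OF UNIV_I]) (rule SUP_upper, simp)

lemma morrey_norm_add_le:
  assumes "1 \<le> r" and [measurable]: "F \<in> borel_measurable borel" "G \<in> borel_measurable borel"
  shows "morrey_norm \<alpha> r (\<lambda>x. F x + G x)
    \<le> ennreal (2 * 2 powr (1 / r)) * (morrey_norm \<alpha> r F + morrey_norm \<alpha> r G)"
  unfolding morrey_norm_def[of _ _ "\<lambda>x. F x + G x"]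
proof (intro SUP_least)
  fix x :: 'a and \<rho> :: real assume "\<rho> \<in> {0<..}"
  then have \<rho>: "0 < \<rho>" by simp
  let ?w = "ennreal (measure lborel (ball x \<rho>) powr (1/\<alpha> - 1/r))"
  let ?L = "\<lambda>F. epow (\<integral>\<^sup>+ y\<in>ball x \<rho>. epow (F y) r \<partial>lborel) (1/r)"
  have "?w * ?L (\<lambda>x. F x + G x) \<le> ?w * (ennreal (2 * 2 powr (1 / r)) * (?L F + ?L G))"
    using assms(1) by (intro mult_left_mono Lr_add_le) auto
  also have "\<dots> = ennreal (2 * 2 powr (1 / r)) * (?w * ?L F + ?w * ?L G)"
    by (simp add: distrib_left mult.left_commute)
  also have "\<dots> \<le> ennreal (2 * 2 powr (1 / r)) * (morrey_norm \<alpha> r F + morrey_norm \<alpha> r G)"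
    using \<rho> by (intro mult_left_mono add_mono le_morrey_norm) auto
  finally show "?w * ?L (\<lambda>x. F x + G x) \<le> \<dots>" .
qed

section \<open>Norms over single balls\<close>

lemma measure_ball_powr:
  assumes "0 < \<rho>"
  shows "measure lborel (ball (x :: 'a::euclidean_space) \<rho>) = unit_ball_vol (real DIM('a)) * \<rho> powr real DIM('a)"
  using assms by (simp add: content_ball powr_realpow)

lemma unit_ball_vol_neq_0 [simp]: "unit_ball_vol (real n) \<noteq> 0"
  using unit_ball_vol_pos[of "real n"] by linarith

lemma ball_Lr_le:
  assumes "0 < \<rho>"
  shows "epow (\<integral>\<^sup>+y\<in>ball (x :: 'a::euclidean_space) \<rho>. epow (F y) r \<partial>lborel) (1/r)
    \<le> ennreal (measure lborel (ball x \<rho>) powr (1/r - 1/\<alpha>)) * morrey_norm \<alpha> r F"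
proof -
  let ?m = "measure lborel (ball x \<rho>)"
  have m: "0 < ?m" using assms by (simp add: content_ball)
  have "epow (\<integral>\<^sup>+y\<in>ball x \<rho>. epow (F y) r \<partial>lborel) (1/r)
    = ennreal (?m powr (1/r - 1/\<alpha>) * ?m powr (1/\<alpha> - 1/r)) * epow (\<integral>\<^sup>+y\<in>ball x \<rho>. epow (F y) r \<partial>lborel) (1/r)"
    using m by (simp add: powr_add[symmetric])
  also have "\<dots> = ennreal (?m powr (1/r - 1/\<alpha>)) * (ennreal (?m powr (1/\<alpha> - 1/r)) * epow (\<integral>\<^sup>+y\<in>ball x \<rho>. epow (F y) r \<partial>lborel) (1/r))"
    by (simp add: ennreal_mult mult.assoc)
  also have "\<dots> \<le> ennreal (?m powr (1/r - 1/\<alpha>)) * morrey_norm \<alpha> r F"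
    by (intro mult_left_mono le_morrey_norm assms) auto
  finally show ?thesis .
qed

text \<open>Hoelder's inequality on the ball, as a root of Jensen's. The exponents
  \<open>(r - 1) / r\<close> and \<open>1/r - 1/\<alpha>\<close> of the volume add up to one without
  \<open>r\<close>.\<close>

lemma ball_L1_le:
  fixes F :: "'a::euclidean_space \<Rightarrow> ennreal"
  assumes "1 \<le> r" "0 < \<rho>" and [measurable]: "F \<in> borel_measurable borel"
  shows "(\<integral>\<^sup>+y\<in>ball x \<rho>. F y \<partial>lborel)
    \<le> ennreal (measure lborel (ball x \<rho>) powr (1 - 1/\<alpha>)) * morrey_norm \<alpha> r F"
proof -
  let ?m = "measure lborel (ball x \<rho>)"
  have m: "0 < ?m" using assms by (simp add: content_ball)
  have "epow (epow (\<integral>\<^sup>+y\<in>ball x \<rho>. F y \<partial>lborel) r) (1/r)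
    \<le> epow (ennreal (?m powr (r - 1)) * (\<integral>\<^sup>+y\<in>ball x \<rho>. epow (F y) r \<partial>lborel)) (1/r)"
    using assms m emeasure_bounded_finite[of "ball x \<rho>"] 
    by (intro epow_mono epow_nn_integral_le) auto
  then have "(\<integral>\<^sup>+y\<in>ball x \<rho>. F y \<partial>lborel)
    \<le> ennreal (?m powr ((r - 1) / r)) * epow (\<integral>\<^sup>+y\<in>ball x \<rho>. epow (F y) r \<partial>lborel) (1/r)"
    using assms(1) by (simp add: epow_epow epow_mult epow_ennreal powr_powr)
  also have "\<dots> \<le> ennreal (?m powr ((r - 1) / r)) * (ennreal (?m powr (1/r - 1/\<alpha>)) * morrey_norm \<alpha> r F)"
    by (intro mult_left_mono ball_Lr_le assms) auto
  also have "\<dots> = ennreal (?m powr (1 - 1/\<alpha>)) * morrey_norm \<alpha> r F"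
  proof -
    have "(r - 1) / r + (1/r - 1/\<alpha>) = 1 - 1/\<alpha>" using assms(1) by (simp add: diff_divide_distrib)
    then have "?m powr ((r - 1) / r) * ?m powr (1/r - 1/\<alpha>) = ?m powr (1 - 1/\<alpha>)"
      by (metis powr_add)
    then show ?thesis by (metis ennreal_mult mult.assoc powr_ge_zero)
  qed
  finally show ?thesis .
qed

section \<open>The endpoint inequality\<close>

text \<open>The average of \<open>k\<close> over directions at distance about \<open>t\<close> is at
  most a multiple of \<open>t powr - (n / \<alpha>)\<close>. Dividing by \<open>t\<close> and
  integrating from \<open>R / 2\<close> on gives the factor \<open>R powr - (n / \<alpha>)\<close>,
  which offsets the growth in \<open>R\<close> of the Morrey norm of a constant on the ball.\<close>

lemma ray_level_far:
  assumes "1 \<le> r" "0 < \<alpha>" "\<gamma> \<noteq> 0"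
  obtains K where "0 < K" "\<And>(k :: 'a::euclidean_space \<Rightarrow> ennreal) x0 x R. k \<in> borel_measurable borel \<Longrightarrow>
    0 < R \<Longrightarrow> x \<in> ball x0 R \<Longrightarrow> (\<And>z. z \<in> ball x0 (2 * R) \<Longrightarrow> k z = 0) \<Longrightarrow>
    (\<integral>\<^sup>+u\<in>shell. ray_level \<gamma> (\<lambda>t. k (x + t *\<^sub>R u)) \<partial>lborel) \<le> ennreal (K * R powr - (real DIM('a) / \<alpha>)) * morrey_norm \<alpha> r k"
proof -
  let ?n = "real DIM('a)"
  \<comment> \<open>Comes from the volume of \<open>ball x (2 * t)\<close>, which contains
    \<open>x + t *\<^sub>R u\<close> for all \<open>u\<close> in the shell, under the exponent of
    \<open>ball_L1_le\<close>.\<close>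
  define v where "v = (unit_ball_vol ?n * 2 powr ?n) powr (1 - 1/\<alpha>)"
  have v: "0 < v" by (simp add: v_def)
  define K where "K = 1 / \<bar>\<gamma>\<bar> * (v * (2 powr (?n / \<alpha>) / (?n / \<alpha>)))"
  have "0 < K" using v assms by (simp add: K_def)
  have main: "(\<integral>\<^sup>+u\<in>shell. ray_level \<gamma> (\<lambda>t. k (x + t *\<^sub>R u)) \<partial>lborel) \<le> ennreal (K * R powr - (?n / \<alpha>)) * morrey_norm \<alpha> r k"
    if [measurable]: "k \<in> borel_measurable borel" and R: "0 < R" and x: "x \<in> ball x0 R"
      and supp: "\<And>z. z \<in> ball x0 (2 * R) \<Longrightarrow> k z = 0" for k :: "'a \<Rightarrow> ennreal" and x0 x R
  proof -
    define N where "N = morrey_norm \<alpha> r k"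
    \<comment> \<open>For \<open>t < R / 2\<close> the point is still in the ball where
      \<open>k\<close> vanishes; for the other \<open>t\<close> up to \<rho> the factor
      \<open>\<rho> / t\<close> is at least 1. The result has the form that
      \<open>ray_level_le\<close> asks for.\<close>
    have ray_int_le: "ray_int (\<lambda>t. k (x + t *\<^sub>R u)) \<rho> \<le> ennreal \<rho> * (\<integral>\<^sup>+t\<in>{R/2..}. k (x + t *\<^sub>R u) * ennreal (1 / t) \<partial>lborel)"
      if "u \<in> shell" "0 < \<rho>" for u \<rho>
    proof -
      have "ray_int (\<lambda>t. k (x + t *\<^sub>R u)) \<rho> \<le> (\<integral>\<^sup>+t. ennreal \<rho> * (k (x + t *\<^sub>R u) * ennreal (1 / t) * indicator {R/2..} t) \<partial>lborel)"
        unfolding ray_int_def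
      proof (rule nn_integral_mono)
        fix t
        show "k (x + t *\<^sub>R u) * indicator {0..\<rho>} t \<le> ennreal \<rho> * (k (x + t *\<^sub>R u) * ennreal (1 / t) * indicator {R/2..} t)"
        proof (cases "0 \<le> t \<and> t \<le> \<rho>")
          case t: True
          show ?thesis
          proof (cases "R / 2 \<le> t")
            case True
            then have "0 < t" using R by simp
            then have "1 \<le> ennreal \<rho> * ennreal (1 / t)"
              using t that by (simp add: ennreal_mult[symmetric])
            then have "k (x + t *\<^sub>R u) * 1 \<le> k (x + t *\<^sub>R u) * (ennreal \<rho> * ennreal (1 / t))"
              by (intro mult_left_mono) auto
            then show ?thesis using True t by (simp add: mult_ac)
          next
            case False
            have "norm (t *\<^sub>R u) \<le> R / 2 * 2"
              unfolding norm_scaleR using t False that by (intro mult_mono) (auto simp: shell_def)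
            then have "x + t *\<^sub>R u \<in> ball x0 (2 * R)"
              using x norm_triangle_ineq4[of "x0 - x" "t *\<^sub>R u"] by (auto simp: dist_norm algebra_simps)
            then show ?thesis using supp by simp
          qed
        qed auto
      qed
      also have "\<dots> = ennreal \<rho> * (\<integral>\<^sup>+t\<in>{R/2..}. k (x + t *\<^sub>R u) * ennreal (1 / t) \<partial>lborel)"
        by (rule nn_integral_cmult) measurable
      finally show ?thesis .
    qed
    have inner: "(\<integral>\<^sup>+u\<in>shell. k (x + t *\<^sub>R u) \<partial>lborel) \<le> ennreal (v * t powr - (?n / \<alpha>)) * N" if t: "0 < t" for t
    proof -
      have "(\<integral>\<^sup>+u\<in>shell. k (x + t *\<^sub>R u) \<partial>lborel)
        \<le> (\<integral>\<^sup>+u. k (x + t *\<^sub>R u) * indicator (ball x (2 * t)) (x + t *\<^sub>R u) \<partial>lborel)"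
        using t by (intro nn_integral_mono) (auto simp: indicator_def shell_def dist_norm)
      also have "\<dots> = ennreal (t powr - ?n) * (\<integral>\<^sup>+z. k (x + z) * indicator (ball x (2 * t)) (x + z) \<partial>lborel)"
        by (rule nn_integral_scale[OF _ t]) measurable
      also have "\<dots> = ennreal (t powr - ?n) * (\<integral>\<^sup>+z\<in>ball x (2 * t). k z \<partial>lborel)"
        by (subst nn_integral_translate[of "\<lambda>z. k z * indicator (ball x (2 * t)) z"]) auto
      also have "\<dots> \<le> ennreal (t powr - ?n) * (ennreal (measure lborel (ball x (2 * t)) powr (1 - 1/\<alpha>)) * N)"
        unfolding N_def using t assms by (intro mult_left_mono ball_L1_le) auto
      also have "measure lborel (ball x (2 * t)) powr (1 - 1/\<alpha>) = v * t powr (?n * (1 - 1/\<alpha>))"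
        using t by (simp add: measure_ball_powr powr_mult powr_powr v_def)
      also have "ennreal (t powr - ?n) * (ennreal (v * t powr (?n * (1 - 1/\<alpha>))) * N) = ennreal (v * t powr - (?n / \<alpha>)) * N"
      proof -
        have "t powr - ?n * (v * t powr (?n * (1 - 1/\<alpha>))) = v * t powr (- ?n + ?n * (1 - 1/\<alpha>))"
          by (simp only: powr_add mult_ac)
        also have "- ?n + ?n * (1 - 1/\<alpha>) = - (?n / \<alpha>)" by (simp add: algebra_simps)
        finally have "ennreal (t powr - ?n) * ennreal (v * t powr (?n * (1 - 1/\<alpha>))) = ennreal (v * t powr - (?n / \<alpha>))"
          using v by (subst ennreal_mult[symmetric]) (simp_all only: powr_ge_zero mult_nonneg_nonneg less_imp_le)
        then show ?thesis by (metis mult.assoc)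
      qed
      finally show ?thesis .
    qed
    have "(\<integral>\<^sup>+u\<in>shell. ray_level \<gamma> (\<lambda>t. k (x + t *\<^sub>R u)) \<partial>lborel)
      \<le> (\<integral>\<^sup>+u. ennreal (1 / \<bar>\<gamma>\<bar>) * ((\<integral>\<^sup>+t\<in>{R/2..}. k (x + t *\<^sub>R u) * ennreal (1 / t) \<partial>lborel) * indicator shell u) \<partial>lborel)"
    proof (rule nn_integral_mono)
      fix u
      show "ray_level \<gamma> (\<lambda>t. k (x + t *\<^sub>R u)) * indicator shell u
        \<le> ennreal (1 / \<bar>\<gamma>\<bar>) * ((\<integral>\<^sup>+t\<in>{R/2..}. k (x + t *\<^sub>R u) * ennreal (1 / t) \<partial>lborel) * indicator shell u)"
        using ray_level_le[OF assms(3) ray_int_le, of u] by (cases "u \<in> shell") simp_all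
    qed
    also have "\<dots> = ennreal (1 / \<bar>\<gamma>\<bar>) * (\<integral>\<^sup>+u. (\<integral>\<^sup>+t. k (x + t *\<^sub>R u) * ennreal (1 / t) * indicator {R/2..} t * indicator shell u \<partial>lborel) \<partial>lborel)"
      by (simp add: nn_integral_cmult nn_integral_multc)
    also have "(\<integral>\<^sup>+u. (\<integral>\<^sup>+t. k (x + t *\<^sub>R u) * ennreal (1 / t) * indicator {R/2..} t * indicator shell u \<partial>lborel) \<partial>lborel)
      = (\<integral>\<^sup>+t. (\<integral>\<^sup>+u. k (x + t *\<^sub>R u) * ennreal (1 / t) * indicator {R/2..} t * indicator shell u \<partial>lborel) \<partial>lborel)"
      by (rule lborel_pair.Fubini'[symmetric]) measurable
    also have "\<dots> = (\<integral>\<^sup>+t. ennreal (1 / t) * indicator {R/2..} t * (\<integral>\<^sup>+u\<in>shell. k (x + t *\<^sub>R u) \<partial>lborel) \<partial>lborel)"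
      by (subst nn_integral_cmult[symmetric]) (auto simp: mult_ac)
    also have "\<dots> \<le> (\<integral>\<^sup>+t. (ennreal v * N) * (ennreal (t powr (- (?n / \<alpha>) - 1)) * indicator {R/2..} t) \<partial>lborel)"
    proof (rule nn_integral_mono)
      fix t
      show "ennreal (1 / t) * indicator {R/2..} t * (\<integral>\<^sup>+u\<in>shell. k (x + t *\<^sub>R u) \<partial>lborel)
        \<le> (ennreal v * N) * (ennreal (t powr (- (?n / \<alpha>) - 1)) * indicator {R/2..} t)"
      proof (cases "R / 2 \<le> t")
        case True
        then have t: "0 < t" using R by simp
        have "ennreal (1 / t) * (\<integral>\<^sup>+u\<in>shell. k (x + t *\<^sub>R u) \<partial>lborel) \<le> ennreal (1 / t) * (ennreal (v * t powr - (?n / \<alpha>)) * N)"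
          by (intro mult_left_mono inner t) auto
        also have "\<dots> = ennreal v * N * ennreal (t powr (- (?n / \<alpha>) - 1))"
        proof -
          have "1 / t * (v * t powr - (?n / \<alpha>)) = v * t powr (- (?n / \<alpha>) - 1)"
            using t by (simp add: powr_diff)
          then have "ennreal (1 / t) * ennreal (v * t powr - (?n / \<alpha>)) = ennreal v * ennreal (t powr (- (?n / \<alpha>) - 1))"
            using t v by (subst (1 2) ennreal_mult[symmetric]) auto
          then show ?thesis by (metis mult.assoc mult.commute)
        qed
        finally show ?thesis using True by simp
      qed simp
    qed
    also have "\<dots> = ennreal v * N * ennreal ((R / 2) powr - (?n / \<alpha>) / (?n / \<alpha>))"
      using nn_integral_powr_to_inf[of "- (?n / \<alpha>) - 1" "R / 2"] R assms by (subst nn_integral_cmult) auto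
    also have "(R / 2) powr - (?n / \<alpha>) / (?n / \<alpha>) = 2 powr (?n / \<alpha>) / (?n / \<alpha>) * R powr - (?n / \<alpha>)"
      using R by (simp add: powr_divide powr_minus divide_simps)
    finally have "(\<integral>\<^sup>+u\<in>shell. ray_level \<gamma> (\<lambda>t. k (x + t *\<^sub>R u)) \<partial>lborel)
      \<le> ennreal (1 / \<bar>\<gamma>\<bar>) * (ennreal v * N * ennreal (2 powr (?n / \<alpha>) / (?n / \<alpha>) * R powr - (?n / \<alpha>)))"
      by (simp only: mult_left_mono zero_le)
    also have "\<dots> = ennreal (1 / \<bar>\<gamma>\<bar>) * (ennreal v * ennreal (2 powr (?n / \<alpha>) / (?n / \<alpha>) * R powr - (?n / \<alpha>))) * N"
      by (simp only: mult_ac)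
    also have "ennreal (1 / \<bar>\<gamma>\<bar>) * (ennreal v * ennreal (2 powr (?n / \<alpha>) / (?n / \<alpha>) * R powr - (?n / \<alpha>))) = ennreal (K * R powr - (?n / \<alpha>))"
      unfolding K_def using v assms by (simp add: ennreal_mult[symmetric])
    finally show ?thesis unfolding N_def .
  qed
  from \<open>0 < K\<close> show ?thesis by (rule that) (rule main; simp)
qed

text \<open>On a fixed ball the near part loses only the ratio of the volumes of the balls of radius
  \<open>2 * R\<close> and \<open>R\<close>, and the far part has a bound constant on the ball. Both
  estimates are uniform in center and radius.\<close>

lemma morrey_norm_rays_le:
  assumes r: "1 \<le> r" and \<alpha>: "0 < \<alpha>" and \<gamma>: "\<gamma> \<noteq> 0" "r = 1 \<longrightarrow> 0 < \<gamma> \<or> \<gamma> < -1"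
  obtains K where "0 < K" "\<And>k :: 'a::euclidean_space \<Rightarrow> ennreal. k \<in> borel_measurable borel \<Longrightarrow>
    morrey_norm \<alpha> r (\<lambda>x. \<integral>\<^sup>+u\<in>shell. ray_level \<gamma> (\<lambda>t. k (x + t *\<^sub>R u)) \<partial>lborel) \<le> ennreal K * morrey_norm \<alpha> r k"
proof -
  let ?n = "real DIM('a)"
  obtain K1 where K1: "0 < K1" "\<And>(k :: 'a \<Rightarrow> ennreal) x0 R u. k \<in> borel_measurable borel \<Longrightarrow> 0 < R \<Longrightarrow>
    (\<And>z. z \<notin> ball x0 (2 * R) \<Longrightarrow> k z = 0) \<Longrightarrow> u \<in> shell \<Longrightarrow>
    (\<integral>\<^sup>+x\<in>ball x0 R. epow (ray_level \<gamma> (\<lambda>t. k (x + t *\<^sub>R u))) r \<partial>lborel) \<le> ennreal K1 * (\<integral>\<^sup>+z. epow (k z) r \<partial>lborel)"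
    by (rule ray_level_near[OF r \<gamma>, where 'a='a]) (rule that; blast)
  obtain K2 where K2: "0 < K2" "\<And>(k :: 'a \<Rightarrow> ennreal) x0 x R. k \<in> borel_measurable borel \<Longrightarrow>
    0 < R \<Longrightarrow> x \<in> ball x0 R \<Longrightarrow> (\<And>z. z \<in> ball x0 (2 * R) \<Longrightarrow> k z = 0) \<Longrightarrow>
    (\<integral>\<^sup>+u\<in>shell. ray_level \<gamma> (\<lambda>t. k (x + t *\<^sub>R u)) \<partial>lborel) \<le> ennreal (K2 * R powr - (?n / \<alpha>)) * morrey_norm \<alpha> r k"
    by (rule ray_level_far[OF r \<alpha> \<gamma>(1), where 'a='a]) (rule that; blast)
  define sv where "sv = measure lborel (shell :: 'a set)"
  have sv: "0 < sv" "emeasure lborel (shell :: 'a set) = ennreal sv"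
    using measure_shell_pos[where 'a='a] emeasure_shell_finite[where 'a='a] by (auto simp: sv_def emeasure_eq_ennreal_measure)
  define v where "v = unit_ball_vol ?n"
  have v: "0 < v" by (simp add: v_def)
  \<comment> \<open>Jensen over the shell contributes \<open>sv powr (r - 1)\<close>; integrating
    the bound of \<open>ray_level_near\<close> over the directions contributes
    \<open>sv * K1\<close>.\<close>
  define D where "D = sv powr (r - 1) * (sv * K1)"
  have D: "0 < D" using sv K1 by (simp add: D_def)
  \<comment> \<open>The outer factor is the constant of \<open>Lr_add_le\<close>. Each inner term
    carries a 2 from \<open>k1\<close> or \<open>k2\<close>, and \<open>2 powr ?n\<close> is the
    ratio of the two volumes.\<close>
  define K where "K = 2 * 2 powr (1 / r) * (D powr (1 / r) * (2 powr ?n) powr (1/r - 1/\<alpha>) * 2 + v powr (1 / \<alpha>) * K2 * 2)"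
  have "0 < K" using D v K2(1) by (simp add: K_def add_pos_pos)
  have main: "morrey_norm \<alpha> r (\<lambda>x. \<integral>\<^sup>+u\<in>shell. ray_level \<gamma> (\<lambda>t. k (x + t *\<^sub>R u)) \<partial>lborel) \<le> ennreal K * morrey_norm \<alpha> r k"
    if [measurable]: "k \<in> borel_measurable borel" for k :: "'a \<Rightarrow> ennreal"
    unfolding morrey_norm_def[of _ _ "\<lambda>x. \<integral>\<^sup>+u\<in>shell. ray_level \<gamma> (\<lambda>t. k (x + t *\<^sub>R u)) \<partial>lborel"]
  proof (intro SUP_least)
    fix x0 :: 'a and R :: real assume "R \<in> {0<..}"
    then have R: "0 < R" by simp
    define N where "N = morrey_norm \<alpha> r k"
    define B where "B = ball x0 R"
    define m where "m = measure lborel B"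
    have m: "m = v * R powr ?n" "0 < m" "emeasure lborel B = ennreal m"
    proof -
      show "m = v * R powr ?n" using R by (simp add: m_def B_def v_def measure_ball_powr)
      then show "0 < m" using v R by simp
      show "emeasure lborel B = ennreal m"
        using emeasure_bounded_finite[of B] by (simp add: m_def B_def emeasure_eq_ennreal_measure)
    qed
    have [measurable]: "B \<in> sets borel" by (simp add: B_def)
    \<comment> \<open>The factor 2 is the price of \<open>ray_level_add_le\<close>.\<close>
    define k1 where "k1 z = 2 * (k z * indicator (ball x0 (2 * R)) z)" for z
    define k2 where "k2 z = 2 * (k z * indicator (- ball x0 (2 * R)) z)" for z
    have [measurable]: "k1 \<in> borel_measurable borel" "k2 \<in> borel_measurable borel"
      unfolding k1_def k2_def by measurable
    define P1 where "P1 x = (\<integral>\<^sup>+u\<in>shell. ray_level \<gamma> (\<lambda>t. k1 (x + t *\<^sub>R u)) \<partial>lborel)" for x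
    define P2 where "P2 x = (\<integral>\<^sup>+u\<in>shell. ray_level \<gamma> (\<lambda>t. k2 (x + t *\<^sub>R u)) \<partial>lborel)" for x
    have [measurable]: "P1 \<in> borel_measurable borel" "P2 \<in> borel_measurable borel"
      unfolding P1_def P2_def by measurable
    let ?w = "ennreal (m powr (1/\<alpha> - 1/r))"
    let ?L = "\<lambda>F. epow (\<integral>\<^sup>+ x\<in>B. epow (F x) r \<partial>lborel) (1/r)"
    have split: "(\<integral>\<^sup>+u\<in>shell. ray_level \<gamma> (\<lambda>t. k (x + t *\<^sub>R u)) \<partial>lborel) \<le> P1 x + P2 x" for x
    proof -
      have "ray_level \<gamma> (\<lambda>t. k (x + t *\<^sub>R u)) \<le> ray_level \<gamma> (\<lambda>t. k1 (x + t *\<^sub>R u)) + ray_level \<gamma> (\<lambda>t. k2 (x + t *\<^sub>R u))" for u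
      proof -
        have "ray_level \<gamma> (\<lambda>t. k (x + t *\<^sub>R u)) \<le> ray_level \<gamma> (\<lambda>t. k (x + t *\<^sub>R u) * indicator (ball x0 (2 * R)) (x + t *\<^sub>R u)
          + k (x + t *\<^sub>R u) * indicator (- ball x0 (2 * R)) (x + t *\<^sub>R u))"
          by (rule ray_level_mono) (auto simp: indicator_def)
        also have "\<dots> \<le> ray_level \<gamma> (\<lambda>t. k1 (x + t *\<^sub>R u)) + ray_level \<gamma> (\<lambda>t. k2 (x + t *\<^sub>R u))"
          unfolding k1_def k2_def by (rule ray_level_add_le) measurable
        finally show ?thesis .
      qed
      then have "(\<integral>\<^sup>+u\<in>shell. ray_level \<gamma> (\<lambda>t. k (x + t *\<^sub>R u)) \<partial>lborel)
        \<le> (\<integral>\<^sup>+u. ray_level \<gamma> (\<lambda>t. k1 (x + t *\<^sub>R u)) * indicator shell u + ray_level \<gamma> (\<lambda>t. k2 (x + t *\<^sub>R u)) * indicator shell u \<partial>lborel)"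
        by (intro nn_integral_mono) (auto simp: indicator_def)
      also have "\<dots> = P1 x + P2 x"
        unfolding P1_def P2_def by (rule nn_integral_add) measurable
      finally show ?thesis .
    qed
    \<comment> \<open>Jensen moves the power inside the average over directions, and Tonelli leaves
      one integral over \<open>B\<close> for each direction.\<close>
    have near: "?w * ?L P1 \<le> ennreal (D powr (1 / r) * (2 powr ?n) powr (1/r - 1/\<alpha>) * 2) * N"
    proof -
      have "(\<integral>\<^sup>+x\<in>B. epow (P1 x) r \<partial>lborel)
        \<le> (\<integral>\<^sup>+x. ennreal (sv powr (r - 1)) * (\<integral>\<^sup>+u. epow (ray_level \<gamma> (\<lambda>t. k1 (x + t *\<^sub>R u))) r * indicator shell u \<partial>lborel) * indicator B x \<partial>lborel)"
        unfolding P1_def sv_def using r emeasure_shell_finite measure_shell_pos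
        by (intro nn_integral_mono mult_right_mono epow_nn_integral_le) auto
      also have "\<dots> = (\<integral>\<^sup>+x. ennreal (sv powr (r - 1)) * (\<integral>\<^sup>+u. epow (ray_level \<gamma> (\<lambda>t. k1 (x + t *\<^sub>R u))) r * indicator shell u * indicator B x \<partial>lborel) \<partial>lborel)"
        by (subst nn_integral_multc) (auto simp: mult.assoc)
      also have "\<dots> = ennreal (sv powr (r - 1)) * (\<integral>\<^sup>+x. (\<integral>\<^sup>+u. epow (ray_level \<gamma> (\<lambda>t. k1 (x + t *\<^sub>R u))) r * indicator shell u * indicator B x \<partial>lborel) \<partial>lborel)"
        by (rule nn_integral_cmult) measurable
      also have "(\<integral>\<^sup>+x. (\<integral>\<^sup>+u. epow (ray_level \<gamma> (\<lambda>t. k1 (x + t *\<^sub>R u))) r * indicator shell u * indicator B x \<partial>lborel) \<partial>lborel)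
        = (\<integral>\<^sup>+u. (\<integral>\<^sup>+x. epow (ray_level \<gamma> (\<lambda>t. k1 (x + t *\<^sub>R u))) r * indicator shell u * indicator B x \<partial>lborel) \<partial>lborel)"
        by (rule lborel_pair.Fubini'[symmetric]) measurable
      also have "\<dots> = (\<integral>\<^sup>+u. (\<integral>\<^sup>+x\<in>B. epow (ray_level \<gamma> (\<lambda>t. k1 (x + t *\<^sub>R u))) r \<partial>lborel) * indicator shell u \<partial>lborel)"
        by (subst nn_integral_multc[symmetric]) (auto simp: mult_ac)
      also have "\<dots> \<le> (\<integral>\<^sup>+u. ennreal K1 * (\<integral>\<^sup>+z. epow (k1 z) r \<partial>lborel) * indicator shell (u::'a) \<partial>lborel)"
      proof (rule nn_integral_mono)
        fix u
        have "(\<integral>\<^sup>+x\<in>B. epow (ray_level \<gamma> (\<lambda>t. k1 (x + t *\<^sub>R u))) r \<partial>lborel) \<le> ennreal K1 * (\<integral>\<^sup>+z. epow (k1 z) r \<partial>lborel)" if "u \<in> shell"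
          unfolding B_def using R that by (intro K1(2)) (auto simp: k1_def)
        then show "(\<integral>\<^sup>+x\<in>B. epow (ray_level \<gamma> (\<lambda>t. k1 (x + t *\<^sub>R u))) r \<partial>lborel) * indicator shell u
          \<le> ennreal K1 * (\<integral>\<^sup>+z. epow (k1 z) r \<partial>lborel) * indicator shell u"
          by (auto simp: indicator_def)
      qed
      also have "\<dots> = ennreal K1 * (\<integral>\<^sup>+z. epow (k1 z) r \<partial>lborel) * ennreal sv"
        by (subst nn_integral_cmult_indicator) (auto simp: sv)
      finally have "(\<integral>\<^sup>+x\<in>B. epow (P1 x) r \<partial>lborel) \<le> ennreal (sv powr (r - 1)) * (ennreal K1 * (\<integral>\<^sup>+z. epow (k1 z) r \<partial>lborel) * ennreal sv)"
        by (simp add: mult_left_mono)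
      also have "\<dots> = ennreal D * (\<integral>\<^sup>+z. epow (k1 z) r \<partial>lborel)"
        unfolding D_def using sv K1 by (simp add: ennreal_mult mult_ac)
      also have "(\<integral>\<^sup>+z. epow (k1 z) r \<partial>lborel) = epow 2 r * (\<integral>\<^sup>+z\<in>ball x0 (2 * R). epow (k z) r \<partial>lborel)"
        unfolding k1_def epow_mult
        by (subst nn_integral_cmult[symmetric]) (auto intro!: nn_integral_cong simp: indicator_def epow_ennreal[of 1 r, simplified])
      finally have "?L P1 \<le> epow (ennreal D * (epow 2 r * (\<integral>\<^sup>+z\<in>ball x0 (2 * R). epow (k z) r \<partial>lborel))) (1 / r)"
        using r by (intro epow_mono) auto
      also have "\<dots> = ennreal (D powr (1 / r)) * (2 * epow (\<integral>\<^sup>+z\<in>ball x0 (2 * R). epow (k z) r \<partial>lborel) (1 / r))"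
        using r D by (simp add: epow_mult epow_epow epow_ennreal)
      also have "\<dots> \<le> ennreal (D powr (1 / r)) * (2 * (ennreal (measure lborel (ball x0 (2 * R)) powr (1/r - 1/\<alpha>)) * N))"
        unfolding N_def using R by (intro mult_left_mono ball_Lr_le) auto
      also have "measure lborel (ball x0 (2 * R)) = 2 powr ?n * m"
        using R by (simp add: measure_ball_powr m powr_mult v_def)
      finally have "?w * ?L P1 \<le> ?w * (ennreal (D powr (1 / r)) * (2 * (ennreal ((2 powr ?n * m) powr (1/r - 1/\<alpha>)) * N)))"
        by (intro mult_left_mono) auto
      also have "\<dots> = ennreal (m powr (1/\<alpha> - 1/r) * (D powr (1 / r) * (2 * (2 powr ?n * m) powr (1/r - 1/\<alpha>)))) * N"
        by (simp add: ennreal_mult mult_ac)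
      also have "m powr (1/\<alpha> - 1/r) * (D powr (1 / r) * (2 * (2 powr ?n * m) powr (1/r - 1/\<alpha>)))
        = D powr (1 / r) * (2 powr ?n) powr (1/r - 1/\<alpha>) * 2 * (m powr (1/\<alpha> - 1/r) * m powr (1/r - 1/\<alpha>))"
        using m(2) by (simp only: powr_mult mult_ac)
      also have "m powr (1/\<alpha> - 1/r) * m powr (1/r - 1/\<alpha>) = 1"
        using m(2) by (simp add: powr_add[symmetric])
      finally show ?thesis by simp
    qed
    have far: "?w * ?L P2 \<le> ennreal (v powr (1 / \<alpha>) * K2 * 2) * N"
    proof -
      define Q where "Q = ennreal (K2 * R powr - (?n / \<alpha>)) * (2 * N)"
      have "morrey_norm \<alpha> r k2 \<le> morrey_norm \<alpha> r (\<lambda>z. 2 * k z)"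
        using r by (intro morrey_norm_mono) (auto simp: k2_def indicator_def)
      also have "\<dots> = 2 * N" using r by (simp add: morrey_norm_cmult N_def)
      finally have k2N: "morrey_norm \<alpha> r k2 \<le> 2 * N" .
      have "P2 x \<le> Q" if "x \<in> B" for x
      proof -
        have "P2 x \<le> ennreal (K2 * R powr - (?n / \<alpha>)) * morrey_norm \<alpha> r k2"
          unfolding P2_def using that R by (intro K2(2)[of _ _ _ x0]) (auto simp: B_def k2_def)
        also have "\<dots> \<le> Q" unfolding Q_def by (intro mult_left_mono k2N) auto
        finally show ?thesis .
      qed
      then have "?L P2 \<le> epow (\<integral>\<^sup>+x. epow Q r * indicator B x \<partial>lborel) (1 / r)"
        using r by (intro epow_mono nn_integral_mono) (auto simp: indicator_def epow_mono)
      also have "\<dots> = ennreal (m powr (1 / r)) * Q"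
        using r m(2) by (subst nn_integral_cmult_indicator) (auto simp: m(3) epow_mult epow_epow epow_ennreal mult.commute)
      finally have "?w * ?L P2 \<le> ?w * (ennreal (m powr (1 / r)) * Q)"
        by (intro mult_left_mono) auto
      also have "\<dots> = ennreal (m powr (1/\<alpha> - 1/r) * m powr (1 / r) * (K2 * R powr - (?n / \<alpha>)) * 2) * N"
        unfolding Q_def using K2(1) by (simp add: ennreal_mult mult_ac)
      \<comment> \<open>What is left of the weight grows like \<open>R powr (?n / \<alpha>)\<close>
        and cancels the decay in \<open>Q\<close>.\<close>
      also have "m powr (1/\<alpha> - 1/r) * m powr (1 / r) = v powr (1 / \<alpha>) * R powr (?n / \<alpha>)"
        using v R by (subst powr_add[symmetric]) (simp add: m(1) powr_mult powr_powr)
      also have "v powr (1 / \<alpha>) * R powr (?n / \<alpha>) * (K2 * R powr - (?n / \<alpha>)) * 2 = v powr (1 / \<alpha>) * K2 * 2"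
        using R by (simp add: powr_minus field_simps)
      finally show ?thesis .
    qed
    have "?w * ?L (\<lambda>x. \<integral>\<^sup>+u\<in>shell. ray_level \<gamma> (\<lambda>t. k (x + t *\<^sub>R u)) \<partial>lborel) \<le> ?w * ?L (\<lambda>x. P1 x + P2 x)"
      using r split by (intro mult_left_mono epow_mono nn_integral_mono mult_right_mono) auto
    also have "\<dots> \<le> ?w * (ennreal (2 * 2 powr (1 / r)) * (?L P1 + ?L P2))"
      using r by (intro mult_left_mono Lr_add_le) auto
    also have "\<dots> = ennreal (2 * 2 powr (1 / r)) * (?w * ?L P1 + ?w * ?L P2)"
      by (simp add: distrib_left mult.left_commute)
    also have "\<dots> \<le> ennreal (2 * 2 powr (1 / r)) * (ennreal (D powr (1 / r) * (2 powr ?n) powr (1/r - 1/\<alpha>) * 2) * N + ennreal (v powr (1 / \<alpha>) * K2 * 2) * N)"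
      by (intro mult_left_mono add_mono near far) auto
    also have "\<dots> = ennreal K * N"
    proof -
      have "0 \<le> D powr (1 / r) * (2 powr ?n) powr (1/r - 1/\<alpha>) * 2" "0 \<le> v powr (1 / \<alpha>) * K2 * 2"
        using K2(1) by auto
      then show ?thesis
        unfolding K_def distrib_right[symmetric] by (subst ennreal_mult) (auto simp: ennreal_plus mult.assoc simp del: ennreal_plus[symmetric])
    qed
    finally show "ennreal (measure lborel (ball x0 R) powr (1/\<alpha> - 1/r)) *
        epow (\<integral>\<^sup>+ x\<in>ball x0 R. epow (\<integral>\<^sup>+u\<in>shell. ray_level \<gamma> (\<lambda>t. k (x + t *\<^sub>R u)) \<partial>lborel) r \<partial>lborel) (1/r) \<le> ennreal K * morrey_norm \<alpha> r k"
      by (simp only: N_def m_def B_def)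
  qed
  from \<open>0 < K\<close> show ?thesis by (rule that) (rule main; simp)
qed

section \<open>The level-set functional and its endpoint bound\<close>

lemma GDERIV_borel_measurable:
  fixes f :: "'a::euclidean_space \<Rightarrow> real"
  assumes "\<And>x. GDERIV f x :> g x"
  shows "f \<in> borel_measurable borel"
proof -
  have "continuous (at x) f" for x
    using assms[of x] by (intro has_derivative_continuous) (auto simp: gderiv_def)
  then show ?thesis
    by (intro borel_measurable_continuous_onI) (simp add: continuous_at_imp_continuous_on)
qed

lemma Dset_indicator_measurable [measurable]:
  fixes f :: "'a::euclidean_space \<Rightarrow> real"
  assumes [measurable]: "f \<in> borel_measurable borel"
  shows "(\<lambda>p. indicator (Dset t \<beta> \<sigma> f) p :: ennreal) \<in> borel_measurable (borel \<Otimes>\<^sub>M borel)"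
proof -
  have "(\<lambda>p. indicator (Dset t \<beta> \<sigma> f) p :: ennreal) = (\<lambda>p. if fst p \<noteq> snd p \<and>
     \<bar>f (fst p) - f (snd p)\<bar> / (dist (fst p) (snd p) powr (\<sigma> + \<beta>)) > t then 1 else 0)"
    by (auto simp: Dset_def fun_eq_iff)
  then show ?thesis by simp
qed

lemma Dint_measurable [measurable]:
  fixes f :: "'a::euclidean_space \<Rightarrow> real"
  assumes [measurable]: "f \<in> borel_measurable borel"
  shows "Dint t \<beta> \<sigma> \<gamma> f \<in> borel_measurable borel"
  unfolding Dint_def by measurable

lemma Dint_subadditive:
  fixes f :: "'a::euclidean_space \<Rightarrow> real"
  assumes [measurable]: "f \<in> borel_measurable borel"
    and "Dset t \<beta> \<sigma> f \<subseteq> Dset t' \<beta>' \<sigma>' f \<union> Dset t'' \<beta>'' \<sigma>'' f"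
  shows "Dint t \<beta> \<sigma> \<gamma> f x \<le> Dint t' \<beta>' \<sigma>' \<gamma> f x + Dint t'' \<beta>'' \<sigma>'' \<gamma> f x"
proof -
  have "Dint t \<beta> \<sigma> \<gamma> f x \<le> (\<integral>\<^sup>+ y. indicator (Dset t' \<beta>' \<sigma>' f) (x, y) * ennreal (dist x y powr (\<gamma> - real DIM('a)))
    + indicator (Dset t'' \<beta>'' \<sigma>'' f) (x, y) * ennreal (dist x y powr (\<gamma> - real DIM('a))) \<partial>lborel)"
    unfolding Dint_def using assms(2) by (intro nn_integral_mono) (auto simp: indicator_def)
  also have "\<dots> = Dint t' \<beta>' \<sigma>' \<gamma> f x + Dint t'' \<beta>'' \<sigma>'' \<gamma> f x"
    unfolding Dint_def by (rule nn_integral_add) measurable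
  finally show ?thesis .
qed

text \<open>The endpoint \<open>s = q = 1\<close>, a Brezis--Seeger--Van Schaftingen--Yung inequality in Morrey spaces.\<close>
lemma morrey_Dint_endpoint:
  assumes r: "1 \<le> r" and \<alpha>: "0 < \<alpha>" and \<gamma>: "\<gamma> \<noteq> 0" "r = 1 \<longrightarrow> 0 < \<gamma> \<or> \<gamma> < -1"
  shows "\<exists>K>0. \<forall>(f :: 'a::euclidean_space \<Rightarrow> real) g. (\<forall>x. GDERIV f x :> g x) \<and> continuous_on UNIV g \<longrightarrow>
    (\<forall>\<nu>>0. morrey_norm \<alpha> r (Dint \<nu> \<gamma> 1 \<gamma> f) \<le> ennreal (K / \<nu>) * morrey_norm \<alpha> r (\<lambda>x. ennreal (norm (g x))))"
proof -
  obtain K where K: "0 < K" "\<And>k :: 'a \<Rightarrow> ennreal. k \<in> borel_measurable borel \<Longrightarrow>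
    morrey_norm \<alpha> r (\<lambda>x. \<integral>\<^sup>+u\<in>shell. ray_level \<gamma> (\<lambda>t. k (x + t *\<^sub>R u)) \<partial>lborel) \<le> ennreal K * morrey_norm \<alpha> r k"
    by (rule morrey_norm_rays_le[OF r \<alpha> \<gamma>, where 'a='a]) (rule that; blast)
  define c where "c = 2 powr \<bar>\<gamma>\<bar>"
  have c: "0 < c" by (simp add: c_def)
  have unit: "morrey_norm \<alpha> r (Dint 1 \<gamma> 1 \<gamma> f) \<le> ennreal (2 * c * K * c) * morrey_norm \<alpha> r (\<lambda>x. ennreal (norm (g x)))"
    if f: "\<And>x. GDERIV f x :> g x" and g: "continuous_on UNIV g" for f :: "'a \<Rightarrow> real" and g
  proof -
    have [measurable]: "g \<in> borel_measurable borel" using g by (rule borel_measurable_continuous_onI)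
    have "morrey_norm \<alpha> r (Dint 1 \<gamma> 1 \<gamma> f)
      \<le> morrey_norm \<alpha> r (\<lambda>x. ennreal (2 * c) * (\<integral>\<^sup>+u\<in>shell. ray_level \<gamma> (\<lambda>t. ennreal c * ennreal (norm (g (x + t *\<^sub>R u)))) \<partial>lborel))"
      unfolding c_def using r by (intro morrey_norm_mono Dint_le_ray_level f g) auto
    also have "\<dots> = ennreal (2 * c) * morrey_norm \<alpha> r (\<lambda>x. \<integral>\<^sup>+u\<in>shell. ray_level \<gamma> (\<lambda>t. ennreal c * ennreal (norm (g (x + t *\<^sub>R u)))) \<partial>lborel)"
      using r by (intro morrey_norm_cmult) auto
    also have "\<dots> \<le> ennreal (2 * c) * (ennreal K * morrey_norm \<alpha> r (\<lambda>x. ennreal c * ennreal (norm (g x))))"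
      by (intro mult_left_mono K(2)[of "\<lambda>x. ennreal c * ennreal (norm (g x))"]) auto
    also have "morrey_norm \<alpha> r (\<lambda>x. ennreal c * ennreal (norm (g x))) = ennreal c * morrey_norm \<alpha> r (\<lambda>x. ennreal (norm (g x)))"
      using r by (intro morrey_norm_cmult) auto
    also have "ennreal (2 * c) * (ennreal K * (ennreal c * morrey_norm \<alpha> r (\<lambda>x. ennreal (norm (g x)))))
      = ennreal (2 * c * K * c) * morrey_norm \<alpha> r (\<lambda>x. ennreal (norm (g x)))"
      using c K(1) by (simp add: ennreal_mult mult.assoc)
    finally show ?thesis .
  qed
  have "morrey_norm \<alpha> r (Dint \<nu> \<gamma> 1 \<gamma> f) \<le> ennreal (2 * c * K * c / \<nu>) * morrey_norm \<alpha> r (\<lambda>x. ennreal (norm (g x)))"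
    if f: "\<And>x. GDERIV f x :> g x" and g: "continuous_on UNIV g" and \<nu>: "0 < \<nu>" for f :: "'a \<Rightarrow> real" and g \<nu>
  proof -
    have [measurable]: "g \<in> borel_measurable borel" using g by (rule borel_measurable_continuous_onI)
    \<comment> \<open>Dividing \<open>f\<close> by \<nu> normalises the level to 1 and scales the
      gradient by \<open>1 / \<nu>\<close>, the source of the dependence on \<nu>.\<close>
    have "Dset \<nu> \<gamma> 1 f = Dset 1 \<gamma> 1 (\<lambda>x. f x / \<nu>)"
      using \<nu> by (auto simp: Dset_def diff_divide_distrib[symmetric] abs_divide field_simps)
    then have "Dint \<nu> \<gamma> 1 \<gamma> f = Dint 1 \<gamma> 1 \<gamma> (\<lambda>x. f x / \<nu>)"
      by (simp add: Dint_def fun_eq_iff)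
    moreover have "GDERIV (\<lambda>x. f x / \<nu>) x :> (1 / \<nu>) *\<^sub>R g x" for x
    proof -
      have "((\<lambda>x. 1 / \<nu> * f x) has_derivative (\<lambda>h. 1 / \<nu> * (h \<bullet> g x))) (at x)"
        using f[of x] unfolding gderiv_def by (rule has_derivative_mult_right)
      then show ?thesis by (simp add: gderiv_def)
    qed
    moreover have "continuous_on UNIV (\<lambda>x. (1 / \<nu>) *\<^sub>R g x)"
      by (intro continuous_intros g)
    ultimately have "morrey_norm \<alpha> r (Dint \<nu> \<gamma> 1 \<gamma> f)
      \<le> ennreal (2 * c * K * c) * morrey_norm \<alpha> r (\<lambda>x. ennreal (norm ((1 / \<nu>) *\<^sub>R g x)))"
      using unit by metis
    also have "(\<lambda>x. ennreal (norm ((1 / \<nu>) *\<^sub>R g x))) = (\<lambda>x. ennreal (1 / \<nu>) * ennreal (norm (g x)))"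
      using \<nu> by (simp add: fun_eq_iff ennreal_mult[symmetric])
    also have "morrey_norm \<alpha> r \<dots> = ennreal (1 / \<nu>) * morrey_norm \<alpha> r (\<lambda>x. ennreal (norm (g x)))"
      using r by (intro morrey_norm_cmult) auto
    also have "ennreal (2 * c * K * c) * (ennreal (1 / \<nu>) * morrey_norm \<alpha> r (\<lambda>x. ennreal (norm (g x))))
      = ennreal (2 * c * K * c / \<nu>) * morrey_norm \<alpha> r (\<lambda>x. ennreal (norm (g x)))"
      using c K(1) \<nu> by (simp add: ennreal_mult[symmetric] mult.assoc[symmetric])
    finally show ?thesis .
  qed
  moreover have "0 < 2 * c * K * c" using c K(1) by simp
  ultimately show ?thesis by blast
qed

text \<open>On balls of volume at most 1 the bound \<open>H\<close> suffices, since
  \<open>m powr (1/\<alpha>) \<le> 1\<close>; on larger balls the weight is at most 1 because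
  \<open>r \<le> \<alpha>\<close>, and the support has finite volume.\<close>

lemma morrey_norm_finite:
  fixes g :: "'a::euclidean_space \<Rightarrow> 'a"
  assumes r: "1 \<le> r" "r \<le> \<alpha>" and g: "continuous_on UNIV g"
    and cpt: "compact (closure {x. norm (g x) \<noteq> 0})"
  shows "morrey_norm \<alpha> r (\<lambda>x. ennreal (norm (g x))) \<noteq> \<infinity>"
proof -
  define S where "S = closure {x. norm (g x) \<noteq> 0}"
  have "compact (g ` S)"
    using cpt g unfolding S_def by (meson compact_continuous_image continuous_on_subset subset_UNIV)
  then obtain H0 where H0: "\<And>x. x \<in> S \<Longrightarrow> norm (g x) \<le> H0"
    using compact_imp_bounded[of "g ` S"] by (auto simp: bounded_iff)
  \<comment> \<open>The maximum keeps the bound positive even if the support is empty and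
    \<open>H0\<close> is arbitrary.\<close>
  define H where "H = max H0 1"
  have H: "1 \<le> H" "norm (g x) \<le> H" for x
  proof -
    show "1 \<le> H" by (simp add: H_def)
    have "x \<in> S" if "norm (g x) \<noteq> 0"
      using that closure_subset[of "{x. norm (g x) \<noteq> 0}"] unfolding S_def by blast
    then show "norm (g x) \<le> H"
      using H0[of x] unfolding H_def by fastforce
  qed
  obtain P where P: "0 < P" "S \<subseteq> ball 0 P"
    using compact_imp_bounded[OF cpt] unfolding S_def[symmetric]
    using bounded_subset_ballD by blast
  define V where "V = measure lborel (ball (0::'a) P)"
  have V: "0 \<le> V" by (simp add: V_def)
  have "morrey_norm \<alpha> r (\<lambda>x. ennreal (norm (g x))) \<le> ennreal (H * (1 + V powr (1 / r)))"
    unfolding morrey_norm_def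
  proof (intro SUP_least)
    fix x :: 'a and \<rho> :: real assume "\<rho> \<in> {0<..}"
    then have \<rho>: "0 < \<rho>" by simp
    define m where "m = measure lborel (ball x \<rho>)"
    have m: "0 < m" using \<rho> by (simp add: m_def content_ball)
    have pt: "epow (ennreal (norm (g y))) r * indicator (ball x \<rho>) y \<le> ennreal (H powr r) * indicator (ball x \<rho> \<inter> ball 0 P) y" for y
    proof (cases "y \<in> ball x \<rho> \<and> norm (g y) \<noteq> 0")
      case True
      then have "y \<in> S" using closure_subset[of "{x. norm (g x) \<noteq> 0}"] unfolding S_def by blast
      with P(2) True H(2)[of y] r show ?thesis
        by (auto simp: epow_ennreal indicator_def intro!: ennreal_leI powr_mono2)
    qed (auto simp: epow_ennreal)
    have "(\<integral>\<^sup>+y\<in>ball x \<rho>. epow (ennreal (norm (g y))) r \<partial>lborel) \<le> (\<integral>\<^sup>+y. ennreal (H powr r) * indicator (ball x \<rho> \<inter> ball 0 P) y \<partial>lborel)"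
      by (intro nn_integral_mono pt)
    also have "\<dots> = ennreal (H powr r) * emeasure lborel (ball x \<rho> \<inter> ball 0 P)"
      by (rule nn_integral_cmult_indicator) measurable
    also have "emeasure lborel (ball x \<rho> \<inter> ball 0 P) \<le> ennreal (min m V)"
    proof -
      have "emeasure lborel (ball x \<rho>) = ennreal m" "emeasure lborel (ball (0::'a) P) = ennreal V"
        using emeasure_bounded_finite[of "ball x \<rho>"] emeasure_bounded_finite[of "ball (0::'a) P"]
        unfolding m_def V_def by (auto intro!: emeasure_eq_ennreal_measure)
      moreover have "emeasure lborel (ball x \<rho> \<inter> ball 0 P) \<le> emeasure lborel (ball x \<rho>)"
        "emeasure lborel (ball x \<rho> \<inter> ball 0 P) \<le> emeasure lborel (ball (0::'a) P)"
        by (auto intro!: emeasure_mono)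
      ultimately show ?thesis by (simp add: min_def)
    qed
    finally have I: "(\<integral>\<^sup>+y\<in>ball x \<rho>. epow (ennreal (norm (g y))) r \<partial>lborel) \<le> ennreal (H powr r * min m V)"
      using m V by (simp add: ennreal_mult mult_left_mono)
    have "ennreal (m powr (1/\<alpha> - 1/r)) * epow (\<integral>\<^sup>+y\<in>ball x \<rho>. epow (ennreal (norm (g y))) r \<partial>lborel) (1/r)
      \<le> ennreal (m powr (1/\<alpha> - 1/r)) * epow (ennreal (H powr r * min m V)) (1/r)"
      using r by (intro mult_left_mono epow_mono I) auto
    also have "\<dots> = ennreal (m powr (1/\<alpha> - 1/r) * (H * min m V powr (1 / r)))"
      using m V H(1) r by (simp add: epow_ennreal powr_mult powr_powr ennreal_mult[symmetric])
    also have "\<dots> \<le> ennreal (H * (1 + V powr (1 / r)))"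
    proof (rule ennreal_leI)
      have "m powr (1/\<alpha> - 1/r) * min m V powr (1 / r) \<le> 1 + V powr (1 / r)"
      proof (cases "m \<le> 1")
        case True
        have "m powr (1/\<alpha> - 1/r) * min m V powr (1 / r) \<le> m powr (1/\<alpha> - 1/r) * m powr (1 / r)"
          using m V r by (intro mult_left_mono powr_mono2) auto
        also have "\<dots> = m powr (1/\<alpha>)" by (simp add: powr_add[symmetric])
        also have "\<dots> \<le> 1" using True m r by (intro powr_le1) auto
        finally show ?thesis using powr_ge_zero[of V "1 / r"] by linarith
      next
        case False
        have "m powr (1/\<alpha> - 1/r) * min m V powr (1 / r) \<le> 1 * V powr (1 / r)"
        proof (intro mult_mono)
          have "1/\<alpha> \<le> 1/r" using r by (simp add: frac_le)
          then have "m powr (1/\<alpha> - 1/r) \<le> m powr 0" using False by (intro powr_mono) auto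
          then show "m powr (1/\<alpha> - 1/r) \<le> 1" using m by simp
        qed (use m V r in \<open>auto intro!: powr_mono2\<close>)
        then show ?thesis by simp
      qed
      then show "m powr (1/\<alpha> - 1/r) * (H * min m V powr (1 / r)) \<le> H * (1 + V powr (1 / r))"
        using H(1) mult_left_mono[of _ _ H] by (simp add: mult.left_commute)
    qed
    finally show "ennreal (measure lborel (ball x \<rho>) powr (1/\<alpha> - 1/r)) *
      epow (\<integral>\<^sup>+y\<in>ball x \<rho>. epow (ennreal (norm (g y))) r \<partial>lborel) (1/r) \<le> ennreal (H * (1 + V powr (1 / r)))"
      by (simp only: m_def)
  qed
  then show ?thesis by (auto simp: top_unique)
qed

text \<open>By continuity a nonzero value would make the norm over some small ball positive. It
  settles the degenerate case of the interpolation, where the level \<open>b / Z\<close> would be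
  0.\<close>

lemma morrey_norm_eq_0_imp:
  fixes g :: "'a::euclidean_space \<Rightarrow> 'a"
  assumes g: "continuous_on UNIV g" and r: "1 \<le> r" and "morrey_norm \<alpha> r (\<lambda>x. ennreal (norm (g x))) = 0"
  shows "g x = 0"
proof (rule ccontr)
  assume "g x \<noteq> 0"
  then have e: "0 < norm (g x) / 2" by simp
  have "isCont g x" using g by (simp add: continuous_on_eq_continuous_at)
  then obtain \<delta> where \<delta>: "0 < \<delta>" "\<And>y. dist y x < \<delta> \<Longrightarrow> dist (g y) (g x) < norm (g x) / 2"
    unfolding continuous_at_eps_delta using e by blast
  have m: "0 < measure lborel (ball x \<delta>)" using \<delta>(1) by (simp add: content_ball)
  have "epow (\<integral>\<^sup>+y\<in>ball x \<delta>. epow (ennreal (norm (g y))) r \<partial>lborel) (1/r)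
    \<le> ennreal (measure lborel (ball x \<delta>) powr (1/r - 1/\<alpha>)) * 0"
    using ball_Lr_le[OF \<delta>(1), where F = "\<lambda>x. ennreal (norm (g x))" and x = x and r = r and \<alpha> = \<alpha>] assms(3) by simp
  then have "(\<integral>\<^sup>+y\<in>ball x \<delta>. epow (ennreal (norm (g y))) r \<partial>lborel) = 0" by simp
  moreover have "ennreal ((norm (g x) / 2) powr r) * emeasure lborel (ball x \<delta>)
    \<le> (\<integral>\<^sup>+y\<in>ball x \<delta>. epow (ennreal (norm (g y))) r \<partial>lborel)"
  proof -
    have "norm (g x) / 2 \<le> norm (g y)" if "y \<in> ball x \<delta>" for y
      using \<delta>(2)[of y] that norm_triangle_ineq2[of "g x" "g y"] by (auto simp: dist_commute dist_norm norm_minus_commute)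
    then have "(\<integral>\<^sup>+y. ennreal ((norm (g x) / 2) powr r) * indicator (ball x \<delta>) y \<partial>lborel)
      \<le> (\<integral>\<^sup>+y\<in>ball x \<delta>. epow (ennreal (norm (g y))) r \<partial>lborel)"
      using r by (intro nn_integral_mono) (auto simp: indicator_def epow_ennreal intro!: ennreal_leI powr_mono2)
    then show ?thesis by (subst (asm) nn_integral_cmult_indicator) auto
  qed
  ultimately have "ennreal ((norm (g x) / 2) powr r) * emeasure lborel (ball x \<delta>) = 0" by simp
  moreover have "emeasure lborel (ball x \<delta>) \<noteq> 0" using m by (auto simp: measure_def)
  ultimately show False using \<open>g x \<noteq> 0\<close> by (simp add: ennreal_eq_0_iff)
qed

lemma Dint_zero_gradient:
  fixes f :: "'a::euclidean_space \<Rightarrow> real"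
  assumes "\<And>x. GDERIV f x :> 0" "0 < t"
  shows "Dint t \<beta> \<sigma> \<gamma> f = (\<lambda>x. 0)"
proof -
  have "f x = f y" for x y
    using abs_diff_le_ray_int[OF assms(1) continuous_on_const zero_le_one, of x "y - x"]
    by (simp add: ray_int_def)
  then have "Dset t \<beta> \<sigma> f = {}" using assms(2) by (auto simp: Dset_def) (metis abs_zero diff_self divide_eq_0_iff less_asym less_irrefl)
  then show ?thesis by (simp add: Dint_def fun_eq_iff)
qed

section \<open>Interpolation\<close>

lemma Dset_interpolation:
  assumes "0 < \<eta>" "\<eta> < 1" "0 < \<mu>" "0 < \<nu>"
    and "\<sigma> + \<beta> = (1 - \<eta>) * (\<sigma>0 + \<beta>0) + \<eta> * (\<sigma>1 + \<beta>1)"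
  shows "Dset (\<mu> powr (1 - \<eta>) * \<nu> powr \<eta>) \<beta> \<sigma> f \<subseteq> Dset \<mu> \<beta>0 \<sigma>0 f \<union> Dset \<nu> \<beta>1 \<sigma>1 f"
proof safe
  fix x y assume xy: "(x, y) \<in> Dset (\<mu> powr (1 - \<eta>) * \<nu> powr \<eta>) \<beta> \<sigma> f" "(x, y) \<notin> Dset \<nu> \<beta>1 \<sigma>1 f"
  define A d where "A = \<bar>f x - f y\<bar>" and "d = dist x y"
  have d: "0 < d" "x \<noteq> y" using xy by (auto simp: Dset_def d_def)
  have *: "\<mu> powr (1 - \<eta>) * \<nu> powr \<eta> < A / d powr (\<sigma> + \<beta>)" "A / d powr (\<sigma>1 + \<beta>1) \<le> \<nu>"
    using xy by (auto simp: Dset_def A_def d_def)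
  have A: "0 < A"
    using *(1) assms(3,4) by (cases "A = 0") (auto simp: A_def mult_less_0_iff)
  \<comment> \<open>The relation between the exponents is exactly what makes this an identity; if
    neither factor exceeded its level, the product could not exceed
    \<open>\<mu> powr (1 - \<eta>) * \<nu> powr \<eta>\<close>.\<close>
  have "A / d powr (\<sigma> + \<beta>) = (A / d powr (\<sigma>0 + \<beta>0)) powr (1 - \<eta>) * (A / d powr (\<sigma>1 + \<beta>1)) powr \<eta>"
  proof -
    have "A = A powr (1 - \<eta>) * A powr \<eta>" using A by (simp add: powr_add[symmetric])
    moreover have "d powr (\<sigma> + \<beta>) = (d powr (\<sigma>0 + \<beta>0)) powr (1 - \<eta>) * (d powr (\<sigma>1 + \<beta>1)) powr \<eta>"
    proof -
      have "\<sigma> + \<beta> = (\<sigma>0 + \<beta>0) * (1 - \<eta>) + (\<sigma>1 + \<beta>1) * \<eta>"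
        using assms(5) by (simp only: mult.commute)
      then have "d powr (\<sigma> + \<beta>) = d powr ((\<sigma>0 + \<beta>0) * (1 - \<eta>)) * d powr ((\<sigma>1 + \<beta>1) * \<eta>)"
        by (simp only: powr_add)
      then show ?thesis by (simp only: powr_powr)
    qed
    ultimately show ?thesis
      using A d by (metis powr_divide times_divide_times_eq less_imp_le powr_ge_zero)
  qed
  moreover have "(A / d powr (\<sigma>1 + \<beta>1)) powr \<eta> \<le> \<nu> powr \<eta>"
    using * A d assms by (intro powr_mono2) auto
  moreover have "(A / d powr (\<sigma>0 + \<beta>0)) powr (1 - \<eta>) \<le> \<mu> powr (1 - \<eta>)" if "A / d powr (\<sigma>0 + \<beta>0) \<le> \<mu>"
    using that A d assms by (intro powr_mono2) auto
  ultimately have "\<mu> < A / d powr (\<sigma>0 + \<beta>0)"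
    using *(1) mult_mono[of "(A / d powr (\<sigma>0 + \<beta>0)) powr (1 - \<eta>)" "\<mu> powr (1 - \<eta>)" "(A / d powr (\<sigma>1 + \<beta>1)) powr \<eta>" "\<nu> powr \<eta>"]
    by fastforce
  then show "(x, y) \<in> Dset \<mu> \<beta>0 \<sigma>0 f" using d by (simp add: Dset_def A_def d_def)
qed

text \<open>
  The levels \<open>\<mu> = a * Z powr - (1 / q0)\<close> and \<open>\<nu> = b / Z\<close> solve \<open>(a / \<mu>) powr q0 = b / \<nu> = Z\<close>.
\<close>
lemma balance_levels:
  fixes a b t q q0 \<eta> :: real
  assumes "0 < a" "0 < b" "0 < t" "0 < q" "0 < q0" "1 / q = (1 - \<eta>) / q0 + \<eta>"
  defines "Z \<equiv> (a powr (1 - \<eta>) * b powr \<eta> / t) powr q"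
  shows "(a * Z powr - (1 / q0)) powr (1 - \<eta>) * (b / Z) powr \<eta> = t"
    and "t * Z powr (1 / q) = a powr (1 - \<eta>) * b powr \<eta>"
    and "0 < Z"
proof -
  show Z: "0 < Z" using assms by (simp add: Z_def)
  have Zq: "Z powr (1 / q) = a powr (1 - \<eta>) * b powr \<eta> / t"
    using assms(1-5) by (simp add: Z_def powr_powr)
  then show eq: "t * Z powr (1 / q) = a powr (1 - \<eta>) * b powr \<eta>" using assms by simp
  have "(b / Z) powr \<eta> = b powr \<eta> * Z powr - \<eta>"
    by (simp add: powr_divide powr_minus_divide)
  then have "(a * Z powr - (1 / q0)) powr (1 - \<eta>) * (b / Z) powr \<eta>
    = a powr (1 - \<eta>) * b powr \<eta> * (Z powr (- (1 / q0) * (1 - \<eta>)) * Z powr - \<eta>)"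
    by (simp only: powr_mult powr_powr mult_ac)
  \<comment> \<open>The exponents add up to \<open>- (1 - \<eta>) / q0 - \<eta>\<close>, which is
    \<open>- (1 / q)\<close> by hypothesis.\<close>
  also have "Z powr (- (1 / q0) * (1 - \<eta>)) * Z powr - \<eta> = Z powr - (1 / q)"
    unfolding powr_add[symmetric] using assms(6) by (simp add: algebra_simps)
  also have "a powr (1 - \<eta>) * b powr \<eta> * Z powr - (1 / q) = t"
    unfolding eq[symmetric] using Z by (simp add: powr_minus)
  finally show "(a * Z powr - (1 / q0)) powr (1 - \<eta>) * (b / Z) powr \<eta> = t" .
qed

theorem theorem5p3:
  fixes r \<alpha> \<gamma> \<eta> s0 s q q0 :: real
  assumes "1 \<le> r" "r \<le> \<alpha>" "\<gamma> \<noteq> 0" "0 < \<eta>" "\<eta> < 1"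
    and "0 \<le> s0" "s0 < s" "s < 1" "1 < q" "q < q0"
    and "s = (1 - \<eta>) * s0 + \<eta>" "1 / q = (1 - \<eta>) / q0 + \<eta>"
    and "r = 1 \<and> \<gamma> < 0 \<longrightarrow> \<gamma> < -1 \<and> DIM('a::euclidean_space) = 1"
  shows "\<exists>C>0. \<forall>(f :: 'a \<Rightarrow> real) (g :: 'a \<Rightarrow> 'a).
           (\<forall>x. GDERIV f x :> g x) \<and> continuous_on UNIV g
           \<and> compact (closure {x. norm (g x) \<noteq> 0}) \<longrightarrow>
           (SUP t\<in>{0<..}. ennreal t *
               epow (morrey_norm \<alpha> r (Dint t (\<gamma> / q) s \<gamma> f)) (1 / q))
           \<le> ennreal C *
             epow (SUP t\<in>{0<..}. ennreal t *
               epow (morrey_norm \<alpha> r (Dint t (\<gamma> / q0) s0 \<gamma> f)) (1 / q0)) (1 - \<eta>) *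
             epow (morrey_norm \<alpha> r (\<lambda>x. ennreal (norm (g x)))) \<eta>"
proof -
  have cond: "r = 1 \<longrightarrow> 0 < \<gamma> \<or> \<gamma> < -1" and \<alpha>: "0 < \<alpha>" and q: "0 < q" "0 < q0"
    using assms by auto
  obtain K where K: "0 < K" "\<And>(f :: 'a \<Rightarrow> real) g \<nu>. (\<And>x. GDERIV f x :> g x) \<Longrightarrow> continuous_on UNIV g \<Longrightarrow> 0 < \<nu> \<Longrightarrow>
    morrey_norm \<alpha> r (Dint \<nu> \<gamma> 1 \<gamma> f) \<le> ennreal (K / \<nu>) * morrey_norm \<alpha> r (\<lambda>x. ennreal (norm (g x)))"
    using morrey_Dint_endpoint[OF assms(1) \<alpha> assms(3) cond, where 'a='a] by blast
  define L where "L = 2 * 2 powr (1 / r)"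
  \<comment> \<open>At balanced levels the two terms add up to \<open>L * (1 + K) * Z\<close>, with
    \<open>L\<close> the constant of \<open>morrey_norm_add_le\<close>; the power
    \<open>1 / q\<close> is then taken.\<close>
  define C where "C = (L * (1 + K)) powr (1 / q)"
  have L: "0 < L" by (simp add: L_def)
  have C: "0 < C" using L K(1) by (simp add: C_def)
  \<comment> \<open>The relation for \<open>1 / q\<close> multiplied by \<gamma>, added to the one
    for \<open>s\<close>: interpolation with the endpoint exponents \<open>\<sigma>1 = 1\<close> and
    \<open>\<beta>1 = \<gamma>\<close>.\<close>
  have exponents: "s + \<gamma> / q = (1 - \<eta>) * (s0 + \<gamma> / q0) + \<eta> * (1 + \<gamma>)"
  proof -
    have "\<gamma> / q = \<gamma> * ((1 - \<eta>) / q0 + \<eta>)"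
      using assms(12) by (metis mult.right_neutral times_divide_eq_right)
    then show ?thesis using assms(11) by (simp add: algebra_simps add_divide_distrib diff_divide_distrib)
  qed
  show ?thesis
  proof (intro exI[of _ C] conjI allI impI C SUP_least)
    fix f :: "'a \<Rightarrow> real" and g :: "'a \<Rightarrow> 'a" and t :: real
    assume asm: "(\<forall>x. GDERIV f x :> g x) \<and> continuous_on UNIV g \<and> compact (closure {x. norm (g x) \<noteq> 0})"
      and "t \<in> {0<..}"
    then have t: "0 < t" and f: "\<And>x. GDERIV f x :> g x" and g: "continuous_on UNIV g"
      and cpt: "compact (closure {x. norm (g x) \<noteq> 0})" by auto
    have [measurable]: "f \<in> borel_measurable borel" by (rule GDERIV_borel_measurable[OF f])
    define N0 where "N0 = (SUP t\<in>{0<..}. ennreal t * epow (morrey_norm \<alpha> r (Dint t (\<gamma> / q0) s0 \<gamma> f)) (1 / q0))"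
    define M where "M = morrey_norm \<alpha> r (\<lambda>x. ennreal (norm (g x)))"
    \<comment> \<open>One term of the supremum solved for the norm; if \<open>N0\<close> is
      infinite, so is the right-hand side.\<close>
    have N0: "morrey_norm \<alpha> r (Dint \<mu> (\<gamma> / q0) s0 \<gamma> f) \<le> ennreal (\<mu> powr - q0) * epow N0 q0" if \<mu>: "0 < \<mu>" for \<mu>
    proof -
      let ?X = "morrey_norm \<alpha> r (Dint \<mu> (\<gamma> / q0) s0 \<gamma> f)"
      have "ennreal \<mu> * epow ?X (1 / q0) \<le> N0"
        unfolding N0_def using \<mu> by (intro SUP_upper2[of \<mu>]) auto
      then have "epow (ennreal \<mu> * epow ?X (1 / q0)) q0 \<le> epow N0 q0"
        using q by (intro epow_mono) auto
      then have "ennreal (\<mu> powr q0) * ?X \<le> epow N0 q0"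
        using q \<mu> by (simp add: epow_mult epow_epow epow_ennreal)
      then have "ennreal (\<mu> powr - q0) * (ennreal (\<mu> powr q0) * ?X) \<le> ennreal (\<mu> powr - q0) * epow N0 q0"
        by (intro mult_left_mono) auto
      then show ?thesis using \<mu> by (simp add: mult.assoc[symmetric] ennreal_mult[symmetric] powr_add[symmetric])
    qed
    have split: "morrey_norm \<alpha> r (Dint t (\<gamma> / q) s \<gamma> f)
      \<le> ennreal L * (ennreal (\<mu> powr - q0) * epow N0 q0 + ennreal (K / \<nu>) * M)"
      if \<mu>: "0 < \<mu>" and \<nu>: "0 < \<nu>" and "\<mu> powr (1 - \<eta>) * \<nu> powr \<eta> = t" for \<mu> \<nu>
    proof -
      have "Dset t (\<gamma> / q) s f \<subseteq> Dset \<mu> (\<gamma> / q0) s0 f \<union> Dset \<nu> \<gamma> 1 f"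
        using Dset_interpolation[OF assms(4,5) \<mu> \<nu> exponents] that(3) by simp
      then have "morrey_norm \<alpha> r (Dint t (\<gamma> / q) s \<gamma> f)
        \<le> morrey_norm \<alpha> r (\<lambda>x. Dint \<mu> (\<gamma> / q0) s0 \<gamma> f x + Dint \<nu> \<gamma> 1 \<gamma> f x)"
        using assms(1) by (intro morrey_norm_mono Dint_subadditive) auto
      also have "\<dots> \<le> ennreal L * (morrey_norm \<alpha> r (Dint \<mu> (\<gamma> / q0) s0 \<gamma> f) + morrey_norm \<alpha> r (Dint \<nu> \<gamma> 1 \<gamma> f))"
        unfolding L_def using assms(1) by (intro morrey_norm_add_le) auto
      also have "\<dots> \<le> ennreal L * (ennreal (\<mu> powr - q0) * epow N0 q0 + ennreal (K / \<nu>) * M)"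
        unfolding M_def by (intro mult_left_mono add_mono N0 K(2) f g \<mu> \<nu>) auto
      finally show ?thesis .
    qed
    have "M \<noteq> \<infinity>" unfolding M_def by (rule morrey_norm_finite[OF assms(1,2) g cpt])
    then obtain b where b: "0 \<le> b" "M = ennreal b" by (cases M) auto
    show "ennreal t * epow (morrey_norm \<alpha> r (Dint t (\<gamma> / q) s \<gamma> f)) (1 / q)
      \<le> ennreal C * epow (SUP t\<in>{0<..}. ennreal t * epow (morrey_norm \<alpha> r (Dint t (\<gamma> / q0) s0 \<gamma> f)) (1 / q0)) (1 - \<eta>) *
        epow (morrey_norm \<alpha> r (\<lambda>x. ennreal (norm (g x)))) \<eta>"
      unfolding N0_def[symmetric] M_def[symmetric]
    proof (cases "b = 0")
      \<comment> \<open>No positive level \<open>b / Z\<close> is available. The gradient vanishes,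
        so \<open>f\<close> is constant and its level sets are empty.\<close>
      case True
      then have "morrey_norm \<alpha> r (\<lambda>x. ennreal (norm (g x))) = 0"
        using b(2) by (simp add: M_def[symmetric])
      then have "g x = 0" for x
        by (rule morrey_norm_eq_0_imp[OF g assms(1)])
      then have "GDERIV f x :> 0" for x using f[of x] by simp
      then have "Dint t (\<gamma> / q) s \<gamma> f = (\<lambda>x. 0)" by (rule Dint_zero_gradient[OF _ t])
      then have "morrey_norm \<alpha> r (Dint t (\<gamma> / q) s \<gamma> f) = 0" by (simp add: morrey_norm_def)
      then show "ennreal t * epow (morrey_norm \<alpha> r (Dint t (\<gamma> / q) s \<gamma> f)) (1 / q) \<le> ennreal C * epow N0 (1 - \<eta>) * epow M \<eta>"
        by simp
    next
      case False
      then have b0: "0 < b" using b by simp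
      show "ennreal t * epow (morrey_norm \<alpha> r (Dint t (\<gamma> / q) s \<gamma> f)) (1 / q) \<le> ennreal C * epow N0 (1 - \<eta>) * epow M \<eta>"
      proof (cases N0)
        \<comment> \<open>\<open>epow M \<eta>\<close> is positive because \<open>b > 0\<close>, so
          the right-hand side is infinite.\<close>
        case top
        then show ?thesis using C b0 by (simp add: b epow_ennreal ennreal_mult_top ennreal_top_mult)
      next
        case (real a)
        show ?thesis
        proof (cases "a = 0")
          case True
          have "morrey_norm \<alpha> r (Dint t (\<gamma> / q) s \<gamma> f) \<le> ennreal e" if e: "0 < e" for e
          proof -
            \<comment> \<open>With \<open>a = 0\<close> the first term vanishes for every \<mu>, so
              \<nu> is free: it makes the second term equal to \<open>e\<close>, and \<mu> is then
              fixed by the constraint on the levels.\<close>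
            define \<nu> where "\<nu> = L * K * b / e"
            have \<nu>: "0 < \<nu>" using e L K(1) b0 by (simp add: \<nu>_def)
            define \<mu> where "\<mu> = (t / \<nu> powr \<eta>) powr (1 / (1 - \<eta>))"
            have \<mu>: "0 < \<mu>" using t \<nu> by (simp add: \<mu>_def)
            have "\<mu> powr (1 - \<eta>) * \<nu> powr \<eta> = t"
              using t \<nu> assms(5) by (simp add: \<mu>_def powr_powr)
            from split[OF \<mu> \<nu> this] have "morrey_norm \<alpha> r (Dint t (\<gamma> / q) s \<gamma> f) \<le> ennreal (L * (K / \<nu> * b))"
              using True real L K(1) \<nu> b by (simp add: ennreal_mult[symmetric])
            also have "L * (K / \<nu> * b) = e" using e L K(1) b0 by (simp add: \<nu>_def)
            finally show ?thesis .
          qed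
          then have "morrey_norm \<alpha> r (Dint t (\<gamma> / q) s \<gamma> f) = 0"
            using ennreal_le_epsilon[of 0 "morrey_norm \<alpha> r (Dint t (\<gamma> / q) s \<gamma> f)"] by simp
          then show ?thesis by simp
        next
          case False
          then have a: "0 < a" using real by simp
          define Z where "Z = (a powr (1 - \<eta>) * b powr \<eta> / t) powr q"
          note bal = balance_levels[OF a b0 t q assms(12), folded Z_def]
          have \<mu>: "0 < a * Z powr - (1 / q0)" and \<nu>: "0 < b / Z" using a b0 bal(3) by simp_all
          \<comment> \<open>The first term at the balanced levels is \<open>Z\<close>; the second,
            \<open>K / (b / Z) * b\<close>, is \<open>K * Z\<close>.\<close>
          have mu_q0: "(a * Z powr - (1 / q0)) powr - q0 * a powr q0 = Z"
          proof -
            have "(a * Z powr - (1 / q0)) powr - q0 * a powr q0 = a powr - q0 * a powr q0 * Z powr (- (1 / q0) * - q0)"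
              by (simp only: powr_mult powr_powr mult_ac)
            then show ?thesis using a bal(3) q by (simp add: powr_add[symmetric])
          qed
          have "morrey_norm \<alpha> r (Dint t (\<gamma> / q) s \<gamma> f)
            \<le> ennreal (L * ((a * Z powr - (1 / q0)) powr - q0 * a powr q0 + K / (b / Z) * b))"
          proof -
            have "ennreal L * (ennreal A * ennreal a' + ennreal B * ennreal b) = ennreal (L * (A * a' + B * b))"
              if "0 \<le> A" "0 \<le> a'" "0 \<le> B" for A B a'
              using that L b by (simp add: ennreal_mult[symmetric] ennreal_plus[symmetric] del: ennreal_plus)
            from this[of "(a * Z powr - (1 / q0)) powr - q0" "a powr q0" "K / (b / Z)"] show ?thesis
              using split[OF \<mu> \<nu> bal(1)] real b K(1) \<nu> by (simp only: epow_ennreal powr_ge_zero divide_nonneg_pos less_imp_le)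
          qed
          also have "L * ((a * Z powr - (1 / q0)) powr - q0 * a powr q0 + K / (b / Z) * b) = L * (1 + K) * Z"
            unfolding mu_q0 using b0 by (simp add: field_simps)
          finally have "ennreal t * epow (morrey_norm \<alpha> r (Dint t (\<gamma> / q) s \<gamma> f)) (1 / q)
            \<le> ennreal t * epow (ennreal (L * (1 + K) * Z)) (1 / q)"
            using q by (intro mult_left_mono epow_mono) auto
          also have "\<dots> = ennreal (t * (C * Z powr (1 / q)))"
            using L K(1) bal(3) t by (simp add: epow_ennreal powr_mult C_def ennreal_mult[symmetric])
          \<comment> \<open>\<open>Z\<close> was chosen so that \<open>t * Z powr (1 / q)\<close>
            does not depend on \<open>t\<close>; hence one constant serves all levels.\<close>
          also have "t * (C * Z powr (1 / q)) = C * (a powr (1 - \<eta>) * b powr \<eta>)"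
            using bal(2) by (simp add: mult.left_commute)
          also have "ennreal \<dots> = ennreal C * epow N0 (1 - \<eta>) * epow M \<eta>"
            using C real b by (simp add: epow_ennreal ennreal_mult mult.assoc)
          finally show ?thesis .
        qed
      qed
    qed
  qed
qed

end
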